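(* For each even integer $m\ge 2$, the $(m+1)^{st}$ first-order Toda bracket associated to the homotopy chain map $\phi_{*,\bullet}:C(m)_{*,\bullet}\to D(m)_{*,\bullet}$, namely $$T(2,m-1;\phi):\Sigma C(m)_{*,m+1}\longrightarrow D(m)_{*,m-1},$$ is non-zero.
   Context: $\Gamma(m)_{\bullet}$ is the free simplicial group with $\Gamma(m)_j=\{id\}$ for $j<m-1$, $\Gamma(m)_{m-1}=\mathbb{Z}$ on a generator $\iota_{m-1}$, and $\Gamma(m)_{m+k}$ $(k\ge0)$ the free group on the generators $s_{\alpha}(\iota_{m-1})$, where $s_{\alpha}$ ranges over iterated degeneracies from dimension $m-1$ to dimension $m+k$ (a model for $\Omega S^m$). $CC_*(A)$ is the cyclic complex of a $\mathbb{C}$-algebra $A$, and $D(m)_{*,\bullet}:=CC_*(\mathbb{C}[\Gamma(m)_{\bullet}])$ (applied degreewise). For a group $G$, $\langle G\rangle$ is the set of conjugacy classes, $\langle x\rangle$ the class of $x$, $C_x$ the centralizer of $x$. Canonical centralizers: for a free group $F$ and $y\ne 1$, $C_y$ is infinite cyclic, generated by the element $x_y\in F$ of shortest length such that $y$ is a (positive) power of $x_y$. For conjugate $y,y'$, $C_y$ and $C_{y'}$ are identified by $x_y\mapsto x_{y'}$, and $C_{\langle y\rangle}$ denotes the resulting group; $C_{\langle 1\rangle}=F$. A homomorphism $\lambda$ of free groups induces $C_{\langle x\rangle}\to C_{\langle\lambda(x)\rangle}$ by restriction and these identifications. $BC_{\langle x\rangle}$ is the nerve with the twisted cyclic structure $t_n(g_1,\dots,g_n)=(x(g_1\cdots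 g_n)^{-1},g_1,\dots,g_{n-1})$. For a free group $F$, $$\widetilde{CC}_*(\mathbb{C}[F]):=C_*(BF;\mathbb{C})\otimes CC_*(\mathbb{C})\oplus\bigoplus_{\langle id\rangle\ne\langle x\rangle\in\langle F\rangle}C_*(B(C_{\langle x\rangle}/(\langle x\rangle));\mathbb{C}),$$ which is the cyclic chain complex (in characteristic $0$) associated to the cyclic set $\coprod_{\langle x\rangle\in\langle F\rangle}BC_{\langle x\rangle}$, functorial in the free group $F$ in this way. $C(m)_{*,\bullet}:=\widetilde{CC}_*(\mathbb{C}[\Gamma(m)_{\bullet}])$ (applied degreewise). The maps $\phi_n:C(m)_{*,n}\to D(m)_{*,n}$: the cyclic bar construction $N^{cy}(G)$ has $N^{cy}(G)_n=G^{n+1}$, faces multiplying adjacent entries cyclically, and $t_n(g_0,\dots,g_n)=(g_n,g_0,\dots,g_{n-1})$; its cyclic complex over $\mathbb{C}$ is $CC_*(\mathbb{C}[G])$. Choosing a representative $x$ of each conjugacy class of $\Gamma(m)_n$, the maps of cyclic sets $BC_{\langle x\rangle}\cong BC_x\to N^{cy}(\Gamma(m)_n)$, $(g_1,\dots,g_k)\mapsto((g_1\cdots g_k)^{-1}x,g_1,\dots,g_k)$ (with $x_y\mapsto x_x$ the canonical identification for $C_{\langle x\rangle}\cong C_x$) induce a quasi-isomorphism $\phi_n$. These commute with the simplicial structure maps up to canonical chain homotopy, the homotopies being induced by the canonical homotopies from conjugation maps on $N^{cy}(\Gamma(m)_k)$ to the identity. So $\phi$ defines a map of simplicial objects in the homotopy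 category of bounded-below chain complexes over $\mathbb{C}$. First-order Toda bracket: write $d^C_n:C(m)_{*,n}\to C(m)_{*,n-1}$ and $d^D_n$ for the alternating sums of face maps. Since $\phi_nd^C_{n+1}\simeq d^D_{n+1}\phi_{n+1}$ for each $n$, choose chain homotopies $s_{n+1}:C(m)_{*,n+1}\to D(m)_{*+1,n}$ (built from the canonical ones) witnessing this. The map $\phi_nd^C_{n+1}d^C_{n+2}-d^D_{n+1}d^D_{n+2}\phi_{n+2}$ then has two nullhomotopies, one from these chain homotopies and one from $d^Cd^C=0=d^Dd^D$; they determine the map $T(2,n;\phi):\Sigma C(m)_{*,n+2}\to D(m)_{*,n}$ in the homotopy category, given up to sign conventions by $s_{n+1}d^C_{n+2}+d^D_{n+1}s_{n+2}$. Non-zero means its class in the homotopy category is non-zero. *)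

theory Defs
  imports
    Complex_Main
    "HOL-Library.FuncSet"
    "HOL-Library.Poly_Mapping"
    "HOL-Algebra.Group_Action"
begin

section \<open>Chain complexes of complex vector spaces\<close>

text \<open>All vector spaces below are free on a set of basis elements of type \<open>'a\<close> and are realised as
  subspaces of \<open>'a \<Rightarrow>\<^sub>0 complex\<close>, the finitely supported functions.\<close>

definition cscale :: "complex \<Rightarrow> ('a \<Rightarrow>\<^sub>0 complex) \<Rightarrow> ('a \<Rightarrow>\<^sub>0 complex)"
  where "cscale a c = Poly_Mapping.map ((*) a) c"

lemma lookup_cscale: "Poly_Mapping.lookup (cscale a c) x = a * Poly_Mapping.lookup c x"
  unfolding cscale_def by (simp add: Poly_Mapping.map.rep_eq when_def)

lemma vector_space_cscale: "vector_space cscale"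
  by standard (auto intro!: poly_mapping_eqI simp: lookup_cscale lookup_add algebra_simps)

definition cextend :: "('a \<Rightarrow> 'b \<Rightarrow>\<^sub>0 complex) \<Rightarrow> ('a \<Rightarrow>\<^sub>0 complex) \<Rightarrow> ('b \<Rightarrow>\<^sub>0 complex)"
  where "cextend f c = (\<Sum>x\<in>Poly_Mapping.keys c. cscale (Poly_Mapping.lookup c x) (f x))"

text \<open>Only the restriction of \<open>bdry C n\<close> to \<open>chains C n\<close> is meaningful; it takes values in
  \<open>chains C (n - 1)\<close> and vanishes for \<open>n = 0\<close>.\<close>

record 'a chain_cx =
  chains :: "nat \<Rightarrow> ('a \<Rightarrow>\<^sub>0 complex) set"
  bdry :: "nat \<Rightarrow> ('a \<Rightarrow>\<^sub>0 complex) \<Rightarrow> ('a \<Rightarrow>\<^sub>0 complex)"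

type_synonym ('a, 'b) gmap = "nat \<Rightarrow> ('a \<Rightarrow>\<^sub>0 complex) \<Rightarrow> ('b \<Rightarrow>\<^sub>0 complex)"

text \<open>Linearity on the whole ambient type is no restriction, because a linear map on the subspace
  \<open>chains C n\<close> always extends.\<close>

definition graded_map :: "nat \<Rightarrow> 'a chain_cx \<Rightarrow> 'b chain_cx \<Rightarrow> ('a, 'b) gmap \<Rightarrow> bool"
  where "graded_map k C D f \<longleftrightarrow>
    (\<forall>n. Vector_Spaces.linear cscale cscale (f n) \<and> f n ` chains C n \<subseteq> chains D (n + k))"

definition chain_map :: "'a chain_cx \<Rightarrow> 'b chain_cx \<Rightarrow> ('a, 'b) gmap \<Rightarrow> bool"
  where "chain_map C D f \<longleftrightarrow> graded_map 0 C D f \<and>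
    (\<forall>n. \<forall>x\<in>chains C n. bdry D n (f n x) = f (n - 1) (bdry C n x))"

definition chain_homotopy ::
    "'a chain_cx \<Rightarrow> 'b chain_cx \<Rightarrow> ('a, 'b) gmap \<Rightarrow> ('a, 'b) gmap \<Rightarrow> ('a, 'b) gmap \<Rightarrow> bool"
  where "chain_homotopy C D f g s \<longleftrightarrow> graded_map 1 C D s \<and>
    (\<forall>n. \<forall>x\<in>chains C n. bdry D (n + 1) (s n x) + s (n - 1) (bdry C n x) = f n x - g n x)"

definition null_homotopic :: "'a chain_cx \<Rightarrow> 'b chain_cx \<Rightarrow> ('a, 'b) gmap \<Rightarrow> bool"
  where "null_homotopic C D f \<longleftrightarrow> (\<exists>s. chain_homotopy C D f (\<lambda>_ _. 0) s)"

definition suspension :: "'a chain_cx \<Rightarrow> 'a chain_cx"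
  where "suspension C = \<lparr>chains = (\<lambda>n. if n = 0 then {0} else chains C (n - 1)),
                          bdry = (\<lambda>n x. - bdry C (n - 1) x)\<rparr>"

text \<open>A degree one map \<open>f\<close> from \<open>C\<close> to \<open>D\<close>, viewed as a degree zero map on \<open>suspension C\<close>.\<close>

definition from_suspension :: "('a, 'b) gmap \<Rightarrow> ('a, 'b) gmap"
  where "from_suspension f = (\<lambda>n. f (n - 1))"


section \<open>Cyclic sets and their cyclic complexes\<close>

text \<open>The degeneracies of a cyclic set do not enter its cyclic complex and are not recorded.\<close>

record 'a cyclic_set =
  cells :: "nat \<Rightarrow> 'a set"
  face :: "nat \<Rightarrow> nat \<Rightarrow> 'a \<Rightarrow> 'a"
  cyc :: "nat \<Rightarrow> 'a \<Rightarrow> 'a"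

text \<open>The total complex of the cyclic bicomplex of the cyclic vector space spanned by \<open>X\<close>: the basis
  element \<open>(p, x)\<close> with \<open>x\<close> a \<open>q\<close>-simplex sits in column \<open>p\<close> and row \<open>q\<close>. Columns carry \<open>b\<close> (\<open>p\<close> even)
  or \<open>- b'\<close> (\<open>p\<close> odd), rows carry \<open>1 - t\<close> (\<open>p\<close> odd) or the norm \<open>N\<close> (\<open>p\<close> even), where \<open>t\<close> is
  \<open>(- 1) ^ q\<close> times the cyclic operator.\<close>

definition cyclic_vert :: "'a cyclic_set \<Rightarrow> nat \<Rightarrow> nat \<Rightarrow> 'a \<Rightarrow> (nat \<times> 'a) \<Rightarrow>\<^sub>0 complex"
  where "cyclic_vert X p q x =
    (if q = 0 then 0
     else if even p then (\<Sum>i\<le>q. Poly_Mapping.single (p, face X q i x) ((- 1) ^ i))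
     else - (\<Sum>i<q. Poly_Mapping.single (p, face X q i x) ((- 1) ^ i)))"

definition cyclic_horiz :: "'a cyclic_set \<Rightarrow> nat \<Rightarrow> nat \<Rightarrow> 'a \<Rightarrow> (nat \<times> 'a) \<Rightarrow>\<^sub>0 complex"
  where "cyclic_horiz X p q x =
    (if p = 0 then 0
     else if odd p then
       Poly_Mapping.single (p - 1, x) 1 - Poly_Mapping.single (p - 1, cyc X q x) ((- 1) ^ q)
     else (\<Sum>j\<le>q. Poly_Mapping.single (p - 1, (cyc X q ^^ j) x) ((- 1) ^ (q * j))))"

definition CC :: "'a cyclic_set \<Rightarrow> (nat \<times> 'a) chain_cx"
  where "CC X = \<lparr>chains = (\<lambda>n. {c. Poly_Mapping.keys c \<subseteq> {(p, x). p \<le> n \<and> x \<in> cells X (n - p)}}),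
                  bdry = (\<lambda>n. cextend (\<lambda>(p, x). cyclic_vert X p (n - p) x + cyclic_horiz X p (n - p) x))\<rparr>"

definition CC_map :: "('a \<Rightarrow> 'b) \<Rightarrow> ((nat \<times> 'a) \<Rightarrow>\<^sub>0 complex) \<Rightarrow> ((nat \<times> 'b) \<Rightarrow>\<^sub>0 complex)"
  where "CC_map f = cextend (\<lambda>(p, x). Poly_Mapping.single (p, f x) 1)"

definition cyclic_prod :: "'a cyclic_set \<Rightarrow> 'b cyclic_set \<Rightarrow> ('a \<times> 'b) cyclic_set"
  where "cyclic_prod X Y = \<lparr>cells = (\<lambda>n. cells X n \<times> cells Y n),
                             face = (\<lambda>n i. map_prod (face X n i) (face Y n i)),
                             cyc = (\<lambda>n. map_prod (cyc X n) (cyc Y n))\<rparr>"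

definition Ncy :: "('g, 'k) monoid_scheme \<Rightarrow> 'g list cyclic_set"
  where "Ncy G = \<lparr>cells = (\<lambda>n. {gs \<in> lists (carrier G). length gs = n + 1}),
                   face = (\<lambda>n i gs. if i < n
                             then take i gs @ (gs ! i \<otimes>\<^bsub>G\<^esub> gs ! (i + 1)) # drop (i + 2) gs
                             else (last gs \<otimes>\<^bsub>G\<^esub> hd gs) # tl (butlast gs)),
                   cyc = (\<lambda>n gs. last gs # butlast gs)\<rparr>"


section \<open>The canonical homotopy from a conjugation to the identity\<close>

text \<open>The cyclic nerve of the groupoid with two objects \<open>False\<close>, \<open>True\<close> and exactly one morphism
  between any two of them; a closed string of \<open>n + 1\<close> morphisms is the list of its \<open>n + 1\<close> objects.
  In the cyclic nerve of the product of \<open>G\<close> with this groupoid, the \<open>i\<close>-th entry of \<open>gs\<close>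
  belongs to a morphism between the \<open>i\<close>-th and the (cyclically) next object of \<open>es\<close>.\<close>

definition Ncy_interval :: "bool list cyclic_set"
  where "Ncy_interval = \<lparr>cells = (\<lambda>n. {es. length es = n + 1}),
                          face = (\<lambda>n i es. if i < n then take (i + 1) es @ drop (i + 2) es
                                            else last es # tl (butlast es)),
                          cyc = (\<lambda>n es. last es # butlast es)\<rparr>"

text \<open>Conjugation by \<open>h\<close> is naturally isomorphic to the identity functor of \<open>G\<close>, and the natural
  isomorphism is a functor from the product of \<open>G\<close> with the interval groupoid to \<open>G\<close>; this is the
  induced map of cyclic nerves.\<close>

definition conj_transport ::
    "('g, 'k) monoid_scheme \<Rightarrow> 'g \<Rightarrow> 'g list \<times> bool list \<Rightarrow> 'g list"
  where "conj_transport G h = (\<lambda>(gs, es).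
    let u = (\<lambda>e. if e then h else \<one>\<^bsub>G\<^esub>) in
    map (\<lambda>i. u (es ! i) \<otimes>\<^bsub>G\<^esub> gs ! i \<otimes>\<^bsub>G\<^esub> inv\<^bsub>G\<^esub> (u (es ! (Suc i mod length gs)))) [0..<length gs])"

text \<open>The projection of \<open>Ncy G\<close> times the interval to \<open>Ncy G\<close> is a homotopy equivalence on cyclic
  complexes, so the two end inclusions are joined by a chain homotopy lying over the constant one,
  unique up to higher homotopy. The canonical homotopy \<open>K\<close> from conjugation by \<open>h\<close> to the identity
  is its image under \<open>conj_transport G h\<close>.\<close>

definition canonical_conj_homotopy ::
    "('g, 'k) monoid_scheme \<Rightarrow> 'g \<Rightarrow> (nat \<times> 'g list, nat \<times> 'g list) gmap \<Rightarrow> bool"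
  where "canonical_conj_homotopy G h K \<longleftrightarrow> (\<exists>L.
    chain_homotopy (CC (Ncy G)) (CC (cyclic_prod (Ncy G) Ncy_interval))
      (\<lambda>_. CC_map (\<lambda>gs. (gs, replicate (length gs) True)))
      (\<lambda>_. CC_map (\<lambda>gs. (gs, replicate (length gs) False))) L \<and>
    null_homotopic (suspension (CC (Ncy G))) (CC (Ncy G)) (from_suspension (\<lambda>n. CC_map fst \<circ> L n)) \<and>
    K = (\<lambda>n. CC_map (conj_transport G h) \<circ> L n))"


section \<open>Free groups, conjugacy classes and canonical centralizers\<close>

type_synonym 'a word = "('a \<times> bool) list"

text \<open>\<open>(a, True)\<close> is the generator \<open>a\<close> and \<open>(a, False)\<close> its inverse. Elements are reduced words,
  so \<open>length\<close> is the word length.\<close>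

definition push :: "'a \<times> bool \<Rightarrow> 'a word \<Rightarrow> 'a word"
  where "push l w = (case w of [] \<Rightarrow> [l]
    | l' # w' \<Rightarrow> if l' = (fst l, \<not> snd l) then w' else l # w)"

definition reduce :: "'a word \<Rightarrow> 'a word"
  where "reduce w = foldr push w []"

definition free_group :: "'a set \<Rightarrow> 'a word monoid"
  where "free_group S = \<lparr>carrier = {w \<in> lists (S \<times> UNIV). reduce w = w},
                          mult = (\<lambda>u v. reduce (u @ v)), one = []\<rparr>"

definition free_hom :: "('g, 'k) monoid_scheme \<Rightarrow> ('a \<Rightarrow> 'g) \<Rightarrow> 'a word \<Rightarrow> 'g"
  where "free_hom G f w =
    foldr (\<lambda>(a, e) g. (if e then f a else inv\<^bsub>G\<^esub> (f a)) \<otimes>\<^bsub>G\<^esub> g) w \<one>\<^bsub>G\<^esub>"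

definition conj_action :: "('g, 'k) monoid_scheme \<Rightarrow> 'g \<Rightarrow> 'g \<Rightarrow> 'g"
  where "conj_action G = (\<lambda>g. \<lambda>h\<in>carrier G. g \<otimes>\<^bsub>G\<^esub> h \<otimes>\<^bsub>G\<^esub> inv\<^bsub>G\<^esub> g)"

abbreviation conj_class :: "('g, 'k) monoid_scheme \<Rightarrow> 'g \<Rightarrow> 'g set"
  where "conj_class G x \<equiv> orbit G (conj_action G) x"

abbreviation conj_classes :: "('g, 'k) monoid_scheme \<Rightarrow> 'g set set"
  where "conj_classes G \<equiv> orbits G (carrier G) (conj_action G)"

abbreviation centralizer :: "('g, 'k) monoid_scheme \<Rightarrow> 'g \<Rightarrow> 'g set"
  where "centralizer G x \<equiv> stabilizer G (conj_action G) x"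

definition free_root :: "'a word monoid \<Rightarrow> 'a word \<Rightarrow> 'a word"
  where "free_root F y = arg_min length (\<lambda>x. x \<in> carrier F \<and> (\<exists>n>0. y = x [^]\<^bsub>F\<^esub> (n::nat)))"

text \<open>The group obtained from the centralizers \<open>C\<^sub>y\<close>, \<open>y \<in> c\<close>, by identifying the generators
  \<open>free_root F y\<close>: an element is the family of its representatives, one in each \<open>C\<^sub>y\<close>.\<close>

definition class_centralizer :: "'a word monoid \<Rightarrow> 'a word set \<Rightarrow> ('a word \<Rightarrow> 'a word) monoid"
  where "class_centralizer F c =
    \<lparr>carrier = {\<gamma> \<in> (\<Pi>\<^sub>E y\<in>c. centralizer F y).
                 c \<noteq> {\<one>\<^bsub>F\<^esub>} \<longrightarrow> (\<exists>k::int. \<forall>y\<in>c. \<gamma> y = free_root F y [^]\<^bsub>F\<^esub> k)},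
     mult = (\<lambda>\<gamma> \<delta>. \<lambda>y\<in>c. \<gamma> y \<otimes>\<^bsub>F\<^esub> \<delta> y), one = (\<lambda>y\<in>c. \<one>\<^bsub>F\<^esub>)\<rparr>"

text \<open>For a homomorphism \<open>f\<close> into \<open>F'\<close> the classes united here all coincide.\<close>

definition class_map :: "'b word monoid \<Rightarrow> ('a word \<Rightarrow> 'b word) \<Rightarrow> 'a word set \<Rightarrow> 'b word set"
  where "class_map F' f c = (\<Union>y\<in>c. conj_class F' (f y))"

definition class_centralizer_map ::
    "'b word monoid \<Rightarrow> ('a word \<Rightarrow> 'b word) \<Rightarrow> 'a word set \<Rightarrow> ('a word \<Rightarrow> 'a word) \<Rightarrow> 'b word \<Rightarrow> 'b word"
  where "class_centralizer_map F' f c \<gamma> =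
    (THE \<gamma>'. \<gamma>' \<in> carrier (class_centralizer F' (class_map F' f c)) \<and> (\<forall>y\<in>c. \<gamma>' (f y) = f (\<gamma> y)))"


section \<open>The cyclic set of twisted nerves of the canonical centralizers\<close>

definition mprod :: "('g, 'k) monoid_scheme \<Rightarrow> 'g list \<Rightarrow> 'g"
  where "mprod G gs = foldr (\<otimes>\<^bsub>G\<^esub>) gs \<one>\<^bsub>G\<^esub>"

definition twisted_nerve :: "('g, 'k) monoid_scheme \<Rightarrow> 'g \<Rightarrow> 'g list cyclic_set"
  where "twisted_nerve G z = \<lparr>cells = (\<lambda>n. {gs \<in> lists (carrier G). length gs = n}),
     face = (\<lambda>n i gs. if i = 0 then tl gs else if i = n then butlast gs
                      else take (i - 1) gs @ (gs ! (i - 1) \<otimes>\<^bsub>G\<^esub> gs ! i) # drop (i + 1) gs),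
     cyc = (\<lambda>n gs. if n = 0 then gs else (z \<otimes>\<^bsub>G\<^esub> inv\<^bsub>G\<^esub> (mprod G gs)) # butlast gs)\<rparr>"

text \<open>In \<open>BC F c\<close> the twist is the element of the canonical centralizer represented by
  \<open>y \<in> C\<^sub>y\<close> for each \<open>y \<in> c\<close>.\<close>

definition BC :: "'a word monoid \<Rightarrow> 'a word set \<Rightarrow> ('a word \<Rightarrow> 'a word) list cyclic_set"
  where "BC F c = twisted_nerve (class_centralizer F c) (\<lambda>y\<in>c. y)"

type_synonym 'a tsimplex = "'a word set \<times> ('a word \<Rightarrow> 'a word) list"

definition centralizer_nerve :: "'a word monoid \<Rightarrow> 'a tsimplex cyclic_set"
  where "centralizer_nerve F =
    \<lparr>cells = (\<lambda>n. {(c, gs). c \<in> conj_classes F \<and> gs \<in> cells (BC F c) n}),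
     face = (\<lambda>n i (c, gs). (c, face (BC F c) n i gs)),
     cyc = (\<lambda>n (c, gs). (c, cyc (BC F c) n gs))\<rparr>"

definition centralizer_nerve_map ::
    "'b word monoid \<Rightarrow> ('a word \<Rightarrow> 'b word) \<Rightarrow> 'a tsimplex \<Rightarrow> 'b tsimplex"
  where "centralizer_nerve_map F' f = (\<lambda>(c, gs).
    (class_map F' f c, map (class_centralizer_map F' f c) gs))"

text \<open>Evaluation at \<open>r c\<close> is the identification of the canonical centralizer of \<open>c\<close> with the
  centralizer of the chosen representative \<open>r c\<close>.\<close>

definition nerve_to_Ncy ::
    "'a word monoid \<Rightarrow> ('a word set \<Rightarrow> 'a word) \<Rightarrow> 'a tsimplex \<Rightarrow> 'a word list"
  where "nerve_to_Ncy F r = (\<lambda>(c, gs).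
    let hs = map (\<lambda>\<gamma>. \<gamma> (r c)) gs in (inv\<^bsub>F\<^esub> (mprod F hs) \<otimes>\<^bsub>F\<^esub> r c) # hs)"


section \<open>The free simplicial group\<close>

text \<open>Iterated degeneracies from dimension \<open>m - 1\<close> to dimension \<open>n\<close> are in bijection with the
  monotone surjections from \<open>{0..n}\<close> onto \<open>{0..m - 1}\<close>; these are encoded by their lists of values.
  A simplicial operator, given by a monotone \<open>\<theta>\<close> from \<open>{0..k}\<close> to \<open>{0..n}\<close>, acts by precomposition;
  if the composite is not surjective, it factors through a proper face of the generating
  simplex, which is the identity element.\<close>

definition Gamma_gens :: "nat \<Rightarrow> nat \<Rightarrow> nat list set"
  where "Gamma_gens m n = {\<alpha>. length \<alpha> = n + 1 \<and> sorted \<alpha> \<and> set \<alpha> = {..<m}}"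

definition Gamma :: "nat \<Rightarrow> nat \<Rightarrow> nat list word monoid"
  where "Gamma m n = free_group (Gamma_gens m n)"

definition Gamma_op :: "nat \<Rightarrow> nat list \<Rightarrow> nat list word \<Rightarrow> nat list word"
  where "Gamma_op m \<theta> = free_hom (Gamma m (length \<theta> - 1))
    (\<lambda>\<alpha>. let \<beta> = map ((!) \<alpha>) \<theta> in if set \<beta> = {..<m} then [(\<beta>, True)] else [])"

definition Gamma_face :: "nat \<Rightarrow> nat \<Rightarrow> nat \<Rightarrow> nat list word \<Rightarrow> nat list word"
  where "Gamma_face m n i = Gamma_op m ([0..<i] @ [Suc i..<Suc n])"


section \<open>The simplicial chain complexes, the homotopy chain map and its Toda bracket\<close>

type_synonym cbasis = "nat \<times> nat list tsimplex"
type_synonym dbasis = "nat \<times> nat list word list"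

definition C_cx :: "nat \<Rightarrow> nat \<Rightarrow> cbasis chain_cx"
  where "C_cx m n = CC (centralizer_nerve (Gamma m n))"

definition D_cx :: "nat \<Rightarrow> nat \<Rightarrow> dbasis chain_cx"
  where "D_cx m n = CC (Ncy (Gamma m n))"

definition C_face :: "nat \<Rightarrow> nat \<Rightarrow> nat \<Rightarrow> (cbasis \<Rightarrow>\<^sub>0 complex) \<Rightarrow> (cbasis \<Rightarrow>\<^sub>0 complex)"
  where "C_face m n i = CC_map (centralizer_nerve_map (Gamma m (n - 1)) (Gamma_face m n i))"

definition D_face :: "nat \<Rightarrow> nat \<Rightarrow> nat \<Rightarrow> (dbasis \<Rightarrow>\<^sub>0 complex) \<Rightarrow> (dbasis \<Rightarrow>\<^sub>0 complex)"
  where "D_face m n i = CC_map (map (Gamma_face m n i))"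

definition C_diff :: "nat \<Rightarrow> nat \<Rightarrow> (cbasis \<Rightarrow>\<^sub>0 complex) \<Rightarrow> (cbasis \<Rightarrow>\<^sub>0 complex)"
  where "C_diff m n x = (\<Sum>i\<le>n. cscale ((- 1) ^ i) (C_face m n i x))"

definition D_diff :: "nat \<Rightarrow> nat \<Rightarrow> (dbasis \<Rightarrow>\<^sub>0 complex) \<Rightarrow> (dbasis \<Rightarrow>\<^sub>0 complex)"
  where "D_diff m n x = (\<Sum>i\<le>n. cscale ((- 1) ^ i) (D_face m n i x))"

definition class_reps :: "nat \<Rightarrow> (nat \<Rightarrow> nat list word set \<Rightarrow> nat list word) \<Rightarrow> bool"
  where "class_reps m r \<longleftrightarrow> (\<forall>n. \<forall>c\<in>conj_classes (Gamma m n). r n c \<in> c)"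

definition phi :: "nat \<Rightarrow> (nat \<Rightarrow> nat list word set \<Rightarrow> nat list word) \<Rightarrow> nat \<Rightarrow>
    (cbasis \<Rightarrow>\<^sub>0 complex) \<Rightarrow> (dbasis \<Rightarrow>\<^sub>0 complex)"
  where "phi m r n = CC_map (nerve_to_Ncy (Gamma m n) (r n))"

text \<open>For each face index \<open>i\<close> and each class \<open>c\<close>, on the summand of \<open>c\<close> the composite of the face
  map of \<open>C\<close> with \<open>\<phi>\<close> is the composite of \<open>\<phi>\<close>, the face map of \<open>D\<close> and conjugation by some \<open>\<kappa> i c\<close>.
  The maps \<open>K i c\<close> are the canonical homotopies from these conjugations to the identity, and \<open>s\<close> is
  assembled from them. The index \<open>n\<close> is that of the source \<open>C_cx m n\<close> of \<open>s\<close>.\<close>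

definition canonical_homotopy :: "nat \<Rightarrow> (nat \<Rightarrow> nat list word set \<Rightarrow> nat list word) \<Rightarrow> nat \<Rightarrow>
    (cbasis, dbasis) gmap \<Rightarrow> bool"
  where "canonical_homotopy m r n s \<longleftrightarrow>
    chain_homotopy (C_cx m n) (D_cx m (n - 1))
      (\<lambda>_. phi m r (n - 1) \<circ> C_diff m n) (\<lambda>_. D_diff m n \<circ> phi m r n) s \<and>
    (\<exists>\<kappa> K.
      (\<forall>i\<le>n. \<forall>c\<in>conj_classes (Gamma m n).
        (let F = Gamma m n; F' = Gamma m (n - 1); d = Gamma_face m n i in
          \<kappa> i c \<in> carrier F' \<and>
          (\<forall>\<gamma>\<in>carrier (class_centralizer F c).
            class_centralizer_map F' d c \<gamma> (r (n - 1) (class_map F' d c))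
              = \<kappa> i c \<otimes>\<^bsub>F'\<^esub> d (\<gamma> (r n c)) \<otimes>\<^bsub>F'\<^esub> inv\<^bsub>F'\<^esub> (\<kappa> i c)) \<and>
          canonical_conj_homotopy F' (\<kappa> i c) (K i c))) \<and>
      s = (\<lambda>k. cextend (\<lambda>(p, c, gs). \<Sum>i\<le>n. cscale ((- 1) ^ i)
            (K i c k (D_face m n i (phi m r n (Poly_Mapping.single (p, c, gs) 1)))))))"

text \<open>\<open>s n\<close> is the homotopy with source \<open>C_cx m n\<close>, for \<open>n \<ge> 1\<close>.\<close>

definition toda_bracket2 :: "nat \<Rightarrow> nat \<Rightarrow> (nat \<Rightarrow> (cbasis, dbasis) gmap) \<Rightarrow> (cbasis, dbasis) gmap"
  where "toda_bracket2 m n s =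
    from_suspension (\<lambda>k x. s (n + 1) k (C_diff m (n + 2) x) + D_diff m (n + 1) (s (n + 2) k x))"

end

theory Submission
  imports Defs
begin

text \<open>The bracket is evaluated on a single cycle and shown to have a non-zero residue there.

  In dimension \<open>m + 1\<close> of the free simplicial group there are three generators \<open>X\<close>, \<open>Y\<close>, \<open>Z\<close> such that
  the words \<open>w = X\<inverse> Y Z\<close> and \<open>w' = X\<inverse> Z Y\<close>, which differ by a transposition of letters, have conjugate
  \<open>j\<close>-th faces for every \<open>j\<close>. The difference \<open>z\<close> of the two classes is therefore a chain in degree
  \<open>0\<close> of \<open>C(m)\<close> all of whose faces vanish (\<open>C_diff_z\<close>), and only the summand \<open>d\<^sup>D s\<close> of the bracket
  contributes to the image of \<open>z\<close>. This image is a chain of degree one in the cyclic complex of the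
  group ring of the infinite cyclic group in dimension \<open>m - 1\<close>. The residue of the differential form
  \<open>g dh\<close> is a functional on such chains that vanishes on boundaries (\<open>log_form_bdry\<close>), so a
  null-homotopic bracket would have residue zero on \<open>z\<close>.

  The residue of the canonical homotopy from the conjugation by \<open>\<kappa>\<close> to the identity, at an element
  of exponent zero, is minus the exponent of \<open>\<kappa>\<close> (\<open>log_form_conj_homotopy\<close>). Hence, up to sign, the
  residue of the bracket is an alternating sum, over the indices \<open>j\<close> and \<open>i\<close> of faces out of dimensions
  \<open>m + 1\<close> and \<open>m\<close> for which the iterated face of \<open>w\<close> has exponent zero, of the exponents \<open>\<epsilon> i\<close> of the
  \<open>i\<close>-th faces of the conjugating elements for the \<open>j\<close>-th face. These elements depend on choices. Those for a fixed non-trivial element differ by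
  elements of a centralizer, and the centralizers in a free group are cyclic, so the differences have
  exponent zero (\<open>additive_conjugators\<close>); for a trivial element the alternating sum over \<open>i\<close> is zero
  for every choice (\<open>sum_face_exponent\<close>). The choice of representatives of the classes of \<open>w\<close> and \<open>w'\<close>
  adds terms that cancel by the simplicial identities (\<open>gauge_sum\<close>). What remains is the holonomy of
  the conjugations that carry the faces of \<open>w\<close> to those of \<open>w'\<close>, and it is equal to \<open>1\<close>
  (\<open>holonomy_sum\<close>).

  That canonical homotopies exist rests on two facts. In a free group the root of a non-trivial element
  generates its centralizer and is compatible with conjugation, so the canonical centralizers are functorial and the
  square formed by \<open>\<phi>\<close> and a face commutes on the summand of a class up to one conjugation. And the
  projection from the cylinder over the cyclic nerve has an acyclic kernel (\<open>kernel_acyclic\<close>), so the two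
  ends of the cylinder are joined by a homotopy inside this kernel. That the bracket is a chain map
  follows formally from the homotopy equations and the simplicial identities.\<close>

section \<open>Reduced words and free groups\<close>

definition neg :: "'a \<times> bool \<Rightarrow> 'a \<times> bool"
  where "neg l = (fst l, \<not> snd l)"

lemma neg_simps [simp]: "neg (neg l) = l" "neg (a, e) = (a, \<not> e)" "fst (neg l) = fst l" "neg l \<noteq> l" "l \<noteq> neg l"
  by (auto simp: neg_def prod_eq_iff)

lemma neg_eq_iff [simp]: "neg k = neg l \<longleftrightarrow> k = l"
  by (metis neg_simps(1))

definition winv :: "'a word \<Rightarrow> 'a word"
  where "winv w = rev (map neg w)"

lemma winv_simps [simp]: "winv [] = []" "winv (l # w) = winv w @ [neg l]" "winv (u @ v) = winv v @ winv u"
  "winv (winv w) = w" "length (winv w) = length w" "winv w = [] \<longleftrightarrow> w = []"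
  by (auto simp: winv_def rev_map o_def)

abbreviation reduced :: "'a word \<Rightarrow> bool"
  where "reduced \<equiv> successively (\<lambda>k l. l \<noteq> neg k)"

lemma push_Nil [simp]: "push l [] = [l]"
  and push_Cons: "push l (k # w) = (if k = neg l then w else l # k # w)"
  by (auto simp: push_def neg_def)

lemma reduced_push: "reduced w \<Longrightarrow> reduced (push l w)"
  by (cases w) (auto simp: push_Cons successively_Cons)

lemma push_neg_push: "reduced w \<Longrightarrow> push (neg l) (push l w) = w"
  by (cases w; cases "tl w") (auto simp: push_Cons successively_Cons)

lemma reduced_foldr_push: "reduced w \<Longrightarrow> reduced (foldr push u w)"
  by (induction u) (auto intro: reduced_push)

lemma reduced_reduce: "reduced (reduce w)"
  unfolding reduce_def by (rule reduced_foldr_push) simp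

lemma reduce_reduced: "reduced w \<Longrightarrow> reduce w = w"
proof (induction w)
  case (Cons l w)
  then have "reduce w = w"
    by (simp add: successively_Cons split: if_splits) (use reduce_def in force)
  then show ?case
    using Cons.prems by (cases w) (auto simp: reduce_def push_Cons)
qed (simp add: reduce_def)

lemma reduce_eq_self_iff: "reduce w = w \<longleftrightarrow> reduced w"
  using reduced_reduce[of w] reduce_reduced[of w] by metis

lemma foldr_push_push:
  assumes "reduced w"
  shows "foldr push (push l u) w = push l (foldr push u w)"
proof (cases u)
  case (Cons k v)
  have "push l (push (neg l) (foldr push v w)) = foldr push v w"
    using push_neg_push[of "foldr push v w" "neg l"] reduced_foldr_push[OF assms] by simp
  then show ?thesis
    using Cons by (simp add: push_Cons)
qed simp

lemma foldr_push_reduce: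
  assumes "reduced w"
  shows "foldr push (reduce u) w = foldr push u w"
  by (induction u) (auto simp: reduce_def foldr_push_push[OF assms])

lemma reduce_append: "reduce (u @ v) = foldr push u (reduce v)"
  by (simp add: reduce_def)

lemma reduce_append_reduce [simp]:
  "reduce (u @ reduce v) = reduce (u @ v)" "reduce (reduce u @ v) = reduce (u @ v)"
  using reduce_reduced[OF reduced_reduce, of v]
  by (simp_all add: reduce_append foldr_push_reduce reduced_reduce)

lemma set_push: "set (push l w) \<subseteq> insert l (set w)"
  by (cases w) (auto simp: push_Cons)

lemma set_reduce: "set (reduce w) \<subseteq> set w"
proof (induction w)
  case (Cons l w)
  then show ?case
    using set_push[of l "reduce w"] by (auto simp: reduce_def)
qed (simp add: reduce_def)

lemma reduce_winv: "reduce (winv w @ w) = []"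
proof (induction w)
  case (Cons l w)
  have "reduce (winv (l # w) @ l # w) = foldr push (winv w) (push (neg l) (push l (reduce w)))"
    by (simp add: reduce_append) (simp add: reduce_def)
  also have "\<dots> = reduce (winv w @ w)"
    by (simp add: push_neg_push reduced_reduce reduce_append)
  finally show ?case
    using Cons by simp
qed (simp add: reduce_def)

lemma reduced_winv: "reduced w \<Longrightarrow> reduced (winv w)"
  unfolding winv_def by (auto simp: successively_map elim!: successively_mono)

lemma reduce_Nil [simp]: "reduce [] = []"
  by (simp add: reduce_def)

lemma free_group_simps:
  "carrier (free_group S) = {w \<in> lists (S \<times> UNIV). reduced w}"
  "u \<otimes>\<^bsub>free_group S\<^esub> v = reduce (u @ v)" "\<one>\<^bsub>free_group S\<^esub> = []"
  by (simp_all add: free_group_def reduce_eq_self_iff)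

lemma group_free_group: "group (free_group S)"
proof (rule groupI)
  fix x y z assume x: "x \<in> carrier (free_group S)" and y: "y \<in> carrier (free_group S)"
  have "set (reduce (x @ y)) \<subseteq> S \<times> UNIV"
    using set_reduce[of "x @ y"] x y unfolding free_group_simps lists_eq_set by auto
  then show "x \<otimes>\<^bsub>free_group S\<^esub> y \<in> carrier (free_group S)"
    by (auto simp: free_group_simps reduced_reduce lists_eq_set)
  show "\<exists>y\<in>carrier (free_group S). y \<otimes>\<^bsub>free_group S\<^esub> x = \<one>\<^bsub>free_group S\<^esub>"
  proof (intro bexI)
    show "winv x \<otimes>\<^bsub>free_group S\<^esub> x = \<one>\<^bsub>free_group S\<^esub>"
      by (simp add: free_group_simps reduce_winv)
    show "winv x \<in> carrier (free_group S)"
      using x reduced_winv[of x] by (auto simp: free_group_simps lists_eq_set winv_def neg_def)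
  qed
qed (auto simp: free_group_simps reduce_reduced)

lemma inv_free_group:
  assumes "w \<in> carrier (free_group S)"
  shows "inv\<^bsub>free_group S\<^esub> w = winv w"
proof -
  interpret group "free_group S" by (rule group_free_group)
  have "winv w \<in> carrier (free_group S)"
    using assms reduced_winv[of w] by (auto simp: free_group_simps lists_eq_set winv_def neg_def)
  then show ?thesis
    using assms by (intro inv_equality) (simp_all add: free_group_simps(2,3) reduce_winv)
qed

lemma letter_in_free_group: "a \<in> S \<Longrightarrow> [(a, e)] \<in> carrier (free_group S)"
  by (simp add: free_group_simps)

lemma free_group_induct [consumes 1, case_names one generator inverse mult]:
  assumes "w \<in> carrier (free_group S)" "P \<one>\<^bsub>free_group S\<^esub>" "\<And>a. a \<in> S \<Longrightarrow> P [(a, True)]"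
    and inverse: "\<And>u. u \<in> carrier (free_group S) \<Longrightarrow> P u \<Longrightarrow> P (inv\<^bsub>free_group S\<^esub> u)"
    and mult: "\<And>u v. u \<in> carrier (free_group S) \<Longrightarrow> v \<in> carrier (free_group S) \<Longrightarrow> P u \<Longrightarrow> P v \<Longrightarrow> P (u \<otimes>\<^bsub>free_group S\<^esub> v)"
  shows "P w"
  using assms(1)
proof (induction w rule: list.induct)
  case Nil
  then show ?case
    using assms(2) by (simp add: free_group_simps)
next
  case (Cons l w)
  obtain a e where l: "l = (a, e)" "a \<in> S"
    using Cons.prems by (cases l) (auto simp: free_group_simps)
  have c: "[l] \<in> carrier (free_group S)" "w \<in> carrier (free_group S)"
    using Cons.prems by (auto simp: free_group_simps successively_Cons)
  have "P [l]"
  proof (cases e)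
    case False
    then have "[l] = inv\<^bsub>free_group S\<^esub> [(a, True)]"
      using inv_free_group[OF letter_in_free_group[OF l(2)], of True] l(1) by simp
    then show ?thesis
      using inverse[OF letter_in_free_group[OF l(2)] assms(3)[OF l(2)]] by simp
  qed (use assms(3) l in simp)
  moreover have "l # w = [l] \<otimes>\<^bsub>free_group S\<^esub> w"
    using Cons.prems by (simp add: free_group_simps reduce_reduced)
  ultimately show ?case
    using mult[OF c] Cons.IH c(2) by simp
qed

text \<open>Making the cancelled block \<open>r\<close> explicit turns an equation between products in a free group into one
  between lists, in which lengths, first and last letters can be compared.\<close>

lemma reduced_mult_cancel:
  assumes "reduced u" "reduced v"
  obtains p q r where "u = p @ r" "v = winv r @ q" "reduce (u @ v) = p @ q" "reduced (p @ q)"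
  using assms
proof (induction u arbitrary: v thesis rule: rev_induct)
  case Nil
  then show ?case
    using Nil(1)[of "[]" "[]" v] by (simp add: reduce_reduced)
next
  case (snoc a u)
  show ?case
  proof (cases "v \<noteq> [] \<and> hd v = neg a")
    case True
    then obtain v' where v: "v = neg a # v'"
      by (cases v) auto
    have "reduced u" "reduced v'"
      using snoc.prems by (auto simp: v successively_append_iff successively_Cons)
    then obtain p q r where pqr: "u = p @ r" "v' = winv r @ q" "reduce (u @ v') = p @ q" "reduced (p @ q)"
      using snoc.IH by blast
    have "reduce ((u @ [a]) @ v) = foldr push u (push a (push (neg a) (reduce v')))"
      by (simp add: v reduce_def)
    also have "\<dots> = reduce (u @ v')"
      using push_neg_push[of "reduce v'" "neg a"] by (simp add: reduced_reduce reduce_append)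
    finally show ?thesis
      using snoc.prems(1)[of p "r @ [a]" q] pqr v by simp
  next
    case False
    then have "reduced ((u @ [a]) @ v)"
      using snoc.prems by (subst successively_append_iff) auto
    then show ?thesis
      using snoc.prems(1)[of "u @ [a]" "[]" v] by (simp add: reduce_reduced)
  qed
qed

section \<open>Commuting elements\<close>

lemma (in group) conj_int_pow:
  assumes "h \<in> carrier G" "t \<in> carrier G"
  shows "(h \<otimes> t \<otimes> inv h) [^] (i::int) = h \<otimes> t [^] i \<otimes> inv h"
proof -
  have "(\<lambda>t. h \<otimes> t \<otimes> inv h) \<in> hom G G"
    using assms(1) by (intro homI) (auto simp: m_assoc inv_solve_left)
  from hom_int_pow[OF this assms(2) is_group is_group, of i] show ?thesis by simp
qed

lemma (in group) conj_nat_pow: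
  assumes "h \<in> carrier G" "t \<in> carrier G"
  shows "(h \<otimes> t \<otimes> inv h) [^] (i::nat) = h \<otimes> t [^] i \<otimes> inv h"
  using conj_int_pow[OF assms, of "int i"] by (simp add: int_pow_int)

text \<open>The inductions on the word length below remove mutually inverse end letters by this conjugation.\<close>

lemma free_group_conj_letter:
  assumes "neg a # w @ [a] \<in> carrier (free_group S)"
  shows "[neg a] \<in> carrier (free_group S)" "w \<in> carrier (free_group S)"
    "neg a # w @ [a] = [neg a] \<otimes>\<^bsub>free_group S\<^esub> w \<otimes>\<^bsub>free_group S\<^esub> inv\<^bsub>free_group S\<^esub> [neg a]"
proof -
  show 1: "[neg a] \<in> carrier (free_group S)" "w \<in> carrier (free_group S)"
    using assms by (auto simp: free_group_simps successively_Cons successively_append_iff)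
  show "neg a # w @ [a] = [neg a] \<otimes>\<^bsub>free_group S\<^esub> w \<otimes>\<^bsub>free_group S\<^esub> inv\<^bsub>free_group S\<^esub> [neg a]"
    using assms by (simp add: inv_free_group[OF 1(1)] free_group_simps reduce_reduced)
qed

lemma (in group) conj_eq_iff:
  assumes "h \<in> carrier G" "x \<in> carrier G" "y \<in> carrier G"
  shows "h \<otimes> x \<otimes> inv h = h \<otimes> y \<otimes> inv h \<longleftrightarrow> x = y"
  using assms by simp

lemma (in group) conj_mult:
  assumes "h \<in> carrier G" "x \<in> carrier G" "y \<in> carrier G"
  shows "(h \<otimes> x \<otimes> inv h) \<otimes> (h \<otimes> y \<otimes> inv h) = h \<otimes> (x \<otimes> y) \<otimes> inv h"
proof -
  have "inv h \<otimes> (h \<otimes> (y \<otimes> inv h)) = y \<otimes> inv h"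
    using assms by (simp add: m_assoc[symmetric])
  then show ?thesis
    using assms by (simp add: m_assoc)
qed

text \<open>Induction on the total length. Without cancellation, and with complete cancellation of the
  shorter word, one of the words is split off the other, as in the Euclidean algorithm. If the
  cancellation is partial, then comparing the first and the last letters of the two products
  shows that both words begin and end in the same mutually inverse letters, which are removed by
  a conjugation.\<close>

lemma free_group_commute_step:
  fixes u v :: "'a word" and S
  defines "F \<equiv> free_group S"
  assumes uv: "u \<in> carrier F" "v \<in> carrier F" "u \<otimes>\<^bsub>F\<^esub> v = v \<otimes>\<^bsub>F\<^esub> u"
    and len: "length u \<le> length v"
    and IH: "\<And>x y. x \<in> carrier F \<Longrightarrow> y \<in> carrier F \<Longrightarrow> x \<otimes>\<^bsub>F\<^esub> y = y \<otimes>\<^bsub>F\<^esub> x \<Longrightarrow>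
      length x + length y < length u + length v \<Longrightarrow>
      \<exists>t\<in>carrier F. \<exists>(i::int) (j::int). x = t [^]\<^bsub>F\<^esub> i \<and> y = t [^]\<^bsub>F\<^esub> j"
  shows "\<exists>t\<in>carrier F. \<exists>(i::int) (j::int). u = t [^]\<^bsub>F\<^esub> i \<and> v = t [^]\<^bsub>F\<^esub> j"
proof -
  interpret F: group F unfolding F_def by (rule group_free_group)
  note fg = free_group_simps[of S, folded F_def]
  have ru: "reduced u" and rv: "reduced v"
    using uv by (auto simp: fg)
  show ?thesis
  proof (cases "u = []")
    case True
    then have "u = v [^]\<^bsub>F\<^esub> (0::int)" "v = v [^]\<^bsub>F\<^esub> (1::int)"
      using uv by (simp_all add: fg(3))
    then show ?thesis
      using uv(2) by metis
  next
    case False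
    obtain p q r where 1: "u = p @ r" "v = winv r @ q" "reduce (u @ v) = p @ q" "reduced (p @ q)"
      using reduced_mult_cancel[OF ru rv] .
    obtain p' q' r' where 2: "v = p' @ r'" "u = winv r' @ q'" "reduce (v @ u) = p' @ q'" "reduced (p' @ q')"
      using reduced_mult_cancel[OF rv ru] .
    have eq: "p @ q = p' @ q'"
      using uv(3) 1 2 by (simp add: fg)
    have lr: "length r = length r'"
      using arg_cong[OF eq, of length] arg_cong[OF 1(1), of length] arg_cong[OF 1(2), of length]
        arg_cong[OF 2(1), of length] arg_cong[OF 2(2), of length] by simp
    consider "r = []" | "r \<noteq> []" "p = []" | "r \<noteq> []" "p \<noteq> []" by blast
    then show ?thesis
    proof cases
      case 1: 1
      then have "u @ v = v @ u"
        using eq \<open>u = p @ r\<close> \<open>v = winv r @ q\<close> \<open>v = p' @ r'\<close> \<open>u = winv r' @ q'\<close> lr by simp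
      then obtain v' where v: "v = u @ v'"
        using len by (metis append_eq_append_conv_if append_take_drop_id)
      have v': "v' \<in> carrier F" "v = u \<otimes>\<^bsub>F\<^esub> v'"
        using uv(2) by (auto simp: v fg successively_append_iff reduce_reduced)
      have comm: "u \<otimes>\<^bsub>F\<^esub> v' = v' \<otimes>\<^bsub>F\<^esub> u"
        using \<open>u @ v = v @ u\<close> v by (simp add: fg)
      have "length u + length v' < length u + length v"
        using False by (simp add: v)
      from IH[OF uv(1) v'(1) comm this]
      obtain t i j where t: "t \<in> carrier F" "u = t [^]\<^bsub>F\<^esub> (i::int)" "v' = t [^]\<^bsub>F\<^esub> (j::int)"
        by blast
      have "v = t [^]\<^bsub>F\<^esub> (i + j)"
        unfolding v'(2) unfolding t(2,3) using t(1) by (simp add: F.int_pow_mult)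
      then show ?thesis
        using t by blast
    next
      case 2: 2
      have q: "q \<in> carrier F" "q = u \<otimes>\<^bsub>F\<^esub> v"
        using 1 2 uv(2) by (auto simp: fg successively_append_iff)
      have vq: "v = inv\<^bsub>F\<^esub> u \<otimes>\<^bsub>F\<^esub> q"
        unfolding q(2) using uv(1,2) by (simp add: F.m_assoc[symmetric])
      have "u \<otimes>\<^bsub>F\<^esub> q = q \<otimes>\<^bsub>F\<^esub> u"
        unfolding q(2) using uv by (metis F.m_assoc)
      then obtain t i j where t: "t \<in> carrier F" "u = t [^]\<^bsub>F\<^esub> (i::int)" "q = t [^]\<^bsub>F\<^esub> (j::int)"
        using IH[OF uv(1) q(1)] 1 2 by auto
      have "v = t [^]\<^bsub>F\<^esub> (- i + j)"
        unfolding vq unfolding t(2,3) using t(1) by (simp only: F.int_pow_mult F.int_pow_neg)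
      then show ?thesis
        using t by blast
    next
      case 3: 3
      have lu: "length u = length p + length r" and lu': "length u = length r' + length q'"
        using 1(1) 2(2) by (metis length_append, metis length_append winv_simps(5))
      have lv: "length v = length r + length q" and lv': "length v = length p' + length r'"
        using 1(2) 2(1) by (metis length_append winv_simps(5), metis length_append)
      have lens: "length q = length p'" "length q' = length p" "length p + length r \<le> length q + length r"
        using lu lu' lv lv' lr len by linarith+
      have ne: "r \<noteq> []" "r' \<noteq> []" "p \<noteq> []" "q \<noteq> []" "p' \<noteq> []" "q' \<noteq> []"
        using 3 lens lr by auto
      define a where "a = last u"
      have "hd u = hd v"
        using arg_cong[OF eq, of hd] 1(1) 2(1) ne by simp
      moreover have "last v = last u"
        using arg_cong[OF eq, of last] 1(2) 2(2) ne by simp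
      moreover have "hd v = neg (last u)"
        using 1(1,2) ne by (simp add: winv_def hd_map last_rev hd_rev last_map)
      ultimately have ends: "hd u = neg a" "last u = a" "hd v = neg a" "last v = a"
        by (simp_all add: a_def)
      have split: "\<exists>w'. w = neg a # w' @ [a]" if "hd w = neg a" "last w = a" "w \<noteq> []" for w
      proof -
        have "tl w \<noteq> []"
          using that by (cases w) auto
        then show ?thesis
          using that by (metis append_butlast_last_id hd_Cons_tl last_tl)
      qed
      obtain u' v' where u': "u = neg a # u' @ [a]" and v': "v = neg a # v' @ [a]"
        using split[of u] split[of v] ends ne 1 by blast
      note cu = free_group_conj_letter[where S=S, folded F_def, OF uv(1)[unfolded u']]
      note cv = free_group_conj_letter[where S=S, folded F_def, OF uv(2)[unfolded v']]
      have "u' \<otimes>\<^bsub>F\<^esub> v' = v' \<otimes>\<^bsub>F\<^esub> u'"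
        using uv(3)[unfolded u' v' cu(3) cv(3)] cu(1,2) cv(2)
        by (simp only: F.conj_mult F.m_closed F.conj_eq_iff)
      then obtain t i j where t: "t \<in> carrier F" "u' = t [^]\<^bsub>F\<^esub> (i::int)" "v' = t [^]\<^bsub>F\<^esub> (j::int)"
        using IH[OF cu(2) cv(2)] unfolding u' v' by auto
      show ?thesis
      proof (intro bexI exI conjI)
        let ?t = "[neg a] \<otimes>\<^bsub>F\<^esub> t \<otimes>\<^bsub>F\<^esub> inv\<^bsub>F\<^esub> [neg a]"
        show "?t \<in> carrier F"
          using t(1) cu(1) by simp
        show "u = ?t [^]\<^bsub>F\<^esub> i" "v = ?t [^]\<^bsub>F\<^esub> j"
          unfolding u' v' cu(3) cv(3) F.conj_int_pow[OF cu(1) t(1)] using t by simp_all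
      qed
    qed
  qed
qed

lemma free_group_commute:
  assumes "u \<in> carrier (free_group S)" "v \<in> carrier (free_group S)"
    and "u \<otimes>\<^bsub>free_group S\<^esub> v = v \<otimes>\<^bsub>free_group S\<^esub> u"
  obtains t i j where "t \<in> carrier (free_group S)"
    "u = t [^]\<^bsub>free_group S\<^esub> (i::int)" "v = t [^]\<^bsub>free_group S\<^esub> (j::int)"
proof -
  let ?F = "free_group S"
  have "\<exists>t\<in>carrier ?F. \<exists>(i::int) (j::int). u = t [^]\<^bsub>?F\<^esub> i \<and> v = t [^]\<^bsub>?F\<^esub> j"
    using assms
  proof (induction "length u + length v" arbitrary: u v rule: less_induct)
    case less
    show ?case
    proof (cases "length u \<le> length v")
      case True
      then show ?thesis
        using free_group_commute_step[OF less.prems True] less.hyps by blast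
    next
      case False
      have "\<exists>t\<in>carrier ?F. \<exists>(i::int) (j::int). v = t [^]\<^bsub>?F\<^esub> i \<and> u = t [^]\<^bsub>?F\<^esub> j"
        by (rule free_group_commute_step) (use False less in \<open>auto simp: add.commute\<close>)
      then obtain t i j where "t \<in> carrier ?F" "v = t [^]\<^bsub>?F\<^esub> (i::int)" "u = t [^]\<^bsub>?F\<^esub> (j::int)"
        by (elim bexE exE conjE)
      then show ?thesis
        by metis
    qed
  qed
  then show ?thesis
    using that by blast
qed

section \<open>Roots and centralizers in free groups\<close>

lemma comm_if_concat_replicate_eq:
  assumes eq: "concat (replicate j a) = concat (replicate k b)" and jk: "j > 0" "k > 0"
  shows "a @ b = b @ a"
proof -
  define W where "W = concat (replicate j a)"
  have comm: "c @ concat (replicate n c) = concat (replicate n c) @ c" for c :: "'a list" and n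
    by (induction n) auto
  have a: "a @ W = W @ a" and b: "b @ W = W @ b"
    using comm[of a j] comm[of b k] eq by (simp_all add: W_def)
  obtain a' where a': "W = a @ a'"
    using jk(1) by (cases j) (auto simp: W_def)
  obtain b' where b': "W = b @ b'"
    using jk(2) by (cases k) (auto simp: W_def eq)
  have "a @ b @ b' @ a' = b @ a @ a' @ b'"
  proof -
    have "a @ b @ b' @ a' = W @ a @ a'" using a b' by simp
    also have "\<dots> = W @ b @ b'" using a' b' by simp
    also have "\<dots> = b @ a @ a' @ b'" using b a' by simp
    finally show ?thesis .
  qed
  then show ?thesis
    by (metis append_assoc append_eq_append_conv length_append add.commute)
qed

lemma free_group_letter_ends:
  assumes "w \<in> carrier (free_group S)" "w \<noteq> []" "hd w = neg (last w)"
  obtains a v where "w = neg a # v @ [a]" "v \<noteq> []"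
proof -
  have "tl w \<noteq> []"
    using assms(2,3) by (cases w) auto
  then have "w = neg (last w) # butlast (tl w) @ [last w]"
    using assms(2,3) by (metis append_butlast_last_id hd_Cons_tl last_tl)
  moreover have "butlast (tl w) \<noteq> []"
  proof
    assume "butlast (tl w) = []"
    then have "w = [neg (last w), last w]"
      using \<open>w = neg (last w) # butlast (tl w) @ [last w]\<close> by simp
    then have "reduced [neg (last w), last w]"
      using assms(1) by (simp add: free_group_simps)
    then show False by simp
  qed
  ultimately show ?thesis
    using that by blast
qed

text \<open>A word with \<open>hd w \<noteq> neg (last w)\<close> is cyclically reduced, and its powers are its repetitions.
  Any other word is a conjugate of a shorter one by a letter, which yields an induction.\<close>

lemma cyclically_reduced_pow:
  assumes w: "w \<in> carrier (free_group S)" "w \<noteq> []" "hd w \<noteq> neg (last w)"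
  shows "w [^]\<^bsub>free_group S\<^esub> (n::nat) = concat (replicate n w)"
proof -
  interpret F: group "free_group S" by (rule group_free_group)
  have red: "reduced (concat (replicate n w)) \<and> (n > 0 \<longrightarrow> hd (concat (replicate n w)) = hd w)" for n
  proof (induction n)
    case (Suc n)
    then show ?case
      using w by (cases n) (auto simp: successively_append_iff free_group_simps)
  qed simp
  show ?thesis
  proof (induction n)
    case (Suc n)
    have "w [^]\<^bsub>free_group S\<^esub> Suc n = w \<otimes>\<^bsub>free_group S\<^esub> w [^]\<^bsub>free_group S\<^esub> n"
      using w(1) by (rule F.nat_pow_Suc2)
    also have "\<dots> = concat (replicate (Suc n) w)"
      using red[of "Suc n"] by (simp add: Suc free_group_simps(2) reduce_reduced)
    finally show ?case .
  qed (simp add: free_group_simps)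
qed

lemma pow_letter_ends:
  assumes w: "neg a # w @ [a] \<in> carrier (free_group S)"
    and p: "hd (w [^]\<^bsub>free_group S\<^esub> n) = hd w" "last (w [^]\<^bsub>free_group S\<^esub> n) = last w"
      "w [^]\<^bsub>free_group S\<^esub> n \<noteq> []" "w \<noteq> []"
  shows "(neg a # w @ [a]) [^]\<^bsub>free_group S\<^esub> (n::nat) = neg a # w [^]\<^bsub>free_group S\<^esub> n @ [a]"
proof -
  interpret F: group "free_group S" by (rule group_free_group)
  note c = free_group_conj_letter[OF w]
  have "w [^]\<^bsub>free_group S\<^esub> n \<in> carrier (free_group S)"
    using c by blast
  then have red: "reduced (neg a # w [^]\<^bsub>free_group S\<^esub> n @ [a])"
    using p w by (auto simp: free_group_simps successively_Cons successively_append_iff)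
  have "(neg a # w @ [a]) [^]\<^bsub>free_group S\<^esub> n
    = [neg a] \<otimes>\<^bsub>free_group S\<^esub> w [^]\<^bsub>free_group S\<^esub> n \<otimes>\<^bsub>free_group S\<^esub> inv\<^bsub>free_group S\<^esub> [neg a]"
    by (subst c(3)) (rule F.conj_nat_pow[OF c(1,2)])
  also have "\<dots> = neg a # w [^]\<^bsub>free_group S\<^esub> n @ [a]"
    using red by (simp add: inv_free_group[OF c(1)] free_group_simps(2) reduce_reduced)
  finally show ?thesis .
qed

text \<open>The powers of a cyclically reduced word are repetitions, and conjugation by a letter that does not
  cancel preserves both the claim on the end letters and the one on the lengths.\<close>

lemma free_group_pow_shape:
  assumes "w \<in> carrier (free_group S)" "w \<noteq> []" "n > 0"
  shows "hd (w [^]\<^bsub>free_group S\<^esub> (n::nat)) = hd w \<and> last (w [^]\<^bsub>free_group S\<^esub> n) = last w \<and>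
    length (w [^]\<^bsub>free_group S\<^esub> n) \<ge> length w + (n - 1)"
  using assms
proof (induction "length w" arbitrary: w rule: less_induct)
  case less
  show ?case
  proof (cases "hd w = neg (last w)")
    case False
    have "hd (concat (replicate n w)) = hd w \<and> last (concat (replicate n w)) = last w \<and>
      length (concat (replicate n w)) \<ge> length w + (n - 1)"
      using less.prems(3)
    proof (induction n)
      case (Suc n)
      have "length w \<ge> 1"
        using less.prems(2) by (simp add: Suc_le_eq)
      then show ?case
        using Suc less.prems(2) by (cases n) auto
    qed simp
    then show ?thesis
      using cyclically_reduced_pow[OF less.prems(1,2) False, of n] by simp
  next
    case True
    obtain a v where v: "w = neg a # v @ [a]" "v \<noteq> []"
      using free_group_letter_ends[OF less.prems(1,2) True] .
    note c = free_group_conj_letter[OF less.prems(1)[unfolded v(1)]]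
    have "length v < length w"
      using v(1) by simp
    from less.hyps[OF this c(2) v(2) less.prems(3)]
    have IH: "hd (v [^]\<^bsub>free_group S\<^esub> n) = hd v" "last (v [^]\<^bsub>free_group S\<^esub> n) = last v"
      "length (v [^]\<^bsub>free_group S\<^esub> n) \<ge> length v + (n - 1)"
      by auto
    then have "v [^]\<^bsub>free_group S\<^esub> n \<noteq> []"
      using v(2) by auto
    then show ?thesis
      using pow_letter_ends[OF less.prems(1)[unfolded v(1)] IH(1,2) _ v(2)] IH(3) v(1) by simp
  qed
qed

lemma free_group_pow_eq_one_iff:
  assumes "w \<in> carrier (free_group S)"
  shows "w [^]\<^bsub>free_group S\<^esub> (n::nat) = [] \<longleftrightarrow> w = [] \<or> n = 0"
proof -
  interpret F: group "free_group S" by (rule group_free_group)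
  show ?thesis
    using free_group_pow_shape[OF assms, of n] F.nat_pow_one[of n]
    by (cases "n = 0"; cases w) (auto simp: free_group_simps(3))
qed

lemma free_group_int_pow_eq_one_iff:
  assumes "w \<in> carrier (free_group S)"
  shows "w [^]\<^bsub>free_group S\<^esub> (i::int) = [] \<longleftrightarrow> w = [] \<or> i = 0"
proof -
  interpret F: group "free_group S" by (rule group_free_group)
  have "w [^]\<^bsub>free_group S\<^esub> i = [] \<longleftrightarrow> w [^]\<^bsub>free_group S\<^esub> \<bar>i\<bar> = []"
    using assms F.inv_eq_1_iff[of "w [^]\<^bsub>free_group S\<^esub> \<bar>i\<bar>"]
    by (cases "i \<ge> 0") (auto simp: free_group_simps(3) F.int_pow_neg[symmetric])
  moreover have "\<bar>i\<bar> = int (nat \<bar>i\<bar>)" by simp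
  ultimately show ?thesis
    using free_group_pow_eq_one_iff[OF assms, of "nat \<bar>i\<bar>"] by (metis int_pow_int abs_eq_0 nat_eq_iff2 of_nat_0)
qed

lemma free_group_int_pow_inj:
  assumes "w \<in> carrier (free_group S)" "w \<noteq> []"
    and "w [^]\<^bsub>free_group S\<^esub> (i::int) = w [^]\<^bsub>free_group S\<^esub> (j::int)"
  shows "i = j"
proof -
  interpret F: group "free_group S" by (rule group_free_group)
  have "w [^]\<^bsub>free_group S\<^esub> (i - j) = []"
    using assms(1,3) by (simp add: F.int_pow_diff free_group_simps(3))
  then show ?thesis
    using assms free_group_int_pow_eq_one_iff by fastforce
qed

text \<open>Comparing the first and last letters of \<open>a ^ j = b ^ k\<close> shows that \<open>a\<close> and \<open>b\<close> are either both
  cyclically reduced, where the claim concerns lists, or both conjugated by the same letter.\<close>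

lemma free_group_commute_if_pow_eq:
  assumes "a \<in> carrier (free_group S)" "b \<in> carrier (free_group S)" "j > 0" "k > 0"
    and "a [^]\<^bsub>free_group S\<^esub> (j::nat) = b [^]\<^bsub>free_group S\<^esub> (k::nat)"
  shows "a \<otimes>\<^bsub>free_group S\<^esub> b = b \<otimes>\<^bsub>free_group S\<^esub> a"
  using assms
proof (induction "length a" arbitrary: a b rule: less_induct)
  case less
  interpret F: group "free_group S" by (rule group_free_group)
  show ?case
  proof (cases "a = [] \<or> b = []")
    case True
    then have "a = \<one>\<^bsub>free_group S\<^esub> \<or> b = \<one>\<^bsub>free_group S\<^esub>"
      by (simp add: free_group_simps)
    then show ?thesis
      using less.prems(1,2) by (elim disjE) simp_all
  next
    case False
    note pa = free_group_pow_shape[OF less.prems(1) _ less.prems(3)]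
    note pb = free_group_pow_shape[OF less.prems(2) _ less.prems(4)]
    have ends: "hd a = hd b" "last a = last b"
      using pa pb False less.prems(5) by auto
    show ?thesis
    proof (cases "hd a = neg (last a)")
      case noncyc: False
      have "concat (replicate j a) = concat (replicate k b)"
        using cyclically_reduced_pow[of a S j] cyclically_reduced_pow[of b S k] less.prems False noncyc ends
        by simp
      then show ?thesis
        using comm_if_concat_replicate_eq[of j a k b] less.prems(3,4) by (simp add: free_group_simps(2))
    next
      case True
      obtain x a' where a': "a = neg x # a' @ [x]" "a' \<noteq> []"
        using free_group_letter_ends[OF less.prems(1) _ True] False by blast
      obtain y b' where b': "b = neg y # b' @ [y]" "b' \<noteq> []"
        using free_group_letter_ends[OF less.prems(2)] True ends False by metis
      have y: "y = x"
        using ends a' b' by simp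
      note ca = free_group_conj_letter[OF less.prems(1)[unfolded a']]
      note cb = free_group_conj_letter[OF less.prems(2)[unfolded b' y]]
      note sa = free_group_pow_shape[OF ca(2) a'(2) less.prems(3)]
      note sb = free_group_pow_shape[OF cb(2) b'(2) less.prems(4)]
      have "a [^]\<^bsub>free_group S\<^esub> j = neg x # a' [^]\<^bsub>free_group S\<^esub> j @ [x]"
        unfolding a' by (rule pow_letter_ends) (use less.prems(1) a' sa in auto)
      moreover have "b [^]\<^bsub>free_group S\<^esub> k = neg x # b' [^]\<^bsub>free_group S\<^esub> k @ [x]"
        unfolding b' y by (rule pow_letter_ends) (use less.prems(2) b' y sb in auto)
      ultimately have "a' [^]\<^bsub>free_group S\<^esub> j = b' [^]\<^bsub>free_group S\<^esub> k"
        using less.prems(5) by simp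
      then have comm: "a' \<otimes>\<^bsub>free_group S\<^esub> b' = b' \<otimes>\<^bsub>free_group S\<^esub> a'"
        using less.hyps[of a' b'] ca(2) cb(2) less.prems(3,4) a'(1) by simp
      have "a = [neg x] \<otimes>\<^bsub>free_group S\<^esub> a' \<otimes>\<^bsub>free_group S\<^esub> inv\<^bsub>free_group S\<^esub> [neg x]"
        "b = [neg x] \<otimes>\<^bsub>free_group S\<^esub> b' \<otimes>\<^bsub>free_group S\<^esub> inv\<^bsub>free_group S\<^esub> [neg x]"
        using ca(3) cb(3) a' b' y by simp_all
      then show ?thesis
        using comm ca cb by (metis F.conj_mult)
    qed
  qed
qed

lemma (in group) pos_int_pow:
  fixes i :: int
  assumes "x \<in> carrier G"
  obtains y and n :: nat where "y \<in> carrier G" "x [^] i = y [^] n" "x = y \<or> x = inv y"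
proof (cases "i \<ge> 0")
  case True
  then show ?thesis
    using that[of x "nat i"] assms int_pow_int[of G x "nat i"] by simp
next
  case False
  have "x [^] i = inv x [^] nat (- i)"
    using assms False int_pow_int[of G "inv x" "nat (- i)"] by (simp add: int_pow_inv int_pow_neg[symmetric])
  then show ?thesis
    using that[of "inv x" "nat (- i)"] assms by simp
qed

context
  fixes S :: "'a set" and F :: "'a word monoid"
  defines "F \<equiv> free_group S"
begin

interpretation F: group F unfolding F_def by (rule group_free_group)

lemma free_root_minimal:
  assumes y: "y \<in> carrier F"
  shows free_root: "free_root F y \<in> carrier F \<and> (\<exists>n>0. y = free_root F y [^]\<^bsub>F\<^esub> (n::nat))"
    and free_root_le: "x \<in> carrier F \<Longrightarrow> n > 0 \<Longrightarrow> y = x [^]\<^bsub>F\<^esub> (n::nat) \<Longrightarrow> length (free_root F y) \<le> length x"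
proof -
  let ?P = "\<lambda>x. x \<in> carrier F \<and> (\<exists>n>0. y = x [^]\<^bsub>F\<^esub> (n::nat))"
  have "?P y"
    using y F.nat_pow_Suc2[of y 0] by (intro conjI exI[of _ 1]) auto
  from arg_min_nat_lemma[of ?P, OF this, of length]
  show "free_root F y \<in> carrier F \<and> (\<exists>n>0. y = free_root F y [^]\<^bsub>F\<^esub> (n::nat))"
    "x \<in> carrier F \<Longrightarrow> n > 0 \<Longrightarrow> y = x [^]\<^bsub>F\<^esub> (n::nat) \<Longrightarrow> length (free_root F y) \<le> length x"
    unfolding free_root_def by auto
qed

lemmas free_root_carrier = free_root[THEN conjunct1]

lemma free_root_neq_one: "y \<in> carrier F \<Longrightarrow> y \<noteq> [] \<Longrightarrow> free_root F y \<noteq> []"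
  using free_root[of y] F.nat_pow_one by (auto simp: F_def free_group_simps)

text \<open>The root \<open>t\<close> of \<open>y\<close> generates the centralizer: an element \<open>g\<close> of it is a power of some \<open>a\<close>
  having \<open>y\<close> as a power, \<open>a\<close> and \<open>t\<close> have a power in common and hence are both powers of some \<open>b\<close>,
  and minimality of \<open>t\<close> makes \<open>b\<close> equal to \<open>t\<close> up to inversion.\<close>

lemma free_root_generates:
  assumes g: "g \<in> carrier F" and y: "y \<in> carrier F" "y \<noteq> []" and comm: "g \<otimes>\<^bsub>F\<^esub> y = y \<otimes>\<^bsub>F\<^esub> g"
  obtains k where "g = free_root F y [^]\<^bsub>F\<^esub> (k::int)"
proof -
  define t where "t = free_root F y"
  obtain n where t: "t \<in> carrier F" "n > 0" "y = t [^]\<^bsub>F\<^esub> (n::nat)"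
    using free_root[OF y(1)] unfolding t_def by blast
  have one: "\<one>\<^bsub>F\<^esub> = []"
    by (simp add: F_def free_group_simps)
  have tne: "t \<noteq> []"
    using free_root_neq_one[OF y] unfolding t_def .
  obtain a0 i j where a0: "a0 \<in> carrier F" "g = a0 [^]\<^bsub>F\<^esub> (i::int)" "y = a0 [^]\<^bsub>F\<^esub> (j::int)"
    using free_group_commute[of g S y] g y(1) comm unfolding F_def by blast
  obtain a m where a: "a \<in> carrier F" "y = a [^]\<^bsub>F\<^esub> (m::nat)" "a0 = a \<or> a0 = inv\<^bsub>F\<^esub> a"
    using F.pos_int_pow[OF a0(1), of j] a0(3) by metis
  have m: "m > 0"
    using a(2) y(2) one by (intro gr0I) simp
  have "a \<otimes>\<^bsub>F\<^esub> t = t \<otimes>\<^bsub>F\<^esub> a"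
    unfolding F_def by (rule free_group_commute_if_pow_eq[of _ _ _ m n]) (use a t m in \<open>auto simp: F_def\<close>)
  then obtain b0 p q0 where b0: "b0 \<in> carrier F" "a = b0 [^]\<^bsub>F\<^esub> (p::int)" "t = b0 [^]\<^bsub>F\<^esub> (q0::int)"
    using free_group_commute[of a S t] a(1) t(1) unfolding F_def by blast
  obtain b q where b: "b \<in> carrier F" "t = b [^]\<^bsub>F\<^esub> (q::nat)" "b0 = b \<or> b0 = inv\<^bsub>F\<^esub> b"
    using F.pos_int_pow[OF b0(1), of q0] b0(3) by metis
  have q: "q > 0"
    using b(2) tne one by (intro gr0I) simp
  have bne: "b \<noteq> []"
    using b(2) tne F.nat_pow_one[of q] one by metis
  have "y = b [^]\<^bsub>F\<^esub> (q * n)"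
    using t b by (simp add: F.nat_pow_pow)
  then have "length t \<le> length b"
    using free_root_le[OF y(1) b(1), of "q * n"] q t(2) by (simp add: t_def)
  moreover have "length t \<ge> length b + (q - 1)"
    using free_group_pow_shape[of b S q] b bne q by (simp add: F_def)
  ultimately have "q = 1"
    using q by simp
  then have "b = t"
    using b by simp
  then have "a \<in> range (\<lambda>k::int. t [^]\<^bsub>F\<^esub> k)"
    using b0(2) b(3) t(1) F.int_pow_inv[of t p] F.int_pow_neg[of t p] by (metis rangeI)
  then obtain k where "a = t [^]\<^bsub>F\<^esub> (k::int)" by blast
  then have "g = t [^]\<^bsub>F\<^esub> (k * i) \<or> g = t [^]\<^bsub>F\<^esub> (- (k * i))"
    using a0(2) a(3) t(1) F.int_pow_pow[of t k i] F.int_pow_neg[of t "k * i"] F.int_pow_inv[of a i] a(1) by metis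
  then show ?thesis
    using that unfolding t_def by blast
qed

text \<open>If \<open>y\<close> is a positive power of \<open>s\<close> and its root is any power \<open>s ^ p\<close>, then \<open>p\<close> is positive, since
  exponents of powers of \<open>s\<close> are unique, and \<open>p = 1\<close> because the root has minimal length.\<close>

lemma free_root_eqI:
  assumes y: "y \<in> carrier F" "y \<noteq> []" and s: "s \<in> carrier F" "n > 0" "y = s [^]\<^bsub>F\<^esub> (n::nat)"
    and gen: "free_root F y = s [^]\<^bsub>F\<^esub> (p::int)"
  shows "free_root F y = s"
proof -
  obtain k where k: "k > 0" "y = free_root F y [^]\<^bsub>F\<^esub> (k::nat)"
    using free_root[OF y(1)] by blast
  have ne: "s \<noteq> []"
    using s y(2) F.nat_pow_one by (auto simp: F_def free_group_simps)
  have "y = (s [^]\<^bsub>F\<^esub> p) [^]\<^bsub>F\<^esub> k"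
    using k(2) gen by metis
  then have "s [^]\<^bsub>F\<^esub> int n = s [^]\<^bsub>F\<^esub> (p * int k)"
    using s by (metis int_pow_int F.int_pow_pow)
  then have "int n = p * int k"
    using free_group_int_pow_inj[of s S] s(1) ne by (simp add: F_def)
  then have "p > 0"
    using s(2) k(1) by (metis of_nat_0_less_iff zero_less_mult_pos2)
  then have "free_root F y = s [^]\<^bsub>F\<^esub> nat p" "nat p > 0"
    using gen int_pow_int[of F s "nat p"] by simp_all
  moreover from this have "length (free_root F y) \<ge> length s + (nat p - 1)"
    using free_group_pow_shape[of s S "nat p"] s(1) ne by (simp add: F_def)
  moreover have "length (free_root F y) \<le> length s"
    using free_root_le[OF y(1) s] .
  ultimately have "nat p = 1"
    by simp
  then show ?thesis
    using \<open>free_root F y = s [^]\<^bsub>F\<^esub> nat p\<close> s(1) by simp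
qed

text \<open>Word length is not invariant under conjugation, so this is not immediate from the minimality of the
  root. It follows from the description of the root as a generator of the centralizer.\<close>

lemma free_root_conj:
  assumes y: "y \<in> carrier F" "y \<noteq> []" and h: "h \<in> carrier F"
  shows "free_root F (h \<otimes>\<^bsub>F\<^esub> y \<otimes>\<^bsub>F\<^esub> inv\<^bsub>F\<^esub> h) = h \<otimes>\<^bsub>F\<^esub> free_root F y \<otimes>\<^bsub>F\<^esub> inv\<^bsub>F\<^esub> h"
proof -
  let ?c = "\<lambda>x. h \<otimes>\<^bsub>F\<^esub> x \<otimes>\<^bsub>F\<^esub> inv\<^bsub>F\<^esub> h"
  let ?t = "free_root F (?c y)"
  have one: "\<one>\<^bsub>F\<^esub> = []"
    by (simp add: F_def free_group_simps)
  have "?c \<one>\<^bsub>F\<^esub> = []"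
    using h by (simp add: one[symmetric])
  then have "?c y \<noteq> []"
    using F.conj_eq_iff[OF h y(1) F.one_closed] y(2) one by metis
  moreover have cy: "?c y \<in> carrier F"
    using y h by simp
  ultimately have t: "?t \<in> carrier F" "?t \<noteq> []"
    using free_root free_root_neq_one by blast+
  obtain m where m: "?c y = ?t [^]\<^bsub>F\<^esub> (m::nat)"
    using free_root[OF cy] by blast
  define g where "g = inv\<^bsub>F\<^esub> h \<otimes>\<^bsub>F\<^esub> ?t \<otimes>\<^bsub>F\<^esub> h"
  have g: "g \<in> carrier F" "?c g = ?t"
    using t h by (auto simp: g_def F.m_assoc F.inv_solve_left) (simp add: F.m_assoc[symmetric])
  have "?c y = ?c (g [^]\<^bsub>F\<^esub> m)"
    using m g h F.conj_nat_pow[OF h g(1), of m] by simp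
  then have "y = g [^]\<^bsub>F\<^esub> m"
    using F.conj_eq_iff[OF h y(1)] g by simp
  then have "g \<otimes>\<^bsub>F\<^esub> y = y \<otimes>\<^bsub>F\<^esub> g"
    using g by (simp add: F.nat_pow_Suc2[symmetric])
  then obtain k where k: "g = free_root F y [^]\<^bsub>F\<^esub> (k::int)"
    using free_root_generates[OF g(1) y] by blast
  obtain n where n: "n > 0" "y = free_root F y [^]\<^bsub>F\<^esub> (n::nat)"
    using free_root[OF y(1)] by blast
  show ?thesis
  proof (rule free_root_eqI[OF cy \<open>?c y \<noteq> []\<close>])
    show "?c (free_root F y) \<in> carrier F"
      using h free_root[OF y(1)] by simp
    show "?c y = ?c (free_root F y) [^]\<^bsub>F\<^esub> n" "n > 0"
      using F.conj_nat_pow[OF h free_root_carrier[OF y(1)], of n] n by simp_all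
    show "?t = ?c (free_root F y) [^]\<^bsub>F\<^esub> k"
      using F.conj_int_pow[OF h free_root_carrier[OF y(1)], of k] k g by simp
  qed
qed

end

section \<open>Canonical centralizers of conjugacy classes\<close>

context group
begin

lemma conj_class_iff:
  assumes "x \<in> carrier G"
  shows "y \<in> conj_class G x \<longleftrightarrow> (\<exists>g\<in>carrier G. y = g \<otimes> x \<otimes> inv g)"
  using assms by (auto simp: orbit_def conj_action_def)

lemma conj_class_eq:
  assumes "x \<in> carrier G" "y \<in> conj_class G x"
  shows "y \<in> carrier G" "conj_class G y = conj_class G x"
proof -
  interpret A: group_action G "carrier G" "conj_action G"
    unfolding conj_action_def by (rule action_by_conjugation)
  show y: "y \<in> carrier G"
    using assms by (auto simp: conj_class_iff)
  have "conj_class G z \<subseteq> conj_class G w" if "w \<in> carrier G" "z \<in> carrier G" "z \<in> conj_class G w" for w z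
  proof
    fix v assume "v \<in> conj_class G z"
    moreover from this have "v \<in> carrier G"
      using that(2) by (auto simp: conj_class_iff)
    ultimately show "v \<in> conj_class G w"
      using A.orbit_trans[of w z v] that by blast
  qed
  then show "conj_class G y = conj_class G x"
    using assms y A.orbit_sym by blast
qed

lemma conj_class_self: "x \<in> carrier G \<Longrightarrow> x \<in> conj_class G x"
  by (auto simp: conj_class_iff intro!: bexI[of _ \<one>])

lemma conj_classesD:
  assumes "c \<in> conj_classes G" "x \<in> c"
  shows "x \<in> carrier G" "c = conj_class G x"
  using assms conj_class_eq unfolding orbits_def by blast+

lemma conj_classes_nonempty: "c \<in> conj_classes G \<Longrightarrow> c \<noteq> {}"
  using conj_class_self unfolding orbits_def by blast

lemma conj_class_in_conj_classes: "x \<in> carrier G \<Longrightarrow> conj_class G x \<in> conj_classes G"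
  by (auto simp: orbits_def)

lemma conjugate_in_class:
  assumes "c \<in> conj_classes G" "x \<in> c" "y \<in> c"
  obtains g where "g \<in> carrier G" "y = g \<otimes> x \<otimes> inv g"
proof -
  have "y \<in> conj_class G x"
    using conj_classesD(2)[OF assms(1,2)] assms(3) by (rule subst)
  then show ?thesis
    using that conj_class_iff[OF conj_classesD(1)[OF assms(1,2)]] by blast
qed

lemma conj_in_class:
  assumes "c \<in> conj_classes G" "x \<in> c" "g \<in> carrier G"
  shows "g \<otimes> x \<otimes> inv g \<in> c"
proof -
  have "g \<otimes> x \<otimes> inv g \<in> conj_class G x"
    using conj_class_iff[OF conj_classesD(1)[OF assms(1,2)]] assms(3) by blast
  then show ?thesis
    using conj_classesD(2)[OF assms(1,2)] by simp
qed

lemma conj_class_one: "conj_class G \<one> = {\<one>}"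
  using conj_class_self[OF one_closed] by (auto simp: conj_class_iff)

lemma one_in_class_iff: "c \<in> conj_classes G \<Longrightarrow> \<one> \<in> c \<longleftrightarrow> c = {\<one>}"
  by (metis conj_classesD(2) conj_class_one singletonI)

lemma centralizer_iff:
  assumes "x \<in> carrier G"
  shows "g \<in> centralizer G x \<longleftrightarrow> g \<in> carrier G \<and> g \<otimes> x = x \<otimes> g"
proof -
  have "g \<otimes> x \<otimes> inv g = x \<longleftrightarrow> g \<otimes> x = x \<otimes> g" if "g \<in> carrier G"
    using inv_solve_right[of x "g \<otimes> x" g] assms that by auto
  then show ?thesis
    using assms by (auto simp: stabilizer_def conj_action_def)
qed

lemma int_pow_in_centralizer:
  assumes "t \<in> carrier G" "x = t [^] (n::nat)"
  shows "t [^] (k::int) \<in> centralizer G x"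
proof -
  have "t [^] k \<otimes> t [^] int n = t [^] int n \<otimes> t [^] k"
    using assms(1) by (simp add: int_pow_mult[symmetric] add.commute)
  then show ?thesis
    using assms by (simp add: centralizer_iff int_pow_int)
qed

end

lemma class_map_eq:
  assumes "group F" "group F'" "f \<in> hom F F'" "c \<in> conj_classes F" "y \<in> c"
  shows "class_map F' f c = conj_class F' (f y)"
proof -
  interpret F: group F by fact
  interpret F': group F' by fact
  interpret group_hom F F' f
    using assms by (simp add: group_hom_def group_hom_axioms_def)
  have "conj_class F' (f z) = conj_class F' (f y)" if z: "z \<in> c" for z
  proof -
    obtain g where g: "g \<in> carrier F" "z = g \<otimes>\<^bsub>F\<^esub> y \<otimes>\<^bsub>F\<^esub> inv\<^bsub>F\<^esub> g"
        using F.conjugate_in_class[OF assms(4,5) z] .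
    then have "f z = f g \<otimes>\<^bsub>F'\<^esub> f y \<otimes>\<^bsub>F'\<^esub> inv\<^bsub>F'\<^esub> f g"
      using F.conj_classesD(1)[OF assms(4,5)] by simp
    moreover have fy: "f y \<in> carrier F'"
      using F.conj_classesD(1)[OF assms(4,5)] by simp
    ultimately have "f z \<in> conj_class F' (f y)"
      using F'.conj_class_iff[OF fy, of "f z"] hom_closed[OF g(1)] by blast
    then show ?thesis
      by (rule F'.conj_class_eq(2)[OF fy])
  qed
  then have "class_map F' f c = (\<Union>z\<in>c. conj_class F' (f y))"
    unfolding class_map_def by (intro SUP_cong refl) blast
  then show ?thesis
    using assms(5) by auto
qed

lemma class_map_in_conj_classes:
  assumes "group F" "group F'" "f \<in> hom F F'" "c \<in> conj_classes F"
  shows "class_map F' f c \<in> conj_classes F'"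
proof -
  interpret F: group F by fact
  interpret F': group F' by fact
  interpret group_hom F F' f
    using assms by (simp add: group_hom_def group_hom_axioms_def)
  obtain y where "y \<in> c"
    using F.conj_classes_nonempty assms(4) by blast
  then show ?thesis
    using class_map_eq[OF assms, of y] F.conj_classesD[OF assms(4)] F'.conj_class_in_conj_classes by simp
qed

lemma image_in_class_map:
  assumes "group F" "group F'" "f \<in> hom F F'" "c \<in> conj_classes F" "y \<in> c"
  shows "f y \<in> class_map F' f c"
proof -
  interpret F: group F by fact
  interpret F': group F' by fact
  interpret group_hom F F' f
    using assms by (simp add: group_hom_def group_hom_axioms_def)
  show ?thesis
    using class_map_eq[OF assms] F.conj_classesD[OF assms(4,5)] F'.conj_class_self by simp
qed

lemma class_map_comp:
  assumes "group F" "group F'" "group F''" "f \<in> hom F F'" "g \<in> hom F' F''" "c \<in> conj_classes F"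
  shows "class_map F'' g (class_map F' f c) = class_map F'' (g \<circ> f) c"
proof -
  interpret F: group F by fact
  obtain y where y: "y \<in> c"
    using F.conj_classes_nonempty assms(6) by blast
  have "g \<circ> f \<in> hom F F''"
    using assms hom_compose by blast
  then show ?thesis
    using class_map_eq[OF assms(2,3,5) class_map_in_conj_classes[OF assms(1,2,4,6)]
        image_in_class_map[OF assms(1,2,4,6) y]] class_map_eq[OF assms(1,3) _ assms(6) y]
    by simp
qed

lemma class_map_cong:
  assumes "group F" "c \<in> conj_classes F" "\<And>x. x \<in> carrier F \<Longrightarrow> f x = g x"
  shows "class_map F' f c = class_map F' g c"
  using group.conj_classesD(1)[OF assms(1,2)] assms(3) by (simp add: class_map_def)

locale free_class =
  fixes S :: "'a set" and F :: "'a word monoid" and c :: "'a word set"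
  assumes F: "F = free_group S" and c: "c \<in> conj_classes F"
begin

sublocale F: group F
  unfolding F by (rule group_free_group)

lemma one_eq_Nil: "\<one>\<^bsub>F\<^esub> = []"
  by (simp add: F free_group_simps)

lemma c_carrier: "y \<in> c \<Longrightarrow> y \<in> carrier F"
  using F.conj_classesD(1)[OF c] .

lemma c_neq_Nil: "c \<noteq> {\<one>\<^bsub>F\<^esub>} \<Longrightarrow> y \<in> c \<Longrightarrow> y \<noteq> []"
  using F.one_in_class_iff[OF c] by (auto simp: one_eq_Nil)

lemma some_in_c: obtains y where "y \<in> c"
  using F.conj_classes_nonempty[OF c] by blast

abbreviation "R \<equiv> class_centralizer F c"

lemma root_carrier: "y \<in> c \<Longrightarrow> free_root F y \<in> carrier F"
  using free_root_carrier[of y S] c_carrier by (simp add: F)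

lemma root_pow_in_centralizer: "y \<in> c \<Longrightarrow> free_root F y [^]\<^bsub>F\<^esub> (k::int) \<in> centralizer F y"
  using free_root[of y S] c_carrier F.int_pow_in_centralizer unfolding F by blast

lemma R_cases [consumes 1, case_names one pow]:
  assumes "\<gamma> \<in> carrier R"
  obtains "c = {\<one>\<^bsub>F\<^esub>}" "\<gamma> \<one>\<^bsub>F\<^esub> \<in> carrier F"
  | k :: int where "c \<noteq> {\<one>\<^bsub>F\<^esub>}" "\<And>y. y \<in> c \<Longrightarrow> \<gamma> y = free_root F y [^]\<^bsub>F\<^esub> k"
proof (cases "c = {\<one>\<^bsub>F\<^esub>}")
  case True
  then show ?thesis
    using that(1) assms PiE_mem[of \<gamma> c "centralizer F" "\<one>\<^bsub>F\<^esub>"]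
    by (auto simp: class_centralizer_def F.centralizer_iff)
next
  case False
  then show ?thesis
    using that(2) assms by (auto simp: class_centralizer_def)
qed

lemma R_mem: "\<gamma> \<in> carrier R \<Longrightarrow> y \<in> c \<Longrightarrow> \<gamma> y \<in> centralizer F y"
  by (auto simp: class_centralizer_def)

lemma R_carrier: "\<gamma> \<in> carrier R \<Longrightarrow> y \<in> c \<Longrightarrow> \<gamma> y \<in> carrier F"
  and R_commute: "\<gamma> \<in> carrier R \<Longrightarrow> y \<in> c \<Longrightarrow> \<gamma> y \<otimes>\<^bsub>F\<^esub> y = y \<otimes>\<^bsub>F\<^esub> \<gamma> y"
  using R_mem[of \<gamma> y] c_carrier[of y] by (auto simp: F.centralizer_iff)

lemma R_extensional: "\<gamma> \<in> carrier R \<Longrightarrow> \<gamma> \<in> extensional c"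
  by (auto simp: class_centralizer_def PiE_def)

lemma R_powI: "(\<lambda>y\<in>c. free_root F y [^]\<^bsub>F\<^esub> (k::int)) \<in> carrier R"
  by (auto simp: class_centralizer_def root_pow_in_centralizer)

lemma R_oneI: "c = {\<one>\<^bsub>F\<^esub>} \<Longrightarrow> g \<in> carrier F \<Longrightarrow> (\<lambda>y\<in>c. g) \<in> carrier R"
  by (auto simp: class_centralizer_def F.centralizer_iff)

text \<open>For a non-trivial class, an element of the canonical centralizer is an exponent, which any one of its values determines because
  free groups are torsion free.\<close>

lemma R_eqI:
  assumes "\<gamma> \<in> carrier R" "\<delta> \<in> carrier R" "y \<in> c" "\<gamma> y = \<delta> y"
  shows "\<gamma> = \<delta>"
proof (rule extensionalityI[OF R_extensional[OF assms(1)] R_extensional[OF assms(2)]])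
  fix z assume z: "z \<in> c"
  show "\<gamma> z = \<delta> z"
    using assms(1)
  proof (cases rule: R_cases)
    case one
    then show ?thesis
      using z assms by auto
  next
    case (pow k)
    from assms(2) obtain l where l: "\<And>y. y \<in> c \<Longrightarrow> \<delta> y = free_root F y [^]\<^bsub>F\<^esub> (l::int)"
      using pow(1) by (cases rule: R_cases) auto
    have "free_root F y \<noteq> []"
      using free_root_neq_one[of y S] c_carrier[OF assms(3)] c_neq_Nil[OF pow(1) assms(3)] by (simp add: F)
    then have "k = l"
      using free_group_int_pow_inj[of "free_root F y" S k l] root_carrier[OF assms(3)] pow(2)[OF assms(3)]
        l[OF assms(3)] assms(4) by (simp add: F)
    then show ?thesis
      using pow(2) l z by simp
  qed
qed

lemma R_mult: "y \<in> c \<Longrightarrow> (\<gamma> \<otimes>\<^bsub>R\<^esub> \<delta>) y = \<gamma> y \<otimes>\<^bsub>F\<^esub> \<delta> y"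
  by (simp add: class_centralizer_def)

lemma R_mult_closed:
  assumes "\<gamma> \<in> carrier R" "\<delta> \<in> carrier R"
  shows "\<gamma> \<otimes>\<^bsub>R\<^esub> \<delta> \<in> carrier R"
  using assms(1)
proof (cases rule: R_cases)
  case one
  have "(\<gamma> \<otimes>\<^bsub>R\<^esub> \<delta>) = (\<lambda>y\<in>c. \<gamma> \<one>\<^bsub>F\<^esub> \<otimes>\<^bsub>F\<^esub> \<delta> \<one>\<^bsub>F\<^esub>)"
    using one by (auto simp: class_centralizer_def fun_eq_iff)
  then show ?thesis
    using R_oneI[OF one(1), of "\<gamma> \<one>\<^bsub>F\<^esub> \<otimes>\<^bsub>F\<^esub> \<delta> \<one>\<^bsub>F\<^esub>"] R_carrier[OF assms(1)] R_carrier[OF assms(2)] one by simp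
next
  case (pow k)
  from assms(2) obtain l where l: "\<And>y. y \<in> c \<Longrightarrow> \<delta> y = free_root F y [^]\<^bsub>F\<^esub> (l::int)"
    using pow(1) by (cases rule: R_cases) auto
  have "(\<gamma> \<otimes>\<^bsub>R\<^esub> \<delta>) = (\<lambda>y\<in>c. free_root F y [^]\<^bsub>F\<^esub> (k + l))"
    using pow l by (auto simp: class_centralizer_def fun_eq_iff F.int_pow_mult root_carrier)
  then show ?thesis
    using R_powI by simp
qed

lemma R_one_closed: "\<one>\<^bsub>R\<^esub> \<in> carrier R"
proof -
  have "\<one>\<^bsub>R\<^esub> = (\<lambda>y\<in>c. free_root F y [^]\<^bsub>F\<^esub> (0::int))"
    by (auto simp: class_centralizer_def fun_eq_iff)
  then show ?thesis
    using R_powI[of 0] by simp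
qed

lemma group_R: "group R"
proof (rule groupI)
  fix \<gamma> assume \<gamma>: "\<gamma> \<in> carrier R"
  show "\<exists>\<delta>\<in>carrier R. \<delta> \<otimes>\<^bsub>R\<^esub> \<gamma> = \<one>\<^bsub>R\<^esub>"
    using \<gamma>
  proof (cases rule: R_cases)
    case one
    show ?thesis
    proof (intro bexI[of _ "\<lambda>y\<in>c. inv\<^bsub>F\<^esub> (\<gamma> \<one>\<^bsub>F\<^esub>)"])
      show "(\<lambda>y\<in>c. inv\<^bsub>F\<^esub> (\<gamma> \<one>\<^bsub>F\<^esub>)) \<otimes>\<^bsub>R\<^esub> \<gamma> = \<one>\<^bsub>R\<^esub>"
        using one by (auto simp: class_centralizer_def fun_eq_iff)
    qed (use one R_oneI in simp)
  next
    case (pow k)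
    show ?thesis
    proof (intro bexI[of _ "\<lambda>y\<in>c. free_root F y [^]\<^bsub>F\<^esub> (- k)"])
      show "(\<lambda>y\<in>c. free_root F y [^]\<^bsub>F\<^esub> (- k)) \<otimes>\<^bsub>R\<^esub> \<gamma> = \<one>\<^bsub>R\<^esub>"
        using pow by (auto simp: class_centralizer_def fun_eq_iff F.int_pow_neg root_carrier)
    qed (use R_powI in simp)
  qed
  show "\<one>\<^bsub>R\<^esub> \<otimes>\<^bsub>R\<^esub> \<gamma> = \<gamma>"
    using R_carrier[OF \<gamma>] R_extensional[OF \<gamma>]
    by (intro extensionalityI[of _ c]) (auto simp: class_centralizer_def)
next
  fix \<gamma> \<delta> \<epsilon> assume *: "\<gamma> \<in> carrier R" "\<delta> \<in> carrier R" "\<epsilon> \<in> carrier R"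
  then show "\<gamma> \<otimes>\<^bsub>R\<^esub> \<delta> \<otimes>\<^bsub>R\<^esub> \<epsilon> = \<gamma> \<otimes>\<^bsub>R\<^esub> (\<delta> \<otimes>\<^bsub>R\<^esub> \<epsilon>)"
    using R_carrier by (auto simp: class_centralizer_def fun_eq_iff F.m_assoc)
qed (auto intro: R_mult_closed R_one_closed)

sublocale R: group R
  by (rule group_R)

lemma eval_hom: "y \<in> c \<Longrightarrow> (\<lambda>\<gamma>. \<gamma> y) \<in> hom R F"
  by (intro homI) (auto simp: R_mult R_carrier)

text \<open>Evaluation at conjugate elements is related by the same conjugation, for every conjugating element. For
  the trivial class this fails, as its canonical centralizer is the whole group.\<close>

lemma R_conj:
  assumes "c \<noteq> {\<one>\<^bsub>F\<^esub>}" "\<gamma> \<in> carrier R" "y \<in> c" "h \<in> carrier F"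
  shows "\<gamma> (h \<otimes>\<^bsub>F\<^esub> y \<otimes>\<^bsub>F\<^esub> inv\<^bsub>F\<^esub> h) = h \<otimes>\<^bsub>F\<^esub> \<gamma> y \<otimes>\<^bsub>F\<^esub> inv\<^bsub>F\<^esub> h"
proof -
  obtain k where k: "\<And>y. y \<in> c \<Longrightarrow> \<gamma> y = free_root F y [^]\<^bsub>F\<^esub> (k::int)"
    using assms(2,1) by (cases rule: R_cases) auto
  have "free_root F (h \<otimes>\<^bsub>F\<^esub> y \<otimes>\<^bsub>F\<^esub> inv\<^bsub>F\<^esub> h) = h \<otimes>\<^bsub>F\<^esub> free_root F y \<otimes>\<^bsub>F\<^esub> inv\<^bsub>F\<^esub> h"
    using free_root_conj[of y S h] assms c_carrier c_neq_Nil by (simp add: F)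
  then show ?thesis
    using k[OF assms(3)] k[OF F.conj_in_class[OF c assms(3,4)]] F.conj_int_pow[OF assms(4) root_carrier[OF assms(3)]]
    by simp
qed

text \<open>Roots are compatible with conjugation, so the exponent of \<open>y\<close> over its root is the same for all
  \<open>y \<in> c\<close>.\<close>

lemma twist_in_R: "(\<lambda>y\<in>c. y) \<in> carrier R"
proof (cases "c = {\<one>\<^bsub>F\<^esub>}")
  case True
  then have "(\<lambda>y\<in>c. y) = (\<lambda>y\<in>c. \<one>\<^bsub>F\<^esub>)"
    by auto
  then show ?thesis
    using R_oneI[OF True] by simp
next
  case False
  obtain y where y: "y \<in> c"
    by (rule some_in_c)
  obtain n where n: "y = free_root F y [^]\<^bsub>F\<^esub> (n::nat)"
    using free_root[of y S] c_carrier[OF y] unfolding F by blast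
  have "free_root F z [^]\<^bsub>F\<^esub> int n = z" if z: "z \<in> c" for z
  proof -
    obtain h where h: "h \<in> carrier F" "z = h \<otimes>\<^bsub>F\<^esub> y \<otimes>\<^bsub>F\<^esub> inv\<^bsub>F\<^esub> h"
      using F.conjugate_in_class[OF c y z] .
    show ?thesis
      using R_conj[OF False R_powI y h(1), of "int n"] n y z h by (simp add: int_pow_int)
  qed
  then have "(\<lambda>y\<in>c. y) = (\<lambda>y\<in>c. free_root F y [^]\<^bsub>F\<^esub> int n)"
    by (auto simp: fun_eq_iff)
  then show ?thesis
    using R_powI by simp
qed

end

locale free_class_hom = free_class S F c
  for S :: "'a set" and F :: "'a word monoid" and c :: "'a word set" +
  fixes S' :: "'b set" and F' :: "'b word monoid" and f :: "'a word \<Rightarrow> 'b word"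
  assumes F': "F' = free_group S'" and f: "f \<in> hom F F'"
begin

sublocale F': group F'
  unfolding F' by (rule group_free_group)

sublocale group_hom F F' f
  using f by (simp add: group_hom_def group_hom_axioms_def F.is_group F'.is_group)

abbreviation "c' \<equiv> class_map F' f c"

lemmas c'_eq = class_map_eq[OF F.is_group F'.is_group f c]
  and image_c' = image_in_class_map[OF F.is_group F'.is_group f c]
  and c'_class = class_map_in_conj_classes[OF F.is_group F'.is_group f c]

sublocale T: free_class S' F' c'
  using F' c'_class by unfold_locales

lemma f_int_pow: "x \<in> carrier F \<Longrightarrow> f (x [^]\<^bsub>F\<^esub> (k::int)) = f x [^]\<^bsub>F'\<^esub> k"
  by (rule hom_int_pow)

text \<open>The image of the root of \<open>y\<close> commutes with \<open>f y\<close>, so it is a power, with some exponent \<open>l\<close>, of the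
  root of \<open>f y\<close>, and \<open>l\<close> does not depend on \<open>y\<close> by compatibility with conjugation. If \<open>f\<close> kills the
  class, it kills the roots as well, since free groups are torsion free.\<close>

lemma induced_exists:
  assumes \<gamma>: "\<gamma> \<in> carrier R"
  shows "\<exists>\<gamma>'. \<gamma>' \<in> carrier T.R \<and> (\<forall>y\<in>c. \<gamma>' (f y) = f (\<gamma> y))"
  using \<gamma>
proof (cases rule: R_cases)
  case one
  then have "c' = {\<one>\<^bsub>F'\<^esub>}"
    using c'_eq[of "\<one>\<^bsub>F\<^esub>"] F'.conj_class_one by simp
  then show ?thesis
    using one T.R_oneI[of "f (\<gamma> \<one>\<^bsub>F\<^esub>)"] by (intro exI[of _ "\<lambda>y\<in>c'. f (\<gamma> \<one>\<^bsub>F\<^esub>)"]) auto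
next
  case (pow k)
  obtain y where y: "y \<in> c"
    by (rule some_in_c)
  show ?thesis
  proof (cases "c' = {\<one>\<^bsub>F'\<^esub>}")
    case True
    have "f (free_root F z) = \<one>\<^bsub>F'\<^esub>" if z: "z \<in> c" for z
    proof -
      obtain n where n: "n > 0" "z = free_root F z [^]\<^bsub>F\<^esub> (n::nat)"
        using free_root[of z S] c_carrier[OF z] unfolding F by blast
      have "f z = []"
        using image_c'[OF z] True by (simp add: T.one_eq_Nil)
      then have "f (free_root F z) [^]\<^bsub>F'\<^esub> n = []"
        using n(2) root_carrier[OF z] hom_nat_pow by metis
      then show ?thesis
        using free_group_pow_eq_one_iff[of "f (free_root F z)" S' n] n(1) root_carrier[OF z]
        by (simp add: F'[symmetric] T.one_eq_Nil)
    qed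
    then have "f (\<gamma> z) = \<one>\<^bsub>F'\<^esub>" if "z \<in> c" for z
      using that pow(2) root_carrier by (simp add: f_int_pow)
    then show ?thesis
      using True T.R_oneI[of "\<one>\<^bsub>F'\<^esub>"] image_c' by (intro exI[of _ "\<lambda>y\<in>c'. \<one>\<^bsub>F'\<^esub>"]) auto
  next
    case False
    obtain n where n: "y = free_root F y [^]\<^bsub>F\<^esub> (n::nat)"
      using free_root[of y S] c_carrier[OF y] unfolding F by blast
    have "f (free_root F y) \<otimes>\<^bsub>F'\<^esub> f y = f y \<otimes>\<^bsub>F'\<^esub> f (free_root F y)"
      using F.int_pow_in_centralizer[OF root_carrier[OF y] n, of 1] c_carrier[OF y] root_carrier[OF y]
      by (simp add: F.centralizer_iff flip: hom_mult)
    then obtain l where l: "f (free_root F y) = free_root F' (f y) [^]\<^bsub>F'\<^esub> (l::int)"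
      using free_root_generates[of "f (free_root F y)" S' "f y"] y root_carrier[OF y] c_carrier[OF y]
        T.c_neq_Nil[OF False image_c'[OF y]] by (auto simp: F'[symmetric])
    define \<gamma>' where "\<gamma>' = (\<lambda>z\<in>c'. free_root F' z [^]\<^bsub>F'\<^esub> (l * k))"
    have \<gamma>': "\<gamma>' \<in> carrier T.R"
      unfolding \<gamma>'_def by (rule T.R_powI)
    have *: "\<gamma>' (f y) = f (\<gamma> y)"
      using y image_c'[OF y] pow(2)[OF y] root_carrier[OF y] T.root_carrier[OF image_c'[OF y]]
      by (simp add: \<gamma>'_def f_int_pow l F'.int_pow_pow)
    have "\<gamma>' (f z) = f (\<gamma> z)" if z: "z \<in> c" for z
    proof -
      obtain h where h: "h \<in> carrier F" "z = h \<otimes>\<^bsub>F\<^esub> y \<otimes>\<^bsub>F\<^esub> inv\<^bsub>F\<^esub> h"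
        using F.conjugate_in_class[OF c y z] .
      then have "f z = f h \<otimes>\<^bsub>F'\<^esub> f y \<otimes>\<^bsub>F'\<^esub> inv\<^bsub>F'\<^esub> f h"
        using c_carrier[OF y] by simp
      then have "\<gamma>' (f z) = f h \<otimes>\<^bsub>F'\<^esub> \<gamma>' (f y) \<otimes>\<^bsub>F'\<^esub> inv\<^bsub>F'\<^esub> f h"
        using T.R_conj[OF False \<gamma>' image_c'[OF y], of "f h"] h(1) by simp
      also have "\<dots> = f (h \<otimes>\<^bsub>F\<^esub> \<gamma> y \<otimes>\<^bsub>F\<^esub> inv\<^bsub>F\<^esub> h)"
        using h(1) R_carrier[OF \<gamma> y] * by simp
      also have "\<dots> = f (\<gamma> z)"
        using R_conj[OF pow(1) \<gamma> y h(1)] h(2) by simp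
      finally show ?thesis .
    qed
    then show ?thesis
      using \<gamma>' by blast
  qed
qed

lemma induced:
  assumes "\<gamma> \<in> carrier R"
  shows "class_centralizer_map F' f c \<gamma> \<in> carrier T.R"
    and "y \<in> c \<Longrightarrow> class_centralizer_map F' f c \<gamma> (f y) = f (\<gamma> y)"
proof -
  have "\<exists>!\<gamma>'. \<gamma>' \<in> carrier T.R \<and> (\<forall>y\<in>c. \<gamma>' (f y) = f (\<gamma> y))"
  proof (rule ex_ex1I[OF induced_exists[OF assms]])
    fix \<delta> \<epsilon> assume "\<delta> \<in> carrier T.R \<and> (\<forall>y\<in>c. \<delta> (f y) = f (\<gamma> y))" "\<epsilon> \<in> carrier T.R \<and> (\<forall>y\<in>c. \<epsilon> (f y) = f (\<gamma> y))"
    then show "\<delta> = \<epsilon>"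
      by (metis T.R_eqI some_in_c image_c')
  qed
  from theI'[OF this]
  show "class_centralizer_map F' f c \<gamma> \<in> carrier T.R"
    and "y \<in> c \<Longrightarrow> class_centralizer_map F' f c \<gamma> (f y) = f (\<gamma> y)"
    unfolding class_centralizer_map_def by blast+
qed

lemma induced_unique:
  assumes "\<gamma> \<in> carrier R" "\<delta> \<in> carrier T.R" "y \<in> c" "\<delta> (f y) = f (\<gamma> y)"
  shows "class_centralizer_map F' f c \<gamma> = \<delta>"
  using T.R_eqI[OF induced(1)[OF assms(1)] assms(2) image_c'[OF assms(3)]] induced(2)[OF assms(1,3)] assms(4)
  by simp

lemma induced_hom: "class_centralizer_map F' f c \<in> hom R T.R"
proof (rule homI)
  fix \<gamma> \<delta> assume \<gamma>: "\<gamma> \<in> carrier R" and \<delta>: "\<delta> \<in> carrier R"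
  obtain y where y: "y \<in> c"
    by (rule some_in_c)
  show "class_centralizer_map F' f c (\<gamma> \<otimes>\<^bsub>R\<^esub> \<delta>)
    = class_centralizer_map F' f c \<gamma> \<otimes>\<^bsub>T.R\<^esub> class_centralizer_map F' f c \<delta>"
    using y \<gamma> \<delta> induced R_carrier[OF _ y] image_c'[OF y]
    by (intro induced_unique[of _ _ y] R_mult_closed T.R_mult_closed) (auto simp: R_mult T.R_mult)
qed (rule induced(1))

lemma induced_twist: "class_centralizer_map F' f c (\<lambda>y\<in>c. y) = (\<lambda>y\<in>c'. y)"
proof -
  obtain y where y: "y \<in> c"
    by (rule some_in_c)
  then show ?thesis
    using image_c'[OF y] by (intro induced_unique[of _ _ y] twist_in_R T.twist_in_R) auto
qed

text \<open>All values of an element of the canonical centralizer transform by the same conjugation, so one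
  \<open>\<kappa>\<close> that carries \<open>f x\<close> to \<open>x'\<close> serves for all \<open>\<gamma>\<close>. If the image class is trivial, its
  canonical centralizer is the whole group, but then \<open>f x = x'\<close>, and \<open>\<kappa> = \<one>\<close> serves.\<close>

lemma conjugator_exists:
  assumes x: "x \<in> c" and x': "x' \<in> c'"
  obtains \<kappa> where "\<kappa> \<in> carrier F'"
    "\<And>\<gamma>. \<gamma> \<in> carrier R \<Longrightarrow> class_centralizer_map F' f c \<gamma> x' = \<kappa> \<otimes>\<^bsub>F'\<^esub> f (\<gamma> x) \<otimes>\<^bsub>F'\<^esub> inv\<^bsub>F'\<^esub> \<kappa>"
proof (cases "c' = {\<one>\<^bsub>F'\<^esub>}")
  case True
  then have "x' = f x"
    using x' image_c'[OF x] by simp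
  then show ?thesis
    using that[of "\<one>\<^bsub>F'\<^esub>"] induced(2)[OF _ x] R_carrier[OF _ x] by simp
next
  case False
  obtain \<kappa> where \<kappa>: "\<kappa> \<in> carrier F'" "x' = \<kappa> \<otimes>\<^bsub>F'\<^esub> f x \<otimes>\<^bsub>F'\<^esub> inv\<^bsub>F'\<^esub> \<kappa>"
    using x' c'_eq[OF x] F'.conj_class_iff c_carrier[OF x] by auto
  show ?thesis
    using that[OF \<kappa>(1)] T.R_conj[OF False induced(1) image_c'[OF x] \<kappa>(1)] induced(2)[OF _ x] \<kappa>(2) by simp
qed

end

lemma induced_comp:
  assumes "free_class_hom S F c S' F' f" "F'' = free_group S''" "g \<in> hom F' F''"
    and \<gamma>: "\<gamma> \<in> carrier (class_centralizer F c)"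
  shows "class_centralizer_map F'' g (class_map F' f c) (class_centralizer_map F' f c \<gamma>)
    = class_centralizer_map F'' (g \<circ> f) c \<gamma>"
proof -
  interpret A: free_class_hom S F c S' F' f by fact
  have F'': "group F''"
    unfolding assms(2) by (rule group_free_group)
  interpret B: free_class_hom S' F' "class_map F' f c" S'' F'' g
    using assms(2,3) A.T.free_class_axioms by (simp add: free_class_hom_def free_class_hom_axioms_def)
  have gf: "g \<circ> f \<in> hom F F''"
    using A.f assms(3) hom_compose by blast
  interpret C: free_class_hom S F c S'' F'' "g \<circ> f"
    using assms(2) gf A.free_class_axioms by (simp add: free_class_hom_def free_class_hom_axioms_def)
  obtain y where y: "y \<in> c"
    by (rule A.some_in_c)
  have "class_map F'' g (class_map F' f c) = class_map F'' (g \<circ> f) c"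
    using class_map_comp[OF A.F.is_group A.F'.is_group F'' A.f assms(3) A.c] .
  then show ?thesis
    using \<gamma> y B.induced(1)[OF A.induced(1)[OF \<gamma>]] B.induced(2)[OF A.induced(1)[OF \<gamma>] A.image_c'[OF y]]
      A.induced(2)[OF \<gamma> y]
    by (intro C.induced_unique[symmetric, of _ _ y]) auto
qed

lemma induced_cong:
  assumes "free_class_hom S F c S' F' f" "\<And>x. x \<in> carrier F \<Longrightarrow> f x = g x"
    and \<gamma>: "\<gamma> \<in> carrier (class_centralizer F c)"
  shows "class_centralizer_map F' f c \<gamma> = class_centralizer_map F' g c \<gamma>"
proof -
  interpret A: free_class_hom S F c S' F' f by fact
  have "class_map F' f c = class_map F' g c"
    using class_map_cong[OF A.F.is_group A.c assms(2)] .
  then show ?thesis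
    using assms(2) A.c_carrier A.R_carrier[OF \<gamma>] by (simp add: class_centralizer_map_def cong: conj_cong ball_cong)
qed

section \<open>Linear maps on finitely supported functions\<close>

interpretation cvs: vector_space cscale
  by (rule vector_space_cscale)

abbreviation linear_c :: "(('a \<Rightarrow>\<^sub>0 complex) \<Rightarrow> ('b \<Rightarrow>\<^sub>0 complex)) \<Rightarrow> bool"
  where "linear_c \<equiv> Vector_Spaces.linear cscale cscale"

lemma linear_c_iff:
  "linear_c f \<longleftrightarrow> (\<forall>x y. f (x + y) = f x + f y) \<and> (\<forall>a x. f (cscale a x) = cscale a (f x))"
  by (simp add: Vector_Spaces.linear_iff vector_space_cscale)

abbreviation bas :: "'a \<Rightarrow> 'a \<Rightarrow>\<^sub>0 complex"
  where "bas x \<equiv> Poly_Mapping.single x 1"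

lemma cscale_single [simp]: "cscale a (Poly_Mapping.single x b) = Poly_Mapping.single x (a * b)"
  by (rule poly_mapping_eqI) (simp add: lookup_cscale lookup_single when_def)

lemma cextend_superset:
  assumes "finite A" "Poly_Mapping.keys c \<subseteq> A"
  shows "cextend f c = (\<Sum>x\<in>A. cscale (Poly_Mapping.lookup c x) (f x))"
  unfolding cextend_def by (rule sum.mono_neutral_left) (use assms in \<open>auto simp: in_keys_iff\<close>)

lemma linear_cextend: "linear_c (cextend f)"
unfolding linear_c_iff
proof (intro conjI allI)
  fix c d :: "'a \<Rightarrow>\<^sub>0 complex" and a :: complex
  let ?A = "Poly_Mapping.keys c \<union> Poly_Mapping.keys d"
  have "Poly_Mapping.keys (c + d) \<subseteq> ?A"
    by (rule Poly_Mapping.keys_add)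
  then show "cextend f (c + d) = cextend f c + cextend f d"
    by (simp add: cextend_superset[of ?A] lookup_add cvs.scale_left_distrib sum.distrib)
  have "Poly_Mapping.keys (cscale a c) \<subseteq> Poly_Mapping.keys c"
    by (auto simp: in_keys_iff lookup_cscale)
  then show "cextend f (cscale a c) = cscale a (cextend f c)"
    by (simp add: cextend_superset[of "Poly_Mapping.keys c"] lookup_cscale cvs.scale_sum_right)
qed

lemma cextend_single [simp]: "cextend f (Poly_Mapping.single x a) = cscale a (f x)"
  by (simp add: cextend_superset[of "{x}"] lookup_single)

lemma cextend_bas: "cextend bas c = c"
proof (rule poly_mapping_eqI)
  fix x
  have "Poly_Mapping.lookup (cextend bas c) x
      = (\<Sum>y\<in>Poly_Mapping.keys c. if y = x then Poly_Mapping.lookup c y else 0)"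
    unfolding cextend_def lookup_sum by (intro sum.cong) (simp_all add: lookup_single when_def)
  then show "Poly_Mapping.lookup (cextend bas c) x = Poly_Mapping.lookup c x"
    by (simp add: in_keys_iff)
qed

lemma linear_c_expand:
  assumes "linear_c f"
  shows "f c = (\<Sum>x\<in>Poly_Mapping.keys c. cscale (Poly_Mapping.lookup c x) (f (bas x)))"
proof -
  interpret module_hom cscale cscale f
    using assms by (simp add: linear_iff_module_hom)
  have "f c = f (cextend bas c)"
    by (simp add: cextend_bas)
  then show ?thesis
    unfolding cextend_def by (simp only: sum scale)
qed

lemma linear_c_eqI:
  assumes "linear_c f" "linear_c g" "Poly_Mapping.keys c \<subseteq> A" "\<And>x. x \<in> A \<Longrightarrow> f (bas x) = g (bas x)"
  shows "f c = g c"
  unfolding linear_c_expand[OF assms(1), of c] linear_c_expand[OF assms(2), of c]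
  by (intro sum.cong) (use assms in auto)

lemma linear_c_id: "linear_c (\<lambda>x. x)" and linear_c_zero: "linear_c (\<lambda>x. 0)"
  by (simp_all add: linear_c_iff)

lemma linear_c_compose: "linear_c f \<Longrightarrow> linear_c g \<Longrightarrow> linear_c (\<lambda>x. f (g x))"
  by (simp add: linear_c_iff)

lemma linear_c_simps:
  assumes "linear_c f"
  shows "f (x + y) = f x + f y" "f (x - y) = f x - f y" "f (- x) = - f x" "f 0 = 0"
    "f (cscale a x) = cscale a (f x)" "f (\<Sum>i\<in>I. g i) = (\<Sum>i\<in>I. f (g i))"
proof -
  interpret f: module_hom cscale cscale f
    using assms by (simp add: linear_iff_module_hom)
  show "f (x + y) = f x + f y" "f (x - y) = f x - f y" "f (- x) = - f x" "f 0 = 0"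
    "f (cscale a x) = cscale a (f x)" "f (\<Sum>i\<in>I. g i) = (\<Sum>i\<in>I. f (g i))"
    by (simp_all add: f.add f.diff f.neg f.zero f.scale f.sum)
qed

lemma linear_c_add: "linear_c f \<Longrightarrow> linear_c g \<Longrightarrow> linear_c (\<lambda>x. f x + g x)"
  and linear_c_sub: "linear_c f \<Longrightarrow> linear_c g \<Longrightarrow> linear_c (\<lambda>x. f x - g x)"
  and linear_c_scale: "linear_c f \<Longrightarrow> linear_c (\<lambda>x. cscale a (f x))"
  by (simp_all add: linear_c_iff cvs.scale_right_distrib cvs.scale_right_diff_distrib mult.commute)

lemma linear_c_sum: "(\<And>i. i \<in> I \<Longrightarrow> linear_c (f i)) \<Longrightarrow> linear_c (\<lambda>x. \<Sum>i\<in>I. f i x)"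
  by (induction I rule: infinite_finite_induct) (simp_all add: linear_c_zero linear_c_add)

lemmas cextend_simps = linear_c_simps[OF linear_cextend]

definition supported :: "'a set \<Rightarrow> ('a \<Rightarrow>\<^sub>0 complex) set"
  where "supported A = {c. Poly_Mapping.keys c \<subseteq> A}"

lemma supported_zero [simp]: "0 \<in> supported A"
  and supported_bas_iff [simp]: "bas x \<in> supported A \<longleftrightarrow> x \<in> A"
  and supported_single: "x \<in> A \<Longrightarrow> Poly_Mapping.single x a \<in> supported A"
  by (auto simp: supported_def)

lemma supported_add: "c \<in> supported A \<Longrightarrow> d \<in> supported A \<Longrightarrow> c + d \<in> supported A"
  and supported_scale: "c \<in> supported A \<Longrightarrow> cscale a c \<in> supported A"
  using Poly_Mapping.keys_add[of c d] by (auto simp: supported_def in_keys_iff lookup_cscale)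

lemma supported_neg: "c \<in> supported A \<Longrightarrow> - c \<in> supported A"
  by (auto simp: supported_def in_keys_iff)

lemma supported_diff: "c \<in> supported A \<Longrightarrow> d \<in> supported A \<Longrightarrow> c - d \<in> supported A"
  using supported_add[of c A "- d"] supported_neg[of d A] by (simp del: add_uminus_conv_diff add: diff_conv_add_uminus)

lemma supported_sum: "(\<And>i. i \<in> I \<Longrightarrow> f i \<in> supported A) \<Longrightarrow> (\<Sum>i\<in>I. f i) \<in> supported A"
  by (induction I rule: infinite_finite_induct) (auto intro: supported_add)

lemma linear_c_supported:
  assumes "linear_c f" "\<And>x. x \<in> A \<Longrightarrow> f (bas x) \<in> supported B" "c \<in> supported A"
  shows "f c \<in> supported B"
  unfolding linear_c_expand[OF assms(1), of c]
  by (intro supported_sum supported_scale assms(2)) (use assms(3) in \<open>auto simp: supported_def\<close>)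

lemma linear_c_eq_on:
  assumes "linear_c f" "linear_c g" "c \<in> supported A" "\<And>x. x \<in> A \<Longrightarrow> f (bas x) = g (bas x)"
  shows "f c = g c"
  using linear_c_eqI[OF assms(1,2) _ assms(4)] assms(3) by (simp add: supported_def)

section \<open>The cyclic bicomplex\<close>

text \<open>The term at \<open>(i, j)\<close> with \<open>j < i\<close> cancels against the one at \<open>(j, i - 1)\<close>.\<close>

lemma alternating_double_sum:
  fixes g :: "nat \<Rightarrow> nat \<Rightarrow> 'a \<Rightarrow>\<^sub>0 complex"
  assumes "\<And>i j. j < i \<Longrightarrow> i \<le> Suc n \<Longrightarrow> g i j = g j (i - 1)"
  shows "(\<Sum>i\<le>Suc n. \<Sum>j\<le>n. cscale ((- 1) ^ (i + j)) (g i j)) = 0"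
proof -
  let ?f = "\<lambda>(i, j). cscale ((- 1) ^ (i + j)) (g i j)"
  let ?A = "{(i, j). i \<le> Suc n \<and> j \<le> n \<and> j < i}" and ?B = "{(i, j). i \<le> Suc n \<and> j \<le> n \<and> i \<le> j}"
  have fin: "finite ?A" "finite ?B"
    by (rule finite_subset[of _ "{..Suc n} \<times> {..n}"]; auto)+
  have "(\<Sum>i\<le>Suc n. \<Sum>j\<le>n. cscale ((- 1) ^ (i + j)) (g i j)) = sum ?f ({..Suc n} \<times> {..n})"
    by (simp add: sum.cartesian_product)
  also have "{..Suc n} \<times> {..n} = ?A \<union> ?B"
    by auto
  also have "sum ?f (?A \<union> ?B) = sum ?f ?A + sum ?f ?B"
    by (rule sum.union_disjoint) (use fin in auto)
  also have "sum ?f ?A = sum (\<lambda>p. - ?f p) ?B"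
  proof (rule sum.reindex_bij_witness[of _ "\<lambda>(i, j). (Suc j, i)" "\<lambda>(i, j). (j, i - 1)"])
    fix p assume p: "p \<in> ?A"
    obtain i j where ij: "p = (i, j)" "j < i" "i \<le> Suc n"
      using p by auto
    have "(- 1 :: complex) ^ (i + j) = - ((- 1) ^ (j + (i - 1)))"
      using ij(2) by (cases i) (auto simp: add.commute)
    then show "- ?f (case p of (i, j) \<Rightarrow> (j, i - 1)) = ?f p"
      using assms[OF ij(2,3)] by (simp add: ij(1) cvs.scale_minus_left)
  qed auto
  finally show ?thesis
    by (simp add: sum_negf)
qed

locale cyclic_cells =
  fixes X :: "'a cyclic_set"
  assumes face_cells: "x \<in> cells X n \<Longrightarrow> 0 < n \<Longrightarrow> i \<le> n \<Longrightarrow> face X n i x \<in> cells X (n - 1)"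
    and cyc_cells: "x \<in> cells X n \<Longrightarrow> cyc X n x \<in> cells X n"
begin

lemma cyc_pow_cells: "x \<in> cells X n \<Longrightarrow> (cyc X n ^^ j) x \<in> cells X n"
  by (induction j) (auto intro: cyc_cells)

end

definition CC_basis :: "'a cyclic_set \<Rightarrow> nat \<Rightarrow> (nat \<times> 'a) set"
  where "CC_basis X n = {(p, x). p \<le> n \<and> x \<in> cells X (n - p)}"

lemma CC_basis_iff [simp]: "(p, x) \<in> CC_basis X n \<longleftrightarrow> p \<le> n \<and> x \<in> cells X (n - p)"
  by (simp add: CC_basis_def)

lemma chains_CC: "chains (CC X) n = supported (CC_basis X n)"
  by (simp add: CC_def supported_def CC_basis_def)

lemma bdry_CC: "bdry (CC X) n = cextend (\<lambda>(p, x). cyclic_vert X p (n - p) x + cyclic_horiz X p (n - p) x)"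
  by (simp add: CC_def)

lemma linear_bdry_CC: "linear_c (bdry (CC X) n)"
  unfolding bdry_CC by (rule linear_cextend)

lemma linear_CC_map: "linear_c (CC_map f)"
  unfolding CC_map_def by (rule linear_cextend)

lemma CC_map_single [simp]: "CC_map f (Poly_Mapping.single (p, x) a) = Poly_Mapping.single (p, f x) a"
  by (simp add: CC_map_def)

lemma CC_map_comp: "CC_map f (CC_map g c) = CC_map (\<lambda>x. f (g x)) c"
  by (rule linear_c_eqI[OF linear_c_compose[OF linear_CC_map linear_CC_map] linear_CC_map, of _ UNIV]) auto

lemma CC_map_supported:
  assumes "\<And>n x. x \<in> cells X n \<Longrightarrow> f x \<in> cells Y n" "c \<in> supported (CC_basis X n)"
  shows "CC_map f c \<in> supported (CC_basis Y n)"
  by (rule linear_c_supported[OF linear_CC_map _ assms(2)]) (use assms(1) in auto)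

lemma bdry_CC_bas:
  "bdry (CC X) n (bas (p, x)) = cyclic_vert X p (n - p) x + cyclic_horiz X p (n - p) x"
  by (simp add: bdry_CC)

context cyclic_cells
begin

lemma vert_supported:
  assumes "x \<in> cells X q"
  shows "cyclic_vert X p q x \<in> supported (CC_basis X (p + q - 1))"
proof (cases "q = 0")
  case False
  then have "p + q - 1 - p = q - 1" "p \<le> p + q - 1"
    by simp_all
  then show ?thesis
    using face_cells[OF assms] False
    by (auto simp: cyclic_vert_def intro!: supported_sum supported_neg supported_single)
qed (simp add: cyclic_vert_def)

lemma horiz_supported:
  assumes "x \<in> cells X q"
  shows "cyclic_horiz X p q x \<in> supported (CC_basis X (p + q - 1))"
proof (cases "p = 0")
  case False
  then have "p + q - 1 - (p - 1) = q" "p - 1 \<le> p + q - 1"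
    by simp_all
  then show ?thesis
    using cyc_pow_cells[OF assms] cyc_cells[OF assms] assms False
    by (auto simp: cyclic_horiz_def intro!: supported_sum supported_diff supported_single)
qed (simp add: cyclic_horiz_def)

lemma bdry_supported:
  assumes "c \<in> supported (CC_basis X n)"
  shows "bdry (CC X) n c \<in> supported (CC_basis X (n - 1))"
proof (rule linear_c_supported[OF linear_bdry_CC _ assms])
  fix y assume "y \<in> CC_basis X n"
  then obtain p x where y: "y = (p, x)" "p \<le> n" "x \<in> cells X (n - p)"
    by (cases y) auto
  then show "bdry (CC X) n (bas y) \<in> supported (CC_basis X (n - 1))"
    using vert_supported[OF y(3), of p] horiz_supported[OF y(3), of p]
    by (simp add: bdry_CC_bas supported_add)
qed

lemma bdry_zero: "bdry (CC X) 0 c = 0" if "c \<in> supported (CC_basis X 0)"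
  by (rule linear_c_eq_on[OF linear_bdry_CC linear_c_zero that])
    (auto simp: bdry_CC_bas cyclic_vert_def cyclic_horiz_def CC_basis_def)

end

definition cyclic_map :: "'a cyclic_set \<Rightarrow> 'b cyclic_set \<Rightarrow> ('a \<Rightarrow> 'b) \<Rightarrow> bool"
  where "cyclic_map X Y f \<longleftrightarrow> (\<forall>n. \<forall>x\<in>cells X n. f x \<in> cells Y n \<and> f (cyc X n x) = cyc Y n (f x) \<and>
    (0 < n \<longrightarrow> (\<forall>i\<le>n. f (face X n i x) = face Y n i (f x))))"

lemma cyclic_map_cells: "cyclic_map X Y f \<Longrightarrow> x \<in> cells X n \<Longrightarrow> f x \<in> cells Y n"
  by (simp add: cyclic_map_def)

context cyclic_cells
begin

lemma CC_map_bdry: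
  assumes f: "cyclic_map X Y f" and c: "c \<in> supported (CC_basis X n)"
  shows "bdry (CC Y) n (CC_map f c) = CC_map f (bdry (CC X) n c)"
proof (rule linear_c_eq_on[OF linear_c_compose[OF linear_bdry_CC linear_CC_map]
      linear_c_compose[OF linear_CC_map linear_bdry_CC] c])
  fix y assume "y \<in> CC_basis X n"
  then obtain p x where y: "y = (p, x)" "p \<le> n" "x \<in> cells X (n - p)"
    by (cases y) auto
  have pow: "f ((cyc X (n - p) ^^ j) x) = (cyc Y (n - p) ^^ j) (f x)" for j
    using f cyc_pow_cells[OF y(3)] by (induction j) (auto simp: cyclic_map_def)
  have "cyclic_vert Y p (n - p) (f x) = CC_map f (cyclic_vert X p (n - p) x)"
    using f y(3) by (auto simp: cyclic_vert_def linear_c_simps[OF linear_CC_map] cyclic_map_def intro!: sum.cong)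
  moreover have "cyclic_horiz Y p (n - p) (f x) = CC_map f (cyclic_horiz X p (n - p) x)"
    using f y(3) by (auto simp: cyclic_horiz_def linear_c_simps[OF linear_CC_map] cyclic_map_def pow intro!: sum.cong)
  ultimately show "bdry (CC Y) n (CC_map f (bas y)) = CC_map f (bdry (CC X) n (bas y))"
    by (simp add: y(1) bdry_CC_bas linear_c_simps[OF linear_CC_map])
qed

end

locale precyclic_set = cyclic_cells X for X :: "'a cyclic_set" +
  assumes face_face: "x \<in> cells X n \<Longrightarrow> 1 < n \<Longrightarrow> i < j \<Longrightarrow> j \<le> n \<Longrightarrow>
      face X (n - 1) i (face X n j x) = face X (n - 1) (j - 1) (face X n i x)"
    and face_cyc: "x \<in> cells X n \<Longrightarrow> 0 < i \<Longrightarrow> i \<le> n \<Longrightarrow> face X n i (cyc X n x) = cyc X (n - 1) (face X n (i - 1) x)"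
    and face_0_cyc: "x \<in> cells X n \<Longrightarrow> 0 < n \<Longrightarrow> face X n 0 (cyc X n x) = face X n n x"
    and cyc_order: "x \<in> cells X n \<Longrightarrow> (cyc X n ^^ Suc n) x = x"
begin

lemma face_cyc_pow_le:
  assumes "x \<in> cells X n" "j \<le> i" "i \<le> n" "0 < n"
  shows "face X n i ((cyc X n ^^ j) x) = (cyc X (n - 1) ^^ j) (face X n (i - j) x)"
  using assms
proof (induction j arbitrary: i)
  case (Suc j)
  have "face X n i (cyc X n ((cyc X n ^^ j) x)) = cyc X (n - 1) (face X n (i - 1) ((cyc X n ^^ j) x))"
    using Suc.prems by (intro face_cyc cyc_pow_cells) auto
  also have "\<dots> = cyc X (n - 1) ((cyc X (n - 1) ^^ j) (face X n (i - 1 - j) x))"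
    using Suc.IH[of "i - 1"] Suc.prems by simp
  finally show ?case
    by simp
qed simp

text \<open>Here the zeroth face is met after \<open>i\<close> steps. It absorbs one cyclic operator and turns into the last
  face, which accounts for the exponent \<open>j - 1\<close>.\<close>

lemma face_cyc_pow_gt:
  assumes "x \<in> cells X n" "i < j" "j \<le> n"
  shows "face X n i ((cyc X n ^^ j) x) = (cyc X (n - 1) ^^ (j - 1)) (face X n (n + 1 + i - j) x)"
proof -
  have "face X n i ((cyc X n ^^ j) x) = face X n i ((cyc X n ^^ i) ((cyc X n ^^ (j - i)) x))"
    using assms by (simp flip: funpow_add comp_apply[of "cyc X n ^^ i"])
  also have "\<dots> = (cyc X (n - 1) ^^ i) (face X n 0 ((cyc X n ^^ (j - i)) x))"
    using face_cyc_pow_le[of "(cyc X n ^^ (j - i)) x" n i i] assms cyc_pow_cells by simp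
  also have "(cyc X n ^^ (j - i)) x = cyc X n ((cyc X n ^^ (j - i - 1)) x)"
    using assms by (cases "j - i") auto
  also have "face X n 0 \<dots> = face X n n ((cyc X n ^^ (j - i - 1)) x)"
    using assms cyc_pow_cells by (intro face_0_cyc) auto
  also have "\<dots> = (cyc X (n - 1) ^^ (j - i - 1)) (face X n (n + 1 + i - j) x)"
    using face_cyc_pow_le[of x n "j - i - 1" n] assms by simp
  also have "(cyc X (n - 1) ^^ i) \<dots> = (cyc X (n - 1) ^^ (i + (j - i - 1))) (face X n (n + 1 + i - j) x)"
    by (simp add: funpow_add)
  also have "i + (j - i - 1) = j - 1"
    using assms by simp
  finally show ?thesis .
qed

lemma vert_vert:
  assumes x: "x \<in> cells X (Suc q)"
  shows "cextend (\<lambda>(p, y). cyclic_vert X p q y) (cyclic_vert X p (Suc q) x) = 0"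
proof (cases q)
  case (Suc r)
  let ?g = "\<lambda>i j. bas (p, face X q j (face X (Suc q) i x))"
  have g: "?g i j = ?g j (i - 1)" if "j < i" "i \<le> Suc q" for i j
    using face_face[OF x, of j i] that Suc by simp
  show ?thesis
  proof (cases "even p")
    case True
    have "cextend (\<lambda>(p, y). cyclic_vert X p q y) (cyclic_vert X p (Suc q) x)
      = (\<Sum>i\<le>Suc q. \<Sum>j\<le>q. cscale ((- 1) ^ (i + j)) (?g i j))"
      using True Suc unfolding cyclic_vert_def
      by (simp add: cextend_simps cvs.scale_sum_right power_add del: sum.atMost_Suc)
    then show ?thesis
      using alternating_double_sum[of q ?g, OF g] by simp
  next
    case False
    have "cextend (\<lambda>(p, y). cyclic_vert X p q y) (cyclic_vert X p (Suc q) x)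
      = (\<Sum>i\<le>Suc r. \<Sum>j\<le>r. cscale ((- 1) ^ (i + j)) (?g i j))"
      using False Suc unfolding cyclic_vert_def
      by (simp add: cextend_simps cvs.scale_sum_right power_add sum_negf lessThan_Suc_atMost
          del: sum.atMost_Suc sum.lessThan_Suc)
    then show ?thesis
      using alternating_double_sum[of r ?g, OF g] Suc by simp
  qed
qed (simp add: cyclic_vert_def cextend_simps)

text \<open>The composites of \<open>1 - t\<close> and the norm telescope to \<open>1 - t ^ (q + 1)\<close>, which is zero: the signs
  \<open>(- 1) ^ (q * (q + 1))\<close> are trivial.\<close>

lemma horiz_horiz:
  assumes x: "x \<in> cells X q"
  shows "cextend (\<lambda>(p, y). cyclic_horiz X p q y) (cyclic_horiz X p q x) = 0"
proof (cases "p \<le> 1")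
  case False
  define a where "a j = Poly_Mapping.single (p - 2, (cyc X q ^^ j) x) ((- 1 :: complex) ^ (q * j))" for j
  have tel: "(\<Sum>j\<le>q. a j - a (Suc j)) = 0"
    unfolding sum_telescope using cyc_order[OF x]
    by (simp add: a_def del: funpow.simps mult_Suc_right)
  have p: "p - 1 - 1 = p - 2" "p - 1 \<noteq> 0"
    using False by auto
  show ?thesis
  proof (cases "even p")
    case True
    then have "odd (p - 1)"
      using False by simp
    have "cextend (\<lambda>(p, y). cyclic_horiz X p q y) (cyclic_horiz X p q x) = (\<Sum>j\<le>q. a j - a (Suc j))"
      using True \<open>odd (p - 1)\<close> p False
      by (simp add: cyclic_horiz_def cextend_simps a_def cvs.scale_right_diff_distrib power_add mult.commute)
    then show ?thesis
      using tel by simp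
  next
    case odd: False
    then have "even (p - 1)"
      by simp
    have "cextend (\<lambda>(p, y). cyclic_horiz X p q y) (cyclic_horiz X p q x) = (\<Sum>j\<le>q. a j - a (Suc j))"
      using odd \<open>even (p - 1)\<close> p False
      by (simp add: cyclic_horiz_def cextend_simps a_def cvs.scale_sum_right power_add mult.commute
          sum_subtractf funpow_swap1)
    then show ?thesis
      using tel by simp
  qed
qed (auto simp: cyclic_horiz_def cextend_simps)

text \<open>For the norm, the faces of the iterated cyclic operators are reindexed; the boundary between
  the two cases of \<open>i\<close> and \<open>j\<close> below is where the zeroth face wraps around.\<close>

lemma norm_face_sum:
  assumes x: "x \<in> cells X (Suc r)"
  shows "(\<Sum>j\<le>Suc r. \<Sum>i\<le>r. Poly_Mapping.single (p, face X (Suc r) i ((cyc X (Suc r) ^^ j) x)) ((- 1 :: complex) ^ (Suc r * j + i)))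
    = (\<Sum>i\<le>Suc r. \<Sum>j\<le>r. Poly_Mapping.single (p, (cyc X r ^^ j) (face X (Suc r) i x)) ((- 1) ^ (i + r * j)))"
    (is "?L = ?R")
proof -
  let ?l = "\<lambda>(j, i). Poly_Mapping.single (p, face X (Suc r) i ((cyc X (Suc r) ^^ j) x)) ((- 1 :: complex) ^ (Suc r * j + i))"
  let ?r = "\<lambda>(i, j). Poly_Mapping.single (p, (cyc X r ^^ j) (face X (Suc r) i x)) ((- 1 :: complex) ^ (i + r * j))"
  have "?L = sum ?l ({..Suc r} \<times> {..r})"
    by (simp add: sum.cartesian_product)
  also have "\<dots> = sum ?r ({..Suc r} \<times> {..r})"
  proof (rule sum.reindex_bij_witness[of _
        "\<lambda>(k, l). if k + l \<le> r then (l, k + l) else (Suc l, k + l - Suc r)"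
        "\<lambda>(j, i). if j \<le> i then (i - j, j) else (r + 2 + i - j, j - 1)"])
    fix a assume a: "a \<in> {..Suc r} \<times> {..r}"
    obtain j i where ji: "a = (j, i)" "j \<le> Suc r" "i \<le> r"
      using a by auto
    show "?r (case a of (j, i) \<Rightarrow> if j \<le> i then (i - j, j) else (r + 2 + i - j, j - 1)) = ?l a"
    proof (cases "j \<le> i")
      case True
      have "even (i - j + r * j) \<longleftrightarrow> even (Suc r * j + i)"
        using True by auto
      then have "(- 1 :: complex) ^ (i - j + r * j) = (- 1) ^ (Suc r * j + i)"
        by (simp only: minus_one_power_iff)
      then show ?thesis
        using True ji face_cyc_pow_le[OF x, of j i] by (simp del: mult_Suc)
    next
      case False
      then obtain k where k: "j = Suc k" "k \<le> r" "i \<le> k"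
        using ji by (cases j) auto
      have "even (r + 1 + i - k + r * k) \<longleftrightarrow> even (Suc r * Suc k + i)"
        using k by auto
      then have "(- 1 :: complex) ^ (r + 1 + i - k + r * k) = (- 1) ^ (Suc r * Suc k + i)"
        by (simp only: minus_one_power_iff)
      then show ?thesis
        using False ji k face_cyc_pow_gt[OF x, of i j] by (simp del: mult_Suc mult_Suc_right)
    qed
  qed auto
  also have "\<dots> = ?R"
    by (simp add: sum.cartesian_product)
  finally show ?thesis .
qed

text \<open>These are the relations \<open>b (1 - t) = (1 - t) b'\<close> and \<open>b' N = N b\<close>; the sign of \<open>- b'\<close> turns them into
  anticommutation.\<close>

lemma horiz_vert:
  assumes x: "x \<in> cells X (Suc r)"
  shows "cextend (\<lambda>(p, y). cyclic_horiz X p r y) (cyclic_vert X p (Suc r) x)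
    + cextend (\<lambda>(p, y). cyclic_vert X p (Suc r) y) (cyclic_horiz X p (Suc r) x) = 0"
proof (cases "p = 0")
  case False
  show ?thesis
  proof (cases "even p")
    case True
    then have "odd (p - 1)"
      using False by simp
    have 1: "cextend (\<lambda>(p, y). cyclic_horiz X p r y) (cyclic_vert X p (Suc r) x)
      = (\<Sum>i\<le>Suc r. \<Sum>j\<le>r. Poly_Mapping.single (p - 1, (cyc X r ^^ j) (face X (Suc r) i x)) ((- 1) ^ (i + r * j)))"
      using True False by (simp add: cyclic_horiz_def cyclic_vert_def cextend_simps cvs.scale_sum_right power_add
          del: sum.atMost_Suc)
    have 2: "cextend (\<lambda>(p, y). cyclic_vert X p (Suc r) y) (cyclic_horiz X p (Suc r) x)
      = - (\<Sum>j\<le>Suc r. \<Sum>i\<le>r. Poly_Mapping.single (p - 1, face X (Suc r) i ((cyc X (Suc r) ^^ j) x)) ((- 1) ^ (Suc r * j + i)))"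
      using True False \<open>odd (p - 1)\<close>
      by (simp add: cyclic_horiz_def cyclic_vert_def cextend_simps cvs.scale_sum_right cvs.scale_minus_right
          power_add sum_negf lessThan_Suc_atMost del: sum.atMost_Suc sum.lessThan_Suc)
    show ?thesis
      unfolding 1 2 norm_face_sum[OF x] by simp
  next
    case odd: False
    then have "even (p - 1)"
      by simp
    let ?d = "\<lambda>i. face X (Suc r) i x"
    have 1: "cextend (\<lambda>(p, y). cyclic_horiz X p r y) (cyclic_vert X p (Suc r) x)
      = - (\<Sum>i\<le>r. cscale ((- 1) ^ i) (bas (p - 1, ?d i)))
        + (\<Sum>i\<le>r. cscale ((- 1) ^ (r + i)) (bas (p - 1, cyc X r (?d i))))"
      using odd False by (simp add: cyclic_horiz_def cyclic_vert_def cextend_simps lessThan_Suc_atMost cvs.scale_right_diff_distrib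
          sum_subtractf power_add mult.commute del: sum.atMost_Suc sum.lessThan_Suc)
    have "cextend (\<lambda>(p, y). cyclic_vert X p (Suc r) y) (cyclic_horiz X p (Suc r) x)
      = (\<Sum>i\<le>Suc r. cscale ((- 1) ^ i) (bas (p - 1, ?d i)))
        - (\<Sum>i\<le>Suc r. cscale ((- 1) ^ (Suc r + i)) (bas (p - 1, face X (Suc r) i (cyc X (Suc r) x))))"
      using odd False \<open>even (p - 1)\<close> by (simp add: cyclic_horiz_def cyclic_vert_def cextend_simps cvs.scale_sum_right
          power_add del: sum.atMost_Suc)
    also have "(\<Sum>i\<le>Suc r. cscale ((- 1) ^ (Suc r + i)) (bas (p - 1, face X (Suc r) i (cyc X (Suc r) x))))
      = cscale ((- 1) ^ Suc r) (bas (p - 1, ?d (Suc r))) +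
        (\<Sum>i\<le>r. cscale ((- 1) ^ (r + i)) (bas (p - 1, cyc X r (?d i))))"
      unfolding sum.atMost_Suc_shift using face_0_cyc[OF x] face_cyc[OF x] by simp
    finally show ?thesis
      unfolding 1 by simp
  qed
qed (auto simp: cyclic_horiz_def cyclic_vert_def cextend_simps split: if_splits)

end

lemma cextend_add_fun: "cextend (\<lambda>x. f x + g x) c = cextend f c + cextend g c"
  by (simp add: cextend_def cvs.scale_right_distrib sum.distrib)

lemma cextend_zero: "cextend (\<lambda>_. 0) c = 0"
  by (simp add: cextend_def)

lemma cextend_eq_on: "c \<in> supported A \<Longrightarrow> (\<And>x. x \<in> A \<Longrightarrow> f x = g x) \<Longrightarrow> cextend f c = cextend g c"
  by (rule linear_c_eq_on[OF linear_cextend linear_cextend, of _ A]) auto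

lemma supported_mono: "c \<in> supported A \<Longrightarrow> A \<subseteq> B \<Longrightarrow> c \<in> supported B"
  by (auto simp: supported_def)

text \<open>The two parts of the differential are kept apart because the contraction of the cylinder below
  inverts only the vertical one.\<close>

definition vert :: "'a cyclic_set \<Rightarrow> nat \<Rightarrow> (nat \<times> 'a \<Rightarrow>\<^sub>0 complex) \<Rightarrow> (nat \<times> 'a \<Rightarrow>\<^sub>0 complex)"
  where "vert X n = cextend (\<lambda>(p, x). cyclic_vert X p (n - p) x)"

definition horiz :: "'a cyclic_set \<Rightarrow> nat \<Rightarrow> (nat \<times> 'a \<Rightarrow>\<^sub>0 complex) \<Rightarrow> (nat \<times> 'a \<Rightarrow>\<^sub>0 complex)"
  where "horiz X n = cextend (\<lambda>(p, x). cyclic_horiz X p (n - p) x)"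

lemma linear_vert: "linear_c (vert X n)" and linear_horiz: "linear_c (horiz X n)"
  unfolding vert_def horiz_def by (rule linear_cextend)+

lemma bdry_eq: "bdry (CC X) n c = vert X n c + horiz X n c"
  by (simp add: bdry_CC vert_def horiz_def cextend_add_fun[symmetric] case_prod_unfold)

lemma vert_supported_col: "cyclic_vert X p q x \<in> supported ({p} \<times> UNIV)"
  by (auto simp: cyclic_vert_def intro!: supported_sum supported_neg supported_single)

lemma horiz_supported_col: "cyclic_horiz X p q x \<in> supported ({p - 1} \<times> UNIV)"
  by (auto simp: cyclic_horiz_def intro!: supported_sum supported_diff supported_single)

context precyclic_set
begin

lemma bdry_bdry:
  assumes c: "c \<in> supported (CC_basis X n)"
  shows "bdry (CC X) (n - 1) (bdry (CC X) n c) = 0"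
proof (rule linear_c_eq_on[OF linear_c_compose[OF linear_bdry_CC linear_bdry_CC] linear_c_zero c])
  fix y assume "y \<in> CC_basis X n"
  then obtain p x where y: "y = (p, x)" "p \<le> n" "x \<in> cells X (n - p)"
    by (cases y) auto
  define q where "q = n - p"
  let ?V = "cyclic_vert X p q x" and ?H = "cyclic_horiz X p q x"
  have bas: "bdry (CC X) n (bas y) = ?V + ?H"
    by (simp add: y(1) q_def bdry_CC_bas)
  have V: "bdry (CC X) (n - 1) ?V = cextend (\<lambda>(p, y). cyclic_vert X p (q - 1) y) ?V
      + cextend (\<lambda>(p, y). cyclic_horiz X p (q - 1) y) ?V"
    unfolding bdry_CC cextend_add_fun[symmetric]
    by (rule cextend_eq_on[OF vert_supported_col]) (auto simp: q_def)
  have H: "bdry (CC X) (n - 1) ?H = cextend (\<lambda>(p, y). cyclic_vert X p q y) ?H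
      + cextend (\<lambda>(p, y). cyclic_horiz X p q y) ?H"
  proof (cases "p = 0")
    case False
    then show ?thesis
      unfolding bdry_CC cextend_add_fun[symmetric]
      by (intro cextend_eq_on[OF horiz_supported_col]) (use y(2) in \<open>auto simp: q_def\<close>)
  qed (simp add: cyclic_horiz_def linear_c_simps[OF linear_bdry_CC] cextend_simps)
  have x: "x \<in> cells X q"
    using y q_def by simp
  show "bdry (CC X) (n - 1) (bdry (CC X) n (bas y)) = 0"
  proof (cases q)
    case 0
    then have "?V = 0" "(\<lambda>(p, y). cyclic_vert X p q y) = (\<lambda>_. 0)"
      by (auto simp: cyclic_vert_def fun_eq_iff)
    then show ?thesis
      using horiz_horiz[OF x] unfolding bas linear_c_simps[OF linear_bdry_CC] H
      by (simp add: linear_c_simps[OF linear_bdry_CC] cextend_zero)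
  next
    case (Suc r)
    then have "cextend (\<lambda>(p, y). cyclic_vert X p (q - 1) y) ?V = 0" "cextend (\<lambda>(p, y). cyclic_horiz X p q y) ?H = 0"
      "cextend (\<lambda>(p, y). cyclic_horiz X p (q - 1) y) ?V + cextend (\<lambda>(p, y). cyclic_vert X p q y) ?H = 0"
      using vert_vert[of x r p] horiz_horiz[OF x] horiz_vert[of x r p] x by simp_all
    then show ?thesis
      unfolding bas linear_c_simps[OF linear_bdry_CC] V H by simp
  qed
qed

end

section \<open>The cyclic nerve of a group and the interval\<close>

definition cyc_list :: "'a list \<Rightarrow> 'a list"
  where "cyc_list gs = last gs # butlast gs"

lemma length_cyc_list [simp]: "length gs = Suc n \<Longrightarrow> length (cyc_list gs) = Suc n"
  by (simp add: cyc_list_def)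

lemma set_cyc_list: "gs \<noteq> [] \<Longrightarrow> set (cyc_list gs) = set gs"
  by (cases gs rule: rev_cases) (auto simp: cyc_list_def)

lemma cyc_list_pow: "(cyc_list ^^ length ys) (xs @ ys) = ys @ xs"
proof (induction ys arbitrary: xs rule: rev_induct)
  case (snoc y ys)
  have "(cyc_list ^^ length (ys @ [y])) (xs @ ys @ [y])
    = (cyc_list ^^ length ys) (cyc_list (xs @ ys @ [y]))"
    by (simp only: length_append_singleton funpow_Suc_right o_apply)
  also have "cyc_list (xs @ ys @ [y]) = y # xs @ ys"
    by (simp add: cyc_list_def butlast_append)
  also have "(cyc_list ^^ length ys) (y # xs @ ys) = ys @ y # xs"
    using snoc[of "y # xs"] by simp
  finally show ?case
    by simp
qed simp

lemma cyc_list_order: "length gs = n \<Longrightarrow> (cyc_list ^^ n) gs = gs"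
  using cyc_list_pow[of gs "[]"] by auto

lemma nth_cyc_list: "length gs = Suc n \<Longrightarrow> k \<le> n \<Longrightarrow>
    cyc_list gs ! k = (if k = 0 then gs ! n else gs ! (k - 1))"
  by (cases gs rule: rev_cases) (auto simp: cyc_list_def nth_Cons nth_append split: nat.splits)

lemma Ncy_simps [simp]:
  "gs \<in> cells (Ncy G) n \<longleftrightarrow> gs \<in> lists (carrier G) \<and> length gs = Suc n"
  "cyc (Ncy G) n = cyc_list"
  by (auto simp: Ncy_def cyc_list_def)

lemma Ncy_interval_simps [simp]:
  "es \<in> cells Ncy_interval n \<longleftrightarrow> length es = Suc n"
  "cyc Ncy_interval n = cyc_list"
  by (auto simp: Ncy_interval_def cyc_list_def)

lemma length_face_Ncy [simp]:
  "length gs = Suc n \<Longrightarrow> 0 < n \<Longrightarrow> i \<le> n \<Longrightarrow> length (face (Ncy G) n i gs) = n"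
  by (auto simp: Ncy_def)

lemma nth_face_Ncy:
  assumes "length gs = Suc n" "i \<le> n" "k < n"
  shows "face (Ncy G) n i gs ! k =
    (if i < n then if k < i then gs ! k else if k = i then gs ! i \<otimes>\<^bsub>G\<^esub> gs ! Suc i else gs ! Suc k
     else if k = 0 then gs ! n \<otimes>\<^bsub>G\<^esub> gs ! 0 else gs ! k)"
proof (cases "i < n")
  case True
  then show ?thesis
    using assms less_linear[of k i] by (auto simp: Ncy_def nth_append dest!: less_imp_Suc_add)
next
  case False
  then show ?thesis
    using assms
    by (cases gs rule: rev_cases) (auto simp: Ncy_def nth_Cons nth_tl nth_append hd_append hd_conv_nth split: nat.splits)
qed

lemma length_face_interval [simp]:
  "length es = Suc n \<Longrightarrow> 0 < n \<Longrightarrow> i \<le> n \<Longrightarrow> length (face Ncy_interval n i es) = n"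
  by (auto simp: Ncy_interval_def)

lemma nth_face_interval:
  assumes "length es = Suc n" "i \<le> n" "k < n"
  shows "face Ncy_interval n i es ! k =
    (if i < n then if k \<le> i then es ! k else es ! Suc k else if k = 0 then es ! n else es ! k)"
proof (cases "i < n")
  case True
  then show ?thesis
    using assms by (auto simp: Ncy_interval_def nth_append)
next
  case False
  then show ?thesis
    using assms by (cases es rule: rev_cases) (auto simp: Ncy_interval_def nth_Cons nth_tl nth_append split: nat.splits)
qed

lemma (in monoid) face_Ncy_closed:
  assumes "gs \<in> lists (carrier G)" "length gs = Suc n" "0 < n" "i \<le> n"
  shows "face (Ncy G) n i gs \<in> lists (carrier G)"
proof -
  have "gs ! k \<in> carrier G" if "k \<le> n" for k
    using assms that by (auto simp: in_lists_conv_set)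
  then have "face (Ncy G) n i gs ! k \<in> carrier G" if "k < n" for k
    using assms that by (auto simp: nth_face_Ncy)
  then show ?thesis
    using assms by (auto simp: in_lists_conv_set in_set_conv_nth)
qed

lemma (in monoid) precyclic_Ncy: "precyclic_set (Ncy G)"
proof
  fix x :: "'a list" and n i j
  assume x: "x \<in> cells (Ncy G) n"
  have car: "x ! k \<in> carrier G" if "k \<le> n" for k
    using x that by (auto simp: in_lists_conv_set)
  have len: "length x = Suc n"
    using x by simp
  show "face (Ncy G) n i x \<in> cells (Ncy G) (n - 1)" if "0 < n" "i \<le> n"
    using that x face_Ncy_closed[of x n i] by auto
  show "cyc (Ncy G) n x \<in> cells (Ncy G) n"
    using x set_cyc_list[of x] by (cases "x = []") (auto simp: in_lists_conv_set)
  show "(cyc (Ncy G) n ^^ Suc n) x = x"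
    using cyc_list_order[OF len] by (simp del: funpow.simps)
  show "face (Ncy G) (n - 1) i (face (Ncy G) n j x) = face (Ncy G) (n - 1) (j - 1) (face (Ncy G) n i x)" (is "?a = ?b")
    if ij: "1 < n" "i < j" "j \<le> n"
  proof (rule nth_equalityI)
    show "length ?a = length ?b"
      using that len by simp
    fix k assume "k < length ?a"
    then have k: "k < n - 1"
      using that len by simp
    define r where "r = n - 2"
    have n: "n = Suc (Suc r)"
      using that(1) by (simp add: r_def)
    obtain j' where j: "j = Suc j'"
      using ij(2) by (cases j) auto
    show "?a ! k = ?b ! k"
      using that len k car unfolding n j
      by (cases "i = j'"; cases "i = Suc r") (auto simp: nth_face_Ncy m_assoc)
  qed
  show "face (Ncy G) n i (cyc (Ncy G) n x) = cyc (Ncy G) (n - 1) (face (Ncy G) n (i - 1) x)" (is "?a = ?b")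
    if il: "0 < i" "i \<le> n"
  proof (rule nth_equalityI)
    obtain i' where i: "i = Suc i'"
      using il(1) by (cases i) auto
    obtain r where n: "n = Suc r"
      using il by (cases n) auto
    have len': "length (cyc_list x) = Suc n" "length (face (Ncy G) n i' x) = Suc r"
      using len that by (auto simp: n i)
    show "length ?a = length ?b"
      using that len' by (simp add: i n)
    fix k assume "k < length ?a"
    then have k: "k < n"
      using that len' by simp
    show "?a ! k = ?b ! k"
      using that len len' k nth_cyc_list[OF len] nth_cyc_list[OF len'(2)] unfolding n i Ncy_simps
      by (cases "k < i'"; cases "k = i'"; cases "k = Suc i'"; cases k; cases "i' = r")
        (simp_all add: nth_face_Ncy)
  qed
  show "face (Ncy G) n 0 (cyc (Ncy G) n x) = face (Ncy G) n n x" (is "?a = ?b") if "0 < n"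
  proof (rule nth_equalityI)
    have len': "length (cyc_list x) = Suc n"
      using len by auto
    show "length ?a = length ?b"
      using that len len' by simp
    fix k assume "k < length ?a"
    then have k: "k < n"
      using that len' by simp
    show "?a ! k = ?b ! k"
      using that len len' k nth_cyc_list[OF len, of 0] nth_cyc_list[OF len, of 1] nth_cyc_list[OF len, of "Suc k"]
      by (simp add: nth_face_Ncy)
  qed
qed

lemma precyclic_interval: "precyclic_set Ncy_interval"
proof
  fix x :: "bool list" and n i j
  assume x: "x \<in> cells Ncy_interval n"
  have len: "length x = Suc n"
    using x by simp
  show "face Ncy_interval n i x \<in> cells Ncy_interval (n - 1)" if "0 < n" "i \<le> n"
    using that x by auto
  show "cyc Ncy_interval n x \<in> cells Ncy_interval n"
    using x by simp
  show "(cyc Ncy_interval n ^^ Suc n) x = x"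
    using cyc_list_order[OF len] by (simp del: funpow.simps)
  show "face Ncy_interval (n - 1) i (face Ncy_interval n j x) = face Ncy_interval (n - 1) (j - 1) (face Ncy_interval n i x)" (is "?a = ?b")
    if ij: "1 < n" "i < j" "j \<le> n"
  proof (rule nth_equalityI)
    show "length ?a = length ?b"
      using that len by simp
    fix k assume "k < length ?a"
    then have k: "k < n - 1"
      using that len by simp
    define r where "r = n - 2"
    have n: "n = Suc (Suc r)"
      using that(1) by (simp add: r_def)
    obtain j' where j: "j = Suc j'"
      using ij(2) by (cases j) auto
    show "?a ! k = ?b ! k"
      using that len k unfolding n j
      by (simp add: nth_face_interval)
  qed
  show "face Ncy_interval n i (cyc Ncy_interval n x) = cyc Ncy_interval (n - 1) (face Ncy_interval n (i - 1) x)" (is "?a = ?b")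
    if il: "0 < i" "i \<le> n"
  proof (rule nth_equalityI)
    obtain i' where i: "i = Suc i'"
      using il(1) by (cases i) auto
    obtain r where n: "n = Suc r"
      using il by (cases n) auto
    have len': "length (cyc_list x) = Suc n" "length (face Ncy_interval n i' x) = Suc r"
      using len that by (auto simp: n i)
    show "length ?a = length ?b"
      using that len' by (simp add: i n)
    fix k assume "k < length ?a"
    then have k: "k < n"
      using that len' by simp
    show "?a ! k = ?b ! k"
      using that len len' k nth_cyc_list[OF len] nth_cyc_list[OF len'(2)] unfolding n i Ncy_interval_simps
      by (cases "k < i'"; cases "k = i'"; cases "k = Suc i'"; cases k; cases "i' = r")
        (simp_all add: nth_face_interval)
  qed
  show "face Ncy_interval n 0 (cyc Ncy_interval n x) = face Ncy_interval n n x" (is "?a = ?b") if "0 < n"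
  proof (rule nth_equalityI)
    have len': "length (cyc_list x) = Suc n"
      using len by auto
    show "length ?a = length ?b"
      using that len len' by simp
    fix k assume "k < length ?a"
    then have k: "k < n"
      using that len' by simp
    show "?a ! k = ?b ! k"
      using that len len' k nth_cyc_list[OF len, of 0] nth_cyc_list[OF len, of "Suc k"]
      by (simp add: nth_face_interval)
  qed
qed

lemma cyclic_prod_simps [simp]:
  "cells (cyclic_prod X Y) n = cells X n \<times> cells Y n"
  "face (cyclic_prod X Y) n i (x, y) = (face X n i x, face Y n i y)"
  "cyc (cyclic_prod X Y) n (x, y) = (cyc X n x, cyc Y n y)"
  by (simp_all add: cyclic_prod_def)

lemma cyc_prod_pow: "(cyc (cyclic_prod X Y) n ^^ k) (x, y) = ((cyc X n ^^ k) x, (cyc Y n ^^ k) y)"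
  by (induction k) auto

lemma precyclic_prod:
  assumes "precyclic_set X" "precyclic_set Y"
  shows "precyclic_set (cyclic_prod X Y)"
proof -
  interpret X: precyclic_set X by fact
  interpret Y: precyclic_set Y by fact
  show ?thesis
    by standard (auto simp: X.face_cells[simplified] Y.face_cells[simplified] X.cyc_cells Y.cyc_cells
        X.face_face[simplified] Y.face_face[simplified] X.face_cyc Y.face_cyc X.face_0_cyc Y.face_0_cyc X.cyc_order Y.cyc_order cyc_prod_pow simp del: funpow.simps)
qed

lemma cyclic_map_fst: "cyclic_map (cyclic_prod X Y) X fst"
  by (auto simp: cyclic_map_def)

section \<open>The projection from the cylinder is a quasi-isomorphism\<close>

text \<open>The degeneracies of the cyclic nerve, and those of the interval with all objects behind the
  first copy of the repeated one replaced by \<open>False\<close>. In terms of the order \<open>1, \<dots>, n, 0\<close> of the objects, which is the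
  one that makes the faces simplicial, these are the usual prism operators.\<close>

definition Ncy_degen :: "('g, 'k) monoid_scheme \<Rightarrow> nat \<Rightarrow> 'g list \<Rightarrow> 'g list"
  where "Ncy_degen G j gs = take (Suc j) gs @ \<one>\<^bsub>G\<^esub> # drop (Suc j) gs"

definition interval_prism :: "nat \<Rightarrow> bool list \<Rightarrow> bool list"
  where "interval_prism j es = False # take (Suc j) (tl es @ [hd es]) @ replicate (length es - Suc j) False"

lemma length_Ncy_degen [simp]: "length (Ncy_degen G j gs) = Suc (length gs)"
  by (simp add: Ncy_degen_def)

lemma nth_Ncy_degen:
  assumes "length gs = Suc n" "j \<le> n" "k \<le> Suc n"
  shows "Ncy_degen G j gs ! k = (if k \<le> j then gs ! k else if k = Suc j then \<one>\<^bsub>G\<^esub> else gs ! (k - 1))"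
  using assms less_linear[of k "Suc j"] by (auto simp: Ncy_degen_def nth_append dest!: less_imp_Suc_add)

lemma length_interval_prism [simp]:
  "length es = Suc n \<Longrightarrow> j \<le> n \<Longrightarrow> length (interval_prism j es) = Suc (Suc n)"
  by (simp add: interval_prism_def)

lemma nth_interval_prism:
  assumes "length es = Suc n" "j \<le> n" "k \<le> Suc n"
  shows "interval_prism j es ! k = (if k = 0 \<or> Suc j < k then False else if k = Suc n then es ! 0 else es ! k)"
  using assms by (cases es) (auto simp: interval_prism_def nth_append nth_Cons less_Suc_eq_le split: nat.splits)

lemma face_Ncy_degen:
  assumes G: "monoid G" and gs: "gs \<in> lists (carrier G)" "length gs = Suc n" and ij: "j \<le> n" "i \<le> Suc n"
  shows "i < j \<Longrightarrow> face (Ncy G) (Suc n) i (Ncy_degen G j gs) = Ncy_degen G (j - 1) (face (Ncy G) n i gs)"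
    and "i = j \<or> i = Suc j \<Longrightarrow> face (Ncy G) (Suc n) i (Ncy_degen G j gs) = gs"
    and "Suc j < i \<Longrightarrow> face (Ncy G) (Suc n) i (Ncy_degen G j gs) = Ncy_degen G j (face (Ncy G) n (i - 1) gs)"
proof -
  interpret monoid G by fact
  have car: "gs ! k \<in> carrier G" if "k \<le> n" for k
    using gs that by (auto simp: in_lists_conv_set)
  note nths = nth_face_Ncy nth_Ncy_degen
  show "face (Ncy G) (Suc n) i (Ncy_degen G j gs) = Ncy_degen G (j - 1) (face (Ncy G) n i gs)" (is "?a = ?b") if "i < j"
  proof (rule nth_equalityI)
    obtain m j' where n: "n = Suc m" and j: "j = Suc j'"
      using \<open>i < j\<close> ij by (cases n; cases j) auto
    show "length ?a = length ?b"
      using that gs ij by simp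
    fix k assume "k < length ?a"
    then have k: "k \<le> n"
      using gs ij by simp
    show "?a ! k = ?b ! k"
      using that gs ij k unfolding n j
      by (cases k) (auto simp: nths)
  qed
  show "face (Ncy G) (Suc n) i (Ncy_degen G j gs) = gs" (is "?a = ?b") if "i = j \<or> i = Suc j"
  proof (rule nth_equalityI)
    show "length ?a = length ?b"
      using gs ij by simp
    fix k assume "k < length ?a"
    then have k: "k \<le> n"
      using gs ij by simp
    show "?a ! k = ?b ! k"
      using that gs ij k car
      by (elim disjE; cases k) (auto simp: nths)
  qed
  show "face (Ncy G) (Suc n) i (Ncy_degen G j gs) = Ncy_degen G j (face (Ncy G) n (i - 1) gs)" (is "?a = ?b") if "Suc j < i"
  proof (rule nth_equalityI)
    obtain m i' where n: "n = Suc m" and i: "i = Suc i'"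
      using \<open>Suc j < i\<close> ij by (cases n; cases i) auto
    show "length ?a = length ?b"
      using that gs ij by (simp add: i)
    fix k assume "k < length ?a"
    then have k: "k \<le> n"
      using gs ij by simp
    show "?a ! k = ?b ! k"
      using that gs ij k unfolding n i
      by (cases k) (auto simp: nths)
  qed
qed

lemma face_interval_prism:
  assumes es: "length es = Suc n" and ij: "j \<le> n" "i \<le> Suc n"
  shows "i < j \<Longrightarrow> face Ncy_interval (Suc n) i (interval_prism j es) = interval_prism (j - 1) (face Ncy_interval n i es)"
    and "0 < j \<Longrightarrow> face Ncy_interval (Suc n) j (interval_prism j es) = face Ncy_interval (Suc n) j (interval_prism (j - 1) es)"
    and "Suc j < i \<Longrightarrow> face Ncy_interval (Suc n) i (interval_prism j es) = interval_prism j (face Ncy_interval n (i - 1) es)"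
    and "face Ncy_interval (Suc n) 0 (interval_prism 0 es) = replicate (Suc n) False"
    and "face Ncy_interval (Suc n) (Suc n) (interval_prism n es) = es"
proof -
  note nths = nth_face_interval nth_interval_prism
  show "face Ncy_interval (Suc n) i (interval_prism j es) = interval_prism (j - 1) (face Ncy_interval n i es)" (is "?a = ?b") if "i < j"
  proof (rule nth_equalityI)
    obtain m j' where n: "n = Suc m" and j: "j = Suc j'"
      using \<open>i < j\<close> ij by (cases n; cases j) auto
    have len: "length (face Ncy_interval (Suc m) i es) = Suc m"
      using es that ij n by simp
    show "length ?a = length ?b"
      using that es ij length_interval_prism[OF len, of j'] by (simp add: n j)
    fix k assume "k < length ?a"
    then have k: "k \<le> n"
      using es ij by simp
    show "?a ! k = ?b ! k"
      using that es ij k nth_interval_prism[OF len, of j' k] unfolding n j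
      by (cases k) (auto simp: nths)
  qed
  show "face Ncy_interval (Suc n) j (interval_prism j es) = face Ncy_interval (Suc n) j (interval_prism (j - 1) es)" (is "?a = ?b") if "0 < j"
  proof (rule nth_equalityI)
    obtain j' where j: "j = Suc j'"
      using \<open>0 < j\<close> by (cases j) auto
    show "length ?a = length ?b"
      using es ij by simp
    fix k assume "k < length ?a"
    then have k: "k \<le> n"
      using es ij by simp
    show "?a ! k = ?b ! k"
      using es ij k unfolding j
      by (cases "k \<le> j'"; cases "k = Suc j'"; cases "k = Suc (Suc j')") (simp_all add: nths)
  qed
  show "face Ncy_interval (Suc n) i (interval_prism j es) = interval_prism j (face Ncy_interval n (i - 1) es)" (is "?a = ?b") if "Suc j < i"
  proof (rule nth_equalityI)
    obtain m i' where n: "n = Suc m" and i: "i = Suc i'"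
      using \<open>Suc j < i\<close> ij by (cases n; cases i) auto
    have len: "length (face Ncy_interval (Suc m) i' es) = Suc m"
      using es that ij n i by simp
    show "length ?a = length ?b"
      using that es ij length_interval_prism[OF len, of j] by (simp add: n i)
    fix k assume "k < length ?a"
    then have k: "k \<le> n"
      using es ij by simp
    show "?a ! k = ?b ! k"
      using that es ij k nth_interval_prism[OF len, of j k] unfolding n i
      by (cases k) (auto simp: nths)
  qed
  show "face Ncy_interval (Suc n) 0 (interval_prism 0 es) = replicate (Suc n) False"
    by (rule nth_equalityI) (use es in \<open>auto simp: nths simp del: replicate_Suc\<close>)
  show "face Ncy_interval (Suc n) (Suc n) (interval_prism n es) = es"
    by (rule nth_equalityI) (use es in \<open>auto simp: nths less_Suc_eq_le\<close>)
qed

text \<open>The prism identities express that the alternating sum of the prism operators is a homotopy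
  between the two operators \<open>D 0 0\<close> and \<open>D (Suc n) n\<close> at the ends.\<close>

lemma prism_sum:
  fixes D E :: "nat \<Rightarrow> nat \<Rightarrow> 'a \<Rightarrow>\<^sub>0 complex"
  assumes lt: "\<And>i j. i < j \<Longrightarrow> j \<le> n \<Longrightarrow> D i j = E i (j - 1)"
    and gt: "\<And>i j. Suc j < i \<Longrightarrow> i \<le> Suc n \<Longrightarrow> D i j = E (i - 1) j"
    and diag: "\<And>j. 0 < j \<Longrightarrow> j \<le> n \<Longrightarrow> D j j = D j (j - 1)"
  shows "(\<Sum>i\<le>Suc n. \<Sum>j\<le>n. cscale ((- 1) ^ (i + j)) (D i j)) + (\<Sum>i\<le>n. \<Sum>j<n. cscale ((- 1) ^ (i + j)) (E i j))
    = D 0 0 - D (Suc n) n"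
proof -
  let ?d = "\<lambda>(i, j). cscale ((- 1) ^ (i + j)) (D i j)" and ?e = "\<lambda>(i, j). cscale ((- 1) ^ (i + j)) (E i j)"
  let ?I = "{..Suc n} \<times> {..n}" and ?J = "{..n} \<times> {..<n}"
  let ?A = "{(i, j)\<in>?I. i < j}" and ?B = "{(i, j)\<in>?I. i = j \<or> i = Suc j}" and ?C = "{(i, j)\<in>?I. Suc j < i}"
  let ?A' = "{(i, j)\<in>?J. i \<le> j}" and ?C' = "{(i, j)\<in>?J. j < i}"
  have fin: "finite ?A" "finite ?B" "finite ?C" "finite ?A'" "finite ?C'"
    by (rule finite_subset[of _ "{..Suc n} \<times> {..n}"]; auto)+
  have "?I = (?A \<union> ?B) \<union> ?C"
    by auto
  then have "sum ?d ?I = sum ?d ((?A \<union> ?B) \<union> ?C)"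
    by (rule arg_cong)
  also have "\<dots> = sum ?d (?A \<union> ?B) + sum ?d ?C"
    by (rule sum.union_disjoint) (use fin in auto)
  also have "sum ?d (?A \<union> ?B) = sum ?d ?A + sum ?d ?B"
    by (rule sum.union_disjoint) (use fin in auto)
  finally have d: "sum ?d ?I = sum ?d ?A + sum ?d ?B + sum ?d ?C" .
  have "?J = ?A' \<union> ?C'"
    by auto
  then have "sum ?e ?J = sum ?e (?A' \<union> ?C')"
    by (rule arg_cong)
  also have "\<dots> = sum ?e ?A' + sum ?e ?C'"
    by (rule sum.union_disjoint) (use fin in auto)
  finally have e: "sum ?e ?J = sum ?e ?A' + sum ?e ?C'" .
  have "sum ?e ?A' = sum (\<lambda>a. - ?d a) ?A"
    by (rule sum.reindex_bij_witness[of _ "\<lambda>(i, j). (i, j - 1)" "\<lambda>(i, j). (i, Suc j)"])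
      (auto simp: lt cvs.scale_minus_left)
  moreover have "sum ?e ?C' = sum (\<lambda>a. - ?d a) ?C"
    by (rule sum.reindex_bij_witness[of _ "\<lambda>(i, j). (i - 1, j)" "\<lambda>(i, j). (Suc i, j)"])
      (auto simp: gt cvs.scale_minus_left)
  moreover have "sum ?d ?B = D 0 0 - D (Suc n) n"
  proof -
    let ?B1 = "(\<lambda>j. (j, j)) ` {..n}" and ?B2 = "(\<lambda>j. (Suc j, j)) ` {..n}"
    have "?B = ?B1 \<union> ?B2"
      by auto
    then have "sum ?d ?B = sum ?d (?B1 \<union> ?B2)"
      by (rule arg_cong)
    also have "\<dots> = sum ?d ?B1 + sum ?d ?B2"
      by (rule sum.union_disjoint) auto
    also have "sum ?d ?B1 = (\<Sum>j\<le>n. D j j)"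
      by (subst sum.reindex) (auto simp: inj_on_def mult_2[symmetric])
    also have "sum ?d ?B2 = - (\<Sum>j\<le>n. D (Suc j) j)"
      by (subst sum.reindex) (auto simp: inj_on_def mult_2[symmetric] cvs.scale_minus_left sum_negf)
    also have "(\<Sum>j\<le>n. D j j) = D 0 0 + (\<Sum>j<n. D (Suc j) (Suc j))"
      by (subst lessThan_Suc_atMost[symmetric]) (rule sum.lessThan_Suc_shift)
    also have "(\<Sum>j<n. D (Suc j) (Suc j)) = (\<Sum>j<n. D (Suc j) j)"
      by (intro sum.cong) (use diag in auto)
    also have "D 0 0 + \<dots> + - (\<Sum>j\<le>n. D (Suc j) j) = D 0 0 - D (Suc n) n"
      by (simp flip: lessThan_Suc_atMost)
    finally show ?thesis .
  qed
  ultimately show ?thesis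
    using d e by (simp add: sum.cartesian_product sum_negf)
qed

locale cylinder = monoid G for G :: "('g, 'k) monoid_scheme" (structure)
begin

abbreviation "X \<equiv> Ncy G"
abbreviation "Y \<equiv> cyclic_prod (Ncy G) Ncy_interval"

sublocale X: precyclic_set X
  by (rule precyclic_Ncy)

sublocale Y: precyclic_set Y
  by (intro precyclic_prod precyclic_Ncy precyclic_interval)

definition prism :: "nat \<Rightarrow> 'g list \<times> bool list \<Rightarrow> 'g list \<times> bool list"
  where "prism j = (\<lambda>(gs, es). (Ncy_degen G j gs, interval_prism j es))"

definition extra :: "'g list \<times> bool list \<Rightarrow> 'g list \<times> bool list"
  where "extra = (\<lambda>(gs, es). (\<one> # gs, hd es # es))"

definition bottom :: "'g list \<times> bool list \<Rightarrow> 'g list \<times> bool list"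
  where "bottom = (\<lambda>(gs, es). (gs, replicate (length es) False))"

lemma prism_cells: "y \<in> cells Y n \<Longrightarrow> j \<le> n \<Longrightarrow> prism j y \<in> cells Y (Suc n)"
  by (cases y) (auto simp: prism_def Ncy_degen_def lists_eq_set dest: in_set_takeD in_set_dropD)

lemma extra_cells: "y \<in> cells Y n \<Longrightarrow> extra y \<in> cells Y (Suc n)"
  by (cases y) (auto simp: extra_def)

lemma face_extra:
  assumes "y \<in> cells Y n"
  shows "face Y (Suc n) 0 (extra y) = y"
    and "i < n \<Longrightarrow> face Y (Suc n) (Suc i) (extra y) = extra (face Y n i y)"
proof -
  obtain gs es where y: "y = (gs, es)"
    by (cases y)
  obtain g gs' e es' where c: "gs = g # gs'" "es = e # es'"
    using assms y by (cases gs; cases es) auto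
  show "face Y (Suc n) 0 (extra y) = y"
    using assms by (simp add: y c extra_def) (simp add: Ncy_def Ncy_interval_def)
  show "face Y (Suc n) (Suc i) (extra y) = extra (face Y n i y)" if "i < n"
    using that by (simp add: y c extra_def) (simp add: Ncy_def Ncy_interval_def)
qed

lemma face_prism:
  assumes "y \<in> cells Y n"
  shows "i < j \<Longrightarrow> j \<le> n \<Longrightarrow> face Y (Suc n) i (prism j y) = prism (j - 1) (face Y n i y)"
    and "Suc j < i \<Longrightarrow> i \<le> Suc n \<Longrightarrow> face Y (Suc n) i (prism j y) = prism j (face Y n (i - 1) y)"
    and "0 < j \<Longrightarrow> j \<le> n \<Longrightarrow> face Y (Suc n) j (prism j y) = face Y (Suc n) j (prism (j - 1) y)"
    and "face Y (Suc n) 0 (prism 0 y) = bottom y"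
    and "face Y (Suc n) (Suc n) (prism n y) = y"
proof -
  obtain gs es where y: "y = (gs, es)"
    by (cases y)
  have gs: "gs \<in> lists (carrier G)" "length gs = Suc n" and es: "length es = Suc n"
    using assms by (auto simp: y)
  note N = face_Ncy_degen[OF monoid_axioms gs] and I = face_interval_prism[OF es]
  show "face Y (Suc n) i (prism j y) = prism (j - 1) (face Y n i y)" if "i < j" "j \<le> n"
    using N(1)[of j i] I(1)[of j i] that by (simp add: y prism_def)
  show "face Y (Suc n) i (prism j y) = prism j (face Y n (i - 1) y)" if "Suc j < i" "i \<le> Suc n"
    using N(3)[of j i] I(3)[of j i] that by (simp add: y prism_def)
  show "face Y (Suc n) j (prism j y) = face Y (Suc n) j (prism (j - 1) y)" if "0 < j" "j \<le> n"
    using N(2)[of j j] N(2)[of "j - 1" j] I(2)[of j j] that by (simp add: y prism_def)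
  show "face Y (Suc n) 0 (prism 0 y) = bottom y"
    using N(2)[of 0 0] I(4)[of 0 0] es by (simp add: y prism_def bottom_def)
  show "face Y (Suc n) (Suc n) (prism n y) = y"
    using N(2)[of n "Suc n"] I(5)[of 0 0] by (simp add: y prism_def)
qed

text \<open>A contraction of the kernel of the projection, column by column: the prism operators in the
  columns with the differential \<open>b\<close>, the extra degeneracy in those with \<open>- b'\<close>, which are acyclic by
  themselves. The cyclic operators are ignored, so this is not a contraction of the total complex.\<close>

definition contraction :: "nat \<Rightarrow> (nat \<times> 'g list \<times> bool list \<Rightarrow>\<^sub>0 complex) \<Rightarrow> (nat \<times> 'g list \<times> bool list \<Rightarrow>\<^sub>0 complex)"
  where "contraction n = cextend (\<lambda>(p, y).
    if even p then - (\<Sum>j\<le>n - p. Poly_Mapping.single (p, prism j y) ((- 1) ^ j))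
    else - bas (p, extra y))"

lemma linear_contraction: "linear_c (contraction n)"
  unfolding contraction_def by (rule linear_cextend)

lemma contraction_bas: "contraction n (bas (p, y)) =
    (if even p then - (\<Sum>j\<le>n - p. Poly_Mapping.single (p, prism j y) ((- 1) ^ j)) else - bas (p, extra y))"
  by (simp add: contraction_def)

text \<open>The prism operators join the identity to the collapse onto the bottom of the cylinder. The collapse
  factors through the projection and so is zero on its kernel.\<close>

lemma vert_contraction_bas:
  assumes y: "y \<in> cells Y (n - p)" and p: "p \<le> n"
  shows "vert Y (Suc n) (contraction n (bas (p, y))) + contraction (n - 1) (vert Y n (bas (p, y)))
    = bas (p, y) - (if even p then bas (p, bottom y) else 0)"
proof -
  define q where "q = n - p"
  have q: "Suc n - p = Suc q" "n - 1 - p = q - 1" "n - p = q"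
    using p by (auto simp: q_def)
  have y: "y \<in> cells Y q"
    using y by (simp add: q_def)
  have vert: "vert Y (Suc n) (Poly_Mapping.single (p, y') a) = cscale a (cyclic_vert Y p (Suc q) y')" for y' a
    unfolding vert_def cextend_single q(1)[symmetric] by simp
  have vert': "vert Y n (bas (p, y)) = cyclic_vert Y p q y"
    unfolding vert_def cextend_single q(3)[symmetric] by simp
  have contr: "contraction (n - 1) (Poly_Mapping.single (p, y') a) = cscale a
      (if even p then - (\<Sum>j\<le>q - 1. Poly_Mapping.single (p, prism j y') ((- 1) ^ j)) else - bas (p, extra y'))" for y' a
    unfolding contraction_def cextend_single q(2)[symmetric] by simp
  show ?thesis
  proof (cases "even p")
    case True
    have 1: "vert Y (Suc n) (contraction n (bas (p, y)))
      = - (\<Sum>j\<le>q. \<Sum>i\<le>Suc q. cscale ((- 1) ^ (i + j)) (bas (p, face Y (Suc q) i (prism j y))))"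
      using True unfolding contraction_bas q(3)
      by (simp add: linear_c_simps[OF linear_vert] vert cyclic_vert_def cvs.scale_sum_right power_add mult.commute
          del: sum.atMost_Suc)
    have 2: "contraction (n - 1) (vert Y n (bas (p, y)))
      = - (\<Sum>i\<le>q. \<Sum>j<q. cscale ((- 1) ^ (i + j)) (bas (p, prism j (face Y q i y))))"
    proof (cases q)
      case 0
      then show ?thesis
        unfolding vert' by (simp add: cyclic_vert_def linear_c_simps[OF linear_contraction])
    next
      case (Suc r)
      then show ?thesis
        using True unfolding vert'
        by (simp add: cyclic_vert_def linear_c_simps[OF linear_contraction] contr[unfolded One_nat_def] cvs.scale_sum_right cvs.scale_minus_right
            power_add mult.commute sum_negf lessThan_Suc_atMost del: sum.atMost_Suc sum.lessThan_Suc)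
    qed
    let ?D = "\<lambda>i j. bas (p, face Y (Suc q) i (prism j y))" and ?E = "\<lambda>i j. bas (p, prism j (face Y q i y))"
    have "(\<Sum>i\<le>Suc q. \<Sum>j\<le>q. cscale ((- 1) ^ (i + j)) (?D i j)) + (\<Sum>i\<le>q. \<Sum>j<q. cscale ((- 1) ^ (i + j)) (?E i j))
      = ?D 0 0 - ?D (Suc q) q"
      by (rule prism_sum) (simp_all only: face_prism[OF y])
    then show ?thesis
      unfolding 1 2 using True face_prism[OF y] by (subst sum.swap) (simp add: algebra_simps del: sum.atMost_Suc)
  next
    case False
    have 1: "vert Y (Suc n) (contraction n (bas (p, y)))
      = (\<Sum>i<Suc q. cscale ((- 1) ^ i) (bas (p, face Y (Suc q) i (extra y))))"
      using False unfolding contraction_bas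
      by (simp add: linear_c_simps[OF linear_vert] vert cyclic_vert_def del: sum.lessThan_Suc)
    have 2: "contraction (n - 1) (vert Y n (bas (p, y)))
      = (\<Sum>i<q. cscale ((- 1) ^ i) (bas (p, extra (face Y q i y))))"
      using False unfolding vert'
      by (simp add: cyclic_vert_def linear_c_simps[OF linear_contraction] contr[unfolded One_nat_def] sum_negf)
    have "(\<Sum>i<q. cscale ((- 1) ^ Suc i) (bas (p, face Y (Suc q) (Suc i) (extra y))))
      = (\<Sum>i<q. - cscale ((- 1) ^ i) (bas (p, extra (face Y q i y))))"
      by (intro sum.cong) (auto simp: face_extra[OF y] single_uminus)
    then show ?thesis
      unfolding 1 2 sum.lessThan_Suc_shift using False face_extra(1)[OF y] by (simp add: sum_negf)
  qed
qed

lemma vert_contraction: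
  assumes c: "c \<in> supported (CC_basis Y n)" and fst: "CC_map fst c = 0"
  shows "vert Y (Suc n) (contraction n c) + contraction (n - 1) (vert Y n c) = c"
proof -
  define \<Phi> where "\<Phi> = cextend (\<lambda>(p :: nat, gs :: 'g list).
    if even p then bas (p, gs, replicate (length gs) False) else 0)"
  have \<Phi>: "linear_c \<Phi>"
    unfolding \<Phi>_def by (rule linear_cextend)
  have "vert Y (Suc n) (contraction n c) + contraction (n - 1) (vert Y n c) = c - \<Phi> (CC_map fst c)"
  proof (rule linear_c_eq_on[where f = "\<lambda>c. vert Y (Suc n) (contraction n c) + contraction (n - 1) (vert Y n c)"
        and g = "\<lambda>c. c - \<Phi> (CC_map fst c)", OF _ _ c])
    show "linear_c (\<lambda>c. vert Y (Suc n) (contraction n c) + contraction (n - 1) (vert Y n c))"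
      by (rule linear_c_add[OF linear_c_compose[OF linear_vert linear_contraction]
            linear_c_compose[OF linear_contraction linear_vert]])
    show "linear_c (\<lambda>c. c - \<Phi> (CC_map fst c))"
      by (rule linear_c_sub[OF linear_c_id linear_c_compose[OF \<Phi> linear_CC_map]])
    fix z assume "z \<in> CC_basis Y n"
    then obtain p y where z: "z = (p, y)" "p \<le> n" "y \<in> cells Y (n - p)"
      by (cases z) auto
    then have "\<Phi> (CC_map fst (bas z)) = (if even p then bas (p, bottom y) else 0)"
      by (cases y) (auto simp: \<Phi>_def bottom_def)
    then show "vert Y (Suc n) (contraction n (bas z)) + contraction (n - 1) (vert Y n (bas z)) = bas z - \<Phi> (CC_map fst (bas z))"
      using vert_contraction_bas[OF z(3,2)] z(1) by simp
  qed
  then show ?thesis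
    by (simp add: fst linear_c_simps[OF \<Phi>])
qed

text \<open>The contraction lies over the analogous operator on the cyclic nerve itself, which uses degeneracies in
  place of prisms.\<close>

lemma contraction_fst:
  assumes "CC_map fst c = 0"
  shows "CC_map fst (contraction n c) = 0"
proof -
  define P where "P = cextend (\<lambda>(p, gs). if even p then - (\<Sum>j\<le>n - p. Poly_Mapping.single (p, Ncy_degen G j gs) ((- 1) ^ j))
    else - bas (p, \<one> # gs))"
  have P: "linear_c P"
    unfolding P_def by (rule linear_cextend)
  have "CC_map fst (contraction n c) = P (CC_map fst c)"
  proof (rule linear_c_eqI[OF linear_c_compose[OF linear_CC_map linear_contraction] linear_c_compose[OF P linear_CC_map]])
    show "Poly_Mapping.keys c \<subseteq> UNIV"
      by simp
    fix z :: "nat \<times> 'g list \<times> bool list"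
    obtain p gs es where "z = (p, gs, es)"
      by (cases z)
    then show "CC_map fst (contraction n (bas z)) = P (CC_map fst (bas z))"
      by (simp add: contraction_bas P_def linear_c_simps[OF linear_CC_map] prism_def extra_def)
  qed
  then show ?thesis
    by (simp add: assms linear_c_simps[OF P])
qed

lemma contraction_supported:
  assumes "c \<in> supported (CC_basis Y n)"
  shows "contraction n c \<in> supported (CC_basis Y (Suc n))"
proof (rule linear_c_supported[OF linear_contraction _ assms])
  fix z assume "z \<in> CC_basis Y n"
  then obtain p y where z: "z = (p, y)" "p \<le> n" "y \<in> cells Y (n - p)"
    by (cases z) auto
  then have "(p, prism j y) \<in> CC_basis Y (Suc n)" if "j \<le> n - p" for j
    using prism_cells[OF z(3) that] by (simp add: Suc_diff_le del: cyclic_prod_simps)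
  moreover have "(p, extra y) \<in> CC_basis Y (Suc n)"
    using extra_cells[OF z(3)] z(2) by (simp add: Suc_diff_le del: cyclic_prod_simps)
  ultimately show "contraction n (bas z) \<in> supported (CC_basis Y (Suc n))"
    unfolding z(1) contraction_bas by (auto intro!: supported_neg supported_sum supported_single)
qed

lemma contraction_cols:
  assumes "c \<in> supported ({..<k} \<times> UNIV)"
  shows "contraction n c \<in> supported ({..<k} \<times> UNIV)"
  by (rule linear_c_supported[OF linear_contraction _ assms])
    (auto simp: contraction_bas intro!: supported_neg supported_sum supported_single)

lemma horiz_cols:
  assumes "c \<in> supported ({..<Suc k} \<times> UNIV)"
  shows "horiz Y n c \<in> supported ({..<k} \<times> UNIV)"
proof (rule linear_c_supported[OF linear_horiz _ assms])
  fix z :: "nat \<times> 'g list \<times> bool list" assume "z \<in> {..<Suc k} \<times> UNIV"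
  then obtain p y where z: "z = (p, y)" "p \<le> k"
    by (cases z) auto
  show "horiz Y n (bas z) \<in> supported ({..<k} \<times> UNIV)"
  proof (cases "p = 0")
    case True
    then show ?thesis
      by (simp add: z horiz_def cyclic_horiz_def)
  next
    case False
    then have "{p - 1} \<times> UNIV \<subseteq> {..<k} \<times> (UNIV :: ('g list \<times> bool list) set)"
      using z by auto
    then show ?thesis
      using supported_mono[OF horiz_supported_col[of Y p "n - p" y]] z by (simp add: horiz_def)
  qed
qed

text \<open>Subtracting from a cycle in the columns up to \<open>k\<close> the boundary of its contraction leaves only terms
  that contain the horizontal differential, hence lie in the columns below \<open>k\<close>. As there are finitely many
  columns, this terminates.\<close>

lemma kernel_acyclic:
  assumes "z \<in> supported (CC_basis Y n)" "z \<in> supported ({..<k} \<times> UNIV)"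
    and "CC_map fst z = 0" "bdry (CC Y) n z = 0"
  obtains w where "w \<in> supported (CC_basis Y (Suc n))" "CC_map fst w = 0" "bdry (CC Y) (Suc n) w = z"
proof -
  have "\<exists>w. w \<in> supported (CC_basis Y (Suc n)) \<and> CC_map fst w = 0 \<and> bdry (CC Y) (Suc n) w = z"
    using assms
  proof (induction k arbitrary: z)
    case 0
    then have "z = 0"
      by (simp add: supported_def)
    then show ?case
      by (intro exI[of _ 0]) (simp add: linear_c_simps[OF linear_CC_map] linear_c_simps[OF linear_bdry_CC])
  next
    case (Suc k)
    define w where "w = contraction n z"
    have w: "w \<in> supported (CC_basis Y (Suc n))" "CC_map fst w = 0"
      using Suc.prems contraction_supported contraction_fst by (simp_all add: w_def)
    define z' where "z' = z - bdry (CC Y) (Suc n) w"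
    have "vert Y n z = - horiz Y n z"
      using Suc.prems(4) by (simp add: bdry_eq eq_neg_iff_add_eq_0)
    moreover have "vert Y (Suc n) w + contraction (n - 1) (vert Y n z) = z"
      unfolding w_def by (rule vert_contraction[OF Suc.prems(1,3)])
    ultimately have "z' = - contraction (n - 1) (horiz Y n z) - horiz Y (Suc n) w"
      unfolding z'_def bdry_eq by (simp add: linear_c_simps[OF linear_contraction] algebra_simps)
    moreover have "contraction (n - 1) (horiz Y n z) \<in> supported ({..<k} \<times> UNIV)"
      by (rule contraction_cols[OF horiz_cols[OF Suc.prems(2)]])
    moreover have "horiz Y (Suc n) w \<in> supported ({..<k} \<times> UNIV)"
      unfolding w_def by (rule horiz_cols[OF contraction_cols[OF Suc.prems(2)]])
    ultimately have "z' \<in> supported ({..<k} \<times> UNIV)"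
      by (simp only: supported_diff supported_neg)
    moreover have "z' \<in> supported (CC_basis Y n)"
      using Suc.prems(1) Y.bdry_supported[OF w(1)] by (simp add: z'_def supported_diff)
    moreover have "CC_map fst z' = 0"
      using Suc.prems(3) Y.CC_map_bdry[OF cyclic_map_fst w(1)] w(2)
      by (simp add: z'_def linear_c_simps[OF linear_CC_map] linear_c_simps[OF linear_bdry_CC])
    moreover have "bdry (CC Y) n z' = 0"
      using Suc.prems(4) Y.bdry_bdry[OF w(1)] by (simp add: z'_def linear_c_simps[OF linear_bdry_CC])
    ultimately obtain v where v: "v \<in> supported (CC_basis Y (Suc n))" "CC_map fst v = 0" "bdry (CC Y) (Suc n) v = z'"
      using Suc.IH by blast
    show ?case
      using v w by (intro exI[of _ "v + w"])
        (simp add: supported_add linear_c_simps[OF linear_CC_map] linear_c_simps[OF linear_bdry_CC] z'_def)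
  qed
  then show ?thesis
    using that by blast
qed

end

section \<open>The canonical homotopy of a conjugation\<close>

context cylinder
begin

definition ends :: "(nat \<times> 'g list \<Rightarrow>\<^sub>0 complex) \<Rightarrow> (nat \<times> 'g list \<times> bool list \<Rightarrow>\<^sub>0 complex)"
  where "ends c = CC_map (\<lambda>gs. (gs, replicate (length gs) True)) c - CC_map (\<lambda>gs. (gs, replicate (length gs) False)) c"

lemma linear_ends: "linear_c ends"
  unfolding ends_def by (rule linear_c_sub[OF linear_CC_map linear_CC_map])

lemma face_interval_replicate: "0 < n \<Longrightarrow> i \<le> n \<Longrightarrow> face Ncy_interval n i (replicate (Suc n) e) = replicate n e"
  by (rule nth_equalityI) (auto simp: nth_face_interval simp del: replicate_Suc)

lemma cyclic_map_end: "cyclic_map X Y (\<lambda>gs. (gs, replicate (length gs) e))"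
proof -
  have "cyc_list (replicate (Suc n) e) = replicate (Suc n) e" for n
    by (rule nth_equalityI) (auto simp: nth_cyc_list simp del: replicate_Suc)
  then show ?thesis
    using X.face_cells by (auto simp: cyclic_map_def face_interval_replicate simp del: replicate_Suc)
qed

lemma ends_supported: "c \<in> supported (CC_basis X n) \<Longrightarrow> ends c \<in> supported (CC_basis Y n)"
  unfolding ends_def using cyclic_map_cells[OF cyclic_map_end]
  by (intro supported_diff CC_map_supported[where X = X]) auto

lemma ends_bdry: "c \<in> supported (CC_basis X n) \<Longrightarrow> bdry (CC Y) n (ends c) = ends (bdry (CC X) n c)"
  unfolding ends_def by (simp add: linear_c_simps[OF linear_bdry_CC] X.CC_map_bdry[OF cyclic_map_end])

lemma ends_fst: "CC_map fst (ends c) = 0"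
  by (simp add: ends_def linear_c_simps[OF linear_CC_map] CC_map_comp)

text \<open>One step of the construction of a homotopy between the two ends with values in the acyclic
  kernel of the projection, given its part \<open>f\<close> in one degree less.\<close>

lemma homotopy_step:
  assumes f: "linear_c f"
    and fc: "\<And>c. c \<in> supported (CC_basis X n) \<Longrightarrow> f (bdry (CC X) n c) \<in> supported (CC_basis Y n)"
      "\<And>c. c \<in> supported (CC_basis X n) \<Longrightarrow> CC_map fst (f (bdry (CC X) n c)) = 0"
      "\<And>c. c \<in> supported (CC_basis X n) \<Longrightarrow> bdry (CC Y) n (f (bdry (CC X) n c)) = ends (bdry (CC X) n c)"
  obtains f' where "linear_c f'"
    "\<And>c. c \<in> supported (CC_basis X n) \<Longrightarrow> f' c \<in> supported (CC_basis Y (Suc n))"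
    "\<And>c. c \<in> supported (CC_basis X n) \<Longrightarrow> CC_map fst (f' c) = 0"
    "\<And>c. c \<in> supported (CC_basis X n) \<Longrightarrow> bdry (CC Y) (Suc n) (f' c) + f (bdry (CC X) n c) = ends c"
proof -
  have "\<exists>w. w \<in> supported (CC_basis Y (Suc n)) \<and> CC_map fst w = 0 \<and> bdry (CC Y) (Suc n) w + f (bdry (CC X) n (bas x)) = ends (bas x)"
    if "x \<in> CC_basis X n" for x
  proof -
    have x: "bas x \<in> supported (CC_basis X n)"
      using that by simp
    define z where "z = ends (bas x) - f (bdry (CC X) n (bas x))"
    have "z \<in> supported (CC_basis Y n)"
      unfolding z_def by (rule supported_diff[OF ends_supported[OF x] fc(1)[OF x]])
    moreover from this have "z \<in> supported ({..<Suc n} \<times> UNIV)"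
      by (rule supported_mono) (auto simp: CC_basis_def)
    moreover have "CC_map fst z = 0"
      by (simp add: z_def linear_c_simps[OF linear_CC_map] ends_fst fc(2)[OF x])
    moreover have "bdry (CC Y) n z = 0"
      by (simp add: z_def linear_c_simps[OF linear_bdry_CC] ends_bdry[OF x] fc(3)[OF x])
    ultimately obtain w where "w \<in> supported (CC_basis Y (Suc n))" "CC_map fst w = 0" "bdry (CC Y) (Suc n) w = z"
      by (rule kernel_acyclic)
    then show ?thesis
      by (intro exI[of _ w]) (simp add: z_def)
  qed
  then obtain w where w: "\<And>x. x \<in> CC_basis X n \<Longrightarrow> w x \<in> supported (CC_basis Y (Suc n))"
    "\<And>x. x \<in> CC_basis X n \<Longrightarrow> CC_map fst (w x) = 0"
    "\<And>x. x \<in> CC_basis X n \<Longrightarrow> bdry (CC Y) (Suc n) (w x) + f (bdry (CC X) n (bas x)) = ends (bas x)"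
    by metis
  show ?thesis
  proof (rule that[of "cextend w"])
    show "linear_c (cextend w)"
      by (rule linear_cextend)
    fix c assume c: "c \<in> supported (CC_basis X n)"
    show "cextend w c \<in> supported (CC_basis Y (Suc n))"
      by (rule linear_c_supported[OF linear_cextend _ c]) (simp add: w(1))
    show "CC_map fst (cextend w c) = 0"
      by (rule linear_c_eq_on[OF linear_c_compose[OF linear_CC_map linear_cextend] linear_c_zero c]) (simp add: w(2))
    show "bdry (CC Y) (Suc n) (cextend w c) + f (bdry (CC X) n c) = ends c"
      by (rule linear_c_eq_on[OF linear_c_add[OF linear_c_compose[OF linear_bdry_CC linear_cextend]
              linear_c_compose[OF f linear_bdry_CC]] linear_ends c]) (simp add: w(3))
  qed
qed

text \<open>In degree zero there is no earlier part, and \<open>f = 0\<close> starts the recursion. The recursion carries along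
  only that boundaries of cycles are prescribed, which is what the next step needs.\<close>

lemma homotopy_exists:
  obtains L where "\<And>n. linear_c (L n)"
    "\<And>n c. c \<in> supported (CC_basis X n) \<Longrightarrow> L n c \<in> supported (CC_basis Y (Suc n))"
    "\<And>n c. c \<in> supported (CC_basis X n) \<Longrightarrow> CC_map fst (L n c) = 0"
    "\<And>n c. c \<in> supported (CC_basis X n) \<Longrightarrow> bdry (CC Y) (Suc n) (L n c) + L (n - 1) (bdry (CC X) n c) = ends c"
proof -
  let ?P = "\<lambda>n f. linear_c f \<and> (\<forall>c\<in>supported (CC_basis X n). f c \<in> supported (CC_basis Y (Suc n)) \<and> CC_map fst (f c) = 0 \<and>
    (bdry (CC X) n c = 0 \<longrightarrow> bdry (CC Y) (Suc n) (f c) = ends c))"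
  let ?Q = "\<lambda>n f f'. \<forall>c\<in>supported (CC_basis X (Suc n)). bdry (CC Y) (Suc (Suc n)) (f' c) + f (bdry (CC X) (Suc n) c) = ends c"
  have "\<exists>f. ?P 0 f"
  proof -
    obtain f' where "linear_c f'"
      "\<And>c. c \<in> supported (CC_basis X 0) \<Longrightarrow> f' c \<in> supported (CC_basis Y (Suc 0))"
      "\<And>c. c \<in> supported (CC_basis X 0) \<Longrightarrow> CC_map fst (f' c) = 0"
      "\<And>c. c \<in> supported (CC_basis X 0) \<Longrightarrow> bdry (CC Y) (Suc 0) (f' c) + (\<lambda>_. 0) (bdry (CC X) 0 c) = ends c"
      by (rule homotopy_step[OF linear_c_zero, of 0])
        (simp_all add: X.bdry_zero linear_c_simps[OF linear_CC_map] linear_c_simps[OF linear_bdry_CC] linear_c_simps[OF linear_ends])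
    then show ?thesis
      by (intro exI[of _ f']) simp
  qed
  moreover have "\<exists>f'. ?P (Suc n) f' \<and> ?Q n f f'" if P: "?P n f" for n f
  proof -
    have f: "linear_c f"
      using P by blast
    have fP: "f d \<in> supported (CC_basis Y (Suc n))" "CC_map fst (f d) = 0"
      "bdry (CC X) n d = 0 \<Longrightarrow> bdry (CC Y) (Suc n) (f d) = ends d" if "d \<in> supported (CC_basis X n)" for d
      using P that by blast+
    have c: "bdry (CC X) (Suc n) c \<in> supported (CC_basis X n)" "bdry (CC X) n (bdry (CC X) (Suc n) c) = 0"
      if "c \<in> supported (CC_basis X (Suc n))" for c
      using X.bdry_supported[OF that] X.bdry_bdry[OF that] by simp_all
    obtain f' where f': "linear_c f'"
      "\<And>c. c \<in> supported (CC_basis X (Suc n)) \<Longrightarrow> f' c \<in> supported (CC_basis Y (Suc (Suc n)))"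
      "\<And>c. c \<in> supported (CC_basis X (Suc n)) \<Longrightarrow> CC_map fst (f' c) = 0"
      "\<And>c. c \<in> supported (CC_basis X (Suc n)) \<Longrightarrow> bdry (CC Y) (Suc (Suc n)) (f' c) + f (bdry (CC X) (Suc n) c) = ends c"
      by (rule homotopy_step[OF f, of "Suc n"]) (simp_all add: fP c)
    have "bdry (CC Y) (Suc (Suc n)) (f' c) = ends c" if "c \<in> supported (CC_basis X (Suc n))" "bdry (CC X) (Suc n) c = 0" for c
      using f'(4)[OF that(1)] that(2) by (simp add: linear_c_simps[OF f])
    then show ?thesis
      using f' by blast
  qed
  ultimately have "\<exists>L. \<forall>n. ?P n (L n) \<and> ?Q n (L n) (L (Suc n))"
    by (rule dependent_nat_choice)
  then obtain L where L: "\<And>n. ?P n (L n)" "\<And>n. ?Q n (L n) (L (Suc n))"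
    by blast
  have lin: "linear_c (L n)" for n
    using L(1) by blast
  show ?thesis
  proof (rule that[of L])
    fix n c assume c: "c \<in> supported (CC_basis X n)"
    show "bdry (CC Y) (Suc n) (L n c) + L (n - 1) (bdry (CC X) n c) = ends c"
    proof (cases n)
      case 0
      then have "bdry (CC X) 0 c = 0"
        using c X.bdry_zero by simp
      then show ?thesis
        using L(1)[of 0] c 0 by (simp add: linear_c_simps[OF lin])
    next
      case (Suc r)
      then show ?thesis
        using L(2)[of r] c by simp
    qed
  qed (use L(1) in blast)+
qed

end

text \<open>The homotopy lies in the kernel of the projection, so its projection is zero and the zero map is the
  required null-homotopy.\<close>

lemma canonical_conj_homotopy_exists:
  assumes "monoid G"
  shows "\<exists>K. canonical_conj_homotopy G h K"
proof -
  interpret cylinder G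
    using assms by (simp add: cylinder_def)
  obtain L where L: "\<And>n. linear_c (L n)"
    "\<And>n c. c \<in> supported (CC_basis X n) \<Longrightarrow> L n c \<in> supported (CC_basis Y (Suc n))"
    "\<And>n c. c \<in> supported (CC_basis X n) \<Longrightarrow> CC_map fst (L n c) = 0"
    "\<And>n c. c \<in> supported (CC_basis X n) \<Longrightarrow> bdry (CC Y) (Suc n) (L n c) + L (n - 1) (bdry (CC X) n c) = ends c"
    by (rule homotopy_exists) blast
  have "chain_homotopy (CC X) (CC Y) (\<lambda>_. CC_map (\<lambda>gs. (gs, replicate (length gs) True)))
      (\<lambda>_. CC_map (\<lambda>gs. (gs, replicate (length gs) False))) L"
    using L by (auto simp: chain_homotopy_def graded_map_def chains_CC ends_def)
  moreover have "chain_homotopy (suspension (CC X)) (CC X) (from_suspension (\<lambda>n. CC_map fst \<circ> L n)) (\<lambda>_ _. 0) (\<lambda>_ _. 0)"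
    using L(3) by (auto simp: chain_homotopy_def graded_map_def chains_CC linear_c_zero suspension_def from_suspension_def
        linear_c_simps[OF linear_bdry_CC] linear_c_simps[OF L(1)] linear_c_simps[OF linear_CC_map])
  ultimately show ?thesis
    unfolding canonical_conj_homotopy_def null_homotopic_def by blast
qed

context group
begin

lemma length_conj_transport [simp]: "length (conj_transport G h (gs, es)) = length gs"
  by (simp add: conj_transport_def Let_def)

lemma nth_conj_transport:
  assumes "length gs = Suc n" "k \<le> n"
  shows "conj_transport G h (gs, es) ! k =
    (if es ! k then h else \<one>) \<otimes> gs ! k \<otimes> inv (if es ! (if k = n then 0 else Suc k) then h else \<one>)"
proof -
  have "Suc k mod Suc n = (if k = n then 0 else Suc k)"
    using assms by auto
  then show ?thesis
    using assms by (simp add: conj_transport_def Let_def del: upt_Suc)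
qed

lemma conj_transport_closed:
  assumes "h \<in> carrier G" "gs \<in> lists (carrier G)"
  shows "conj_transport G h (gs, es) \<in> lists (carrier G)"
  using assms by (auto simp: conj_transport_def Let_def)

text \<open>The conjugating elements at adjacent ends of two consecutive entries are mutually inverse and cancel when
  the entries are multiplied.\<close>

lemma face_conj_transport:
  assumes h: "h \<in> carrier G" and gs: "gs \<in> lists (carrier G)" "length gs = Suc n" and es: "length es = Suc n"
    and n: "0 < n" "i \<le> n"
  shows "conj_transport G h (face (Ncy G) n i gs, face Ncy_interval n i es) = face (Ncy G) n i (conj_transport G h (gs, es))" (is "?a = ?b")
proof (rule nth_equalityI)
  obtain m where m: "n = Suc m"
    using n by (cases n) auto
  have len: "length (face (Ncy G) n i gs) = Suc m" "length (conj_transport G h (gs, es)) = Suc n"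
    using gs n by (simp_all add: m)
  show "length ?a = length ?b"
    using gs n by simp
  have car: "gs ! k \<in> carrier G" if "k \<le> n" for k
    using gs that by (auto simp: in_lists_conv_set)
  define u where "u e = (if e then h else \<one>)" for e
  have u: "u e \<in> carrier G" for e
    using h by (simp add: u_def)
  have cancel: "(u a \<otimes> x \<otimes> inv u b) \<otimes> (u b \<otimes> y \<otimes> inv u c) = u a \<otimes> (x \<otimes> y) \<otimes> inv u c"
    if "x \<in> carrier G" "y \<in> carrier G" for a b c x y
  proof -
    have "inv u b \<otimes> (u b \<otimes> (y \<otimes> inv u c)) = y \<otimes> inv u c"
      using that u by (simp add: m_assoc[symmetric])
    then show ?thesis
      using that u by (simp add: m_assoc)
  qed
  fix k assume "k < length ?a"
  then have k: "k \<le> m"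
    using len by simp
  have ct: "conj_transport G h (gs, es) ! k = u (es ! k) \<otimes> gs ! k \<otimes> inv u (es ! (if k = n then 0 else Suc k))" if "k \<le> n" for k
    using nth_conj_transport[OF gs(2) that] by (simp add: u_def)
  have "?a ! k
    = u (face Ncy_interval n i es ! k) \<otimes> face (Ncy G) n i gs ! k \<otimes> inv u (face Ncy_interval n i es ! (if k = m then 0 else Suc k))"
    using nth_conj_transport[OF len(1) k] by (simp add: u_def)
  also have "\<dots> = ?b ! k"
  proof (cases "i < n")
    case True
    consider "k < i" | "k = i" | "i < k"
      by linarith
    then show ?thesis
      by cases (use True k gs es len car ct cancel in \<open>simp_all add: nth_face_Ncy nth_face_interval m\<close>)
  next
    case False
    then have i: "i = n"
      using n by simp
    then show ?thesis
      using k gs es len car ct cancel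
      by (cases "k = 0") (simp_all add: nth_face_Ncy nth_face_interval m)
  qed
  finally show "?a ! k = ?b ! k" .
qed

lemma cyc_conj_transport:
  assumes gs: "length gs = Suc n" and es: "length es = Suc n"
  shows "conj_transport G h (cyc_list gs, cyc_list es) = cyc_list (conj_transport G h (gs, es))" (is "?a = ?b")
proof (rule nth_equalityI)
  have len: "length (cyc_list gs) = Suc n" "length (conj_transport G h (gs, es)) = Suc n"
    using gs by simp_all
  show "length ?a = length ?b"
    using length_cyc_list[OF len(2)] len(1) by simp
  fix k assume "k < length ?a"
  then have k: "k \<le> n"
    using len by simp
  show "?a ! k = ?b ! k"
    using k nth_conj_transport[OF len(1) k, of h "cyc_list es"] nth_conj_transport[OF gs, of _ h es]
    by (cases k) (auto simp: nth_cyc_list[OF gs] nth_cyc_list[OF es] nth_cyc_list[OF len(2)])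
qed

lemma cyclic_map_conj_transport:
  assumes "h \<in> carrier G"
  shows "cyclic_map (cyclic_prod (Ncy G) Ncy_interval) (Ncy G) (conj_transport G h)"
  using assms conj_transport_closed[OF assms]
  by (auto simp: cyclic_map_def cyc_conj_transport face_conj_transport)

lemma conj_transport_True:
  assumes "h \<in> carrier G" "gs \<in> lists (carrier G)"
  shows "conj_transport G h (gs, replicate (length gs) True) = map (\<lambda>g. h \<otimes> g \<otimes> inv h) gs"
proof (cases gs)
  case (Cons g gs')
  then have len: "length gs = Suc (length gs')"
    by simp
  show ?thesis
    by (rule nth_equalityI) (auto simp: nth_conj_transport[OF len] len less_Suc_eq_le simp del: replicate_Suc)
qed (simp add: conj_transport_def)

lemma conj_transport_False:
  assumes "gs \<in> lists (carrier G)"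
  shows "conj_transport G h (gs, replicate (length gs) False) = gs"
proof (cases gs)
  case (Cons g gs')
  have "gs ! k \<in> carrier G" if "k < length gs" for k
    using assms that by (auto simp: in_lists_conv_set)
  then show ?thesis
    using Cons by (intro nth_equalityI)
      (auto simp: nth_conj_transport[where n = "length gs'"] simp del: replicate_Suc)
qed (simp add: conj_transport_def)

lemma canonical_conj_homotopy:
  assumes h: "h \<in> carrier G" and K: "canonical_conj_homotopy G h K"
  shows "graded_map 1 (CC (Ncy G)) (CC (Ncy G)) K"
    and "c \<in> supported (CC_basis (Ncy G) n) \<Longrightarrow>
      bdry (CC (Ncy G)) (Suc n) (K n c) + K (n - 1) (bdry (CC (Ncy G)) n c)
      = CC_map (map (\<lambda>g. h \<otimes> g \<otimes> inv h)) c - c"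
proof -
  interpret cylinder G
    by unfold_locales
  obtain L where L: "chain_homotopy (CC X) (CC Y) (\<lambda>_. CC_map (\<lambda>gs. (gs, replicate (length gs) True)))
      (\<lambda>_. CC_map (\<lambda>gs. (gs, replicate (length gs) False))) L"
    and K: "K = (\<lambda>n. CC_map (conj_transport G h) \<circ> L n)"
    using K unfolding canonical_conj_homotopy_def by blast
  have lin: "linear_c (L n)" and Ls: "\<And>c. c \<in> supported (CC_basis X n) \<Longrightarrow> L n c \<in> supported (CC_basis Y (Suc n))" for n
    using L by (auto simp: chain_homotopy_def graded_map_def chains_CC)
  have "K n c \<in> supported (CC_basis X (Suc n))" if "c \<in> supported (CC_basis X n)" for n c
    unfolding K o_def
    by (rule CC_map_supported[where X = Y, OF _ Ls[OF that]]) (rule cyclic_map_cells[OF cyclic_map_conj_transport[OF h]])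
  then show "graded_map 1 (CC X) (CC X) K"
    using linear_c_compose[OF linear_CC_map lin] by (auto simp: graded_map_def chains_CC K o_def)
  assume c: "c \<in> supported (CC_basis X n)"
  have "bdry (CC X) (Suc n) (K n c) + K (n - 1) (bdry (CC X) n c)
    = CC_map (conj_transport G h) (bdry (CC Y) (Suc n) (L n c) + L (n - 1) (bdry (CC X) n c))"
    by (simp add: K Y.CC_map_bdry[OF cyclic_map_conj_transport[OF h] Ls[OF c]] linear_c_simps[OF linear_CC_map])
  also have "bdry (CC Y) (Suc n) (L n c) + L (n - 1) (bdry (CC X) n c) = ends c"
    using L c by (auto simp: chain_homotopy_def chains_CC ends_def)
  also have "CC_map (conj_transport G h) (ends c) = CC_map (map (\<lambda>g. h \<otimes> g \<otimes> inv h)) c - c"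
    unfolding ends_def linear_c_simps[OF linear_CC_map] CC_map_comp
  proof (rule arg_cong2[where f = "(-)"])
    have basis: "\<exists>p gs. z = (p, gs) \<and> gs \<in> lists (carrier G)" if "z \<in> CC_basis X n" for z
      using that by (cases z) auto
    show "CC_map (\<lambda>gs. conj_transport G h (gs, replicate (length gs) True)) c = CC_map (map (\<lambda>g. h \<otimes> g \<otimes> inv h)) c"
    proof (rule linear_c_eq_on[OF linear_CC_map linear_CC_map c])
      fix z assume "z \<in> CC_basis X n"
      from basis[OF this] obtain p gs where z: "z = (p, gs)" "gs \<in> lists (carrier G)"
        by blast
      show "CC_map (\<lambda>gs. conj_transport G h (gs, replicate (length gs) True)) (bas z) = CC_map (map (\<lambda>g. h \<otimes> g \<otimes> inv h)) (bas z)"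
        unfolding z(1) CC_map_single conj_transport_True[OF h z(2)] ..
    qed
    show "CC_map (\<lambda>gs. conj_transport G h (gs, replicate (length gs) False)) c = c"
    proof (rule linear_c_eq_on[OF linear_CC_map linear_c_id c])
      fix z assume "z \<in> CC_basis X n"
      from basis[OF this] obtain p gs where z: "z = (p, gs)" "gs \<in> lists (carrier G)"
        by blast
      show "CC_map (\<lambda>gs. conj_transport G h (gs, replicate (length gs) False)) (bas z) = bas z"
        unfolding z(1) CC_map_single conj_transport_False[OF z(2)] ..
    qed
  qed
  finally show "bdry (CC X) (Suc n) (K n c) + K (n - 1) (bdry (CC X) n c) = CC_map (map (\<lambda>g. h \<otimes> g \<otimes> inv h)) c - c" .
qed

end

section \<open>Twisted nerves\<close>

context group
begin

lemma mprod_closed: "gs \<in> lists (carrier G) \<Longrightarrow> mprod G gs \<in> carrier G"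
  by (induction gs) (auto simp: mprod_def)

lemma mprod_Nil [simp]: "mprod G [] = \<one>" and mprod_Cons [simp]: "mprod G (g # gs) = g \<otimes> mprod G gs"
  by (simp_all add: mprod_def)

lemma mprod_append:
  "gs \<in> lists (carrier G) \<Longrightarrow> hs \<in> lists (carrier G) \<Longrightarrow> mprod G (gs @ hs) = mprod G gs \<otimes> mprod G hs"
  by (induction gs) (auto simp: mprod_closed m_assoc)

lemma mprod_hom:
  assumes "group H" "f \<in> hom G H" "gs \<in> lists (carrier G)"
  shows "mprod H (map f gs) = f (mprod G gs)"
proof -
  note closed = mprod_closed
  interpret group_hom G H f
    using assms is_group by (simp add: group_hom_def group_hom_axioms_def)
  show ?thesis
    using assms(3)
  proof (induction gs rule: list.induct)
    case (Cons g gs)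
    then have "g \<in> carrier G" "mprod G gs \<in> carrier G"
      using closed[of gs] by simp_all
    then have "f (g \<otimes> mprod G gs) = f g \<otimes>\<^bsub>H\<^esub> f (mprod G gs)"
      by (rule hom_mult)
    then show ?case
      using Cons by (simp add: mprod_def[of H])
  qed (simp add: mprod_def[of H])
qed

end

lemma twisted_nerve_simps [simp]:
  "gs \<in> cells (twisted_nerve G z) n \<longleftrightarrow> gs \<in> lists (carrier G) \<and> length gs = n"
  by (simp add: twisted_nerve_def)

lemma centralizer_nerve_simps [simp]:
  "(c, gs) \<in> cells (centralizer_nerve F) n \<longleftrightarrow>
    c \<in> conj_classes F \<and> gs \<in> lists (carrier (class_centralizer F c)) \<and> length gs = n"
  "face (centralizer_nerve F) n i (c, gs) = (c, face (BC F c) n i gs)"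
  "cyc (centralizer_nerve F) n (c, gs) = (c, cyc (BC F c) n gs)"
  by (auto simp: centralizer_nerve_def BC_def)

lemma (in group) twisted_nerve_cyclic_cells:
  assumes "z \<in> carrier G"
  shows "cyclic_cells (twisted_nerve G z)"
proof
  fix gs n i assume "gs \<in> cells (twisted_nerve G z) n"
  then have gs: "gs \<in> lists (carrier G)" "length gs = n"
    by simp_all
  have car: "gs ! k \<in> carrier G" if "k < n" for k
    using gs that by (auto simp: in_lists_conv_set)
  have "tl gs \<in> lists (carrier G)"
    using gs(1) by (cases gs) auto
  moreover have "butlast gs \<in> lists (carrier G)" "take k gs \<in> lists (carrier G)"
    "drop k gs \<in> lists (carrier G)" for k
    using gs(1) by (auto simp: lists_eq_set dest: in_set_takeD in_set_dropD in_set_butlastD)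
  ultimately have sub: "tl gs \<in> lists (carrier G)" "butlast gs \<in> lists (carrier G)" "take k gs \<in> lists (carrier G)"
    "drop k gs \<in> lists (carrier G)" for k
    by simp_all
  show "face (twisted_nerve G z) n i gs \<in> cells (twisted_nerve G z) (n - 1)" if ni: "0 < n" "i \<le> n"
  proof -
    consider "i = 0" | "i = n" "0 < i" | "0 < i" "i < n"
      using ni by linarith
    then show ?thesis
    proof cases
      case 3
      then show ?thesis
        using sub car gs(2) by (auto simp: twisted_nerve_def)
    qed (use sub gs(2) ni in \<open>auto simp: twisted_nerve_def\<close>)
  qed
  show "cyc (twisted_nerve G z) n gs \<in> cells (twisted_nerve G z) n"
    using gs sub assms mprod_closed[OF gs(1)] by (auto simp: twisted_nerve_def)
qed

lemma twisted_nerve_map: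
  assumes "group G" "group H" "f \<in> hom G H" "z \<in> carrier G"
  shows "cyclic_map (twisted_nerve G z) (twisted_nerve H (f z)) (map f)"
proof -
  interpret G: group G by fact
  interpret H: group H by fact
  interpret group_hom G H f
    using assms by (simp add: group_hom_def group_hom_axioms_def)
  have cells: "map f gs \<in> lists (carrier H)" if "gs \<in> lists (carrier G)" for gs
    using that by auto
  have cyc: "map f (cyc (twisted_nerve G z) (length gs) gs) = cyc (twisted_nerve H (f z)) (length gs) (map f gs)"
    if gs: "gs \<in> lists (carrier G)" for gs
    using gs assms(4) G.mprod_closed[OF gs] G.mprod_hom[OF assms(2,3) gs] by (simp add: twisted_nerve_def map_butlast)
  have face: "map f (face (twisted_nerve G z) (length gs) i gs) = face (twisted_nerve H (f z)) (length gs) i (map f gs)"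
    if gs: "gs \<in> lists (carrier G)" "i \<le> length gs" "0 < length gs" for gs i
  proof -
    have "gs ! k \<in> carrier G" if "k < length gs" for k
      using gs(1) that by (auto simp: in_lists_conv_set)
    then show ?thesis
      using gs by (auto simp: twisted_nerve_def map_butlast map_tl take_map drop_map)
  qed
  show ?thesis
    unfolding cyclic_map_def using cells cyc face by auto
qed

text \<open>The closed string \<open>(inv (h\<^sub>1 \<cdots> h\<^sub>n) z, h\<^sub>1, \<dots>, h\<^sub>n)\<close> of the cyclic nerve, with cyclic product \<open>z\<close>;
  separating it from the evaluation of centralizers makes it natural in the group.\<close>

definition close_string :: "('g, 'k) monoid_scheme \<Rightarrow> 'g \<Rightarrow> 'g list \<Rightarrow> 'g list"
  where "close_string G z hs = (inv\<^bsub>G\<^esub> (mprod G hs) \<otimes>\<^bsub>G\<^esub> z) # hs"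

lemma nerve_to_Ncy_eq: "nerve_to_Ncy F r (c, gs) = close_string F (r c) (map (\<lambda>\<gamma>. \<gamma> (r c)) gs)"
  by (simp add: nerve_to_Ncy_def close_string_def Let_def)

lemma close_string_hom:
  assumes "group G" "group H" "f \<in> hom G H" "z \<in> carrier G" "hs \<in> lists (carrier G)"
  shows "close_string H (f z) (map f hs) = map f (close_string G z hs)"
proof -
  interpret G: group G by fact
  interpret H: group H by fact
  interpret group_hom G H f
    using assms by (simp add: group_hom_def group_hom_axioms_def)
  show ?thesis
    using assms G.mprod_closed[OF assms(5)] G.mprod_hom[OF assms(2,3,5)] by (simp add: close_string_def)
qed

context group
begin

text \<open>The zeroth face multiplies the first entry by \<open>h\<^sub>1\<close> from the right, and moving this factor past \<open>z\<close>
  makes it cancel; for the last face the two factors \<open>h\<^sub>n\<close> are adjacent from the start.\<close>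

lemma close_string_face:
  assumes z: "z \<in> carrier G" and hs: "hs \<in> lists (carrier G)" "length hs = n" and n: "0 < n" "i \<le> n"
    and comm: "\<And>h. h \<in> set hs \<Longrightarrow> h \<otimes> z = z \<otimes> h"
  shows "face (Ncy G) n i (close_string G z hs) = close_string G z (face (twisted_nerve G z) n i hs)"
proof -
  have car: "hs ! k \<in> carrier G" if "k < n" for k
    using hs that by (auto simp: in_lists_conv_set)
  consider "i = 0" | "i = n" "0 < i" | "0 < i" "i < n"
    using n by linarith
  then show ?thesis
  proof cases
    case 1
    obtain h hs' where h: "hs = h # hs'"
      using n hs by (cases hs) auto
    have c: "h \<in> carrier G" "hs' \<in> lists (carrier G)" "mprod G hs' \<in> carrier G"
      using hs h mprod_closed by auto
    have "inv h \<otimes> (z \<otimes> h) = z"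
      using comm[of h] c z by (simp add: h m_assoc[symmetric] flip: comm)
    then have "inv (h \<otimes> mprod G hs') \<otimes> z \<otimes> h = inv (mprod G hs') \<otimes> z"
      using c z by (simp add: inv_mult_group m_assoc)
    then show ?thesis
      using 1 n h hs by (simp add: Ncy_def twisted_nerve_def close_string_def)
  next
    case 2
    obtain h hs' where h: "hs = hs' @ [h]"
      using n hs by (cases hs rule: rev_cases) auto
    have c: "h \<in> carrier G" "hs' \<in> lists (carrier G)" "mprod G hs' \<in> carrier G"
      using hs h mprod_closed by auto
    have "h \<otimes> (inv (mprod G (hs' @ [h])) \<otimes> z) = inv (mprod G hs') \<otimes> z"
      using c z by (simp add: mprod_append inv_mult_group m_assoc[symmetric])
    then show ?thesis
      using 2 n h hs by (simp add: Ncy_def twisted_nerve_def close_string_def)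
  next
    case 3
    then obtain i' where i: "i = Suc i'"
      by (cases i) auto
    have split: "hs = take i' hs @ hs ! i' # hs ! Suc i' # drop (Suc (Suc i')) hs"
      using 3 hs(2) by (simp add: i Cons_nth_drop_Suc)
    have c: "take i' hs \<in> lists (carrier G)" "drop (Suc (Suc i')) hs \<in> lists (carrier G)"
      using hs(1) by (auto simp: lists_eq_set dest: in_set_takeD in_set_dropD)
    have "mprod G (take i' hs @ hs ! i' # hs ! Suc i' # drop (Suc (Suc i')) hs)
      = mprod G (take i' hs @ (hs ! i' \<otimes> hs ! Suc i') # drop (Suc (Suc i')) hs)"
      using c car[of i'] car[of "Suc i'"] 3 i mprod_closed[OF c(2)] by (simp add: mprod_append m_assoc)
    then have "mprod G (take i' hs @ (hs ! i' \<otimes> hs ! Suc i') # drop (Suc (Suc i')) hs) = mprod G hs"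
      using split by simp
    then show ?thesis
      using 3 by (simp add: Ncy_def twisted_nerve_def close_string_def i)
  qed
qed

lemma mprod_commute:
  assumes z: "z \<in> carrier G" and "hs \<in> lists (carrier G)" "\<And>h. h \<in> set hs \<Longrightarrow> h \<otimes> z = z \<otimes> h"
  shows "mprod G hs \<otimes> z = z \<otimes> mprod G hs"
  using assms(2,3)
proof (induction hs rule: list.induct)
  case (Cons g gs)
  have g: "g \<in> carrier G" "gs \<in> lists (carrier G)"
    using Cons.prems(1) by simp_all
  note m = mprod_closed[OF g(2)]
  have "g \<otimes> mprod G gs \<otimes> z = g \<otimes> (mprod G gs \<otimes> z)"
    using g m z by (simp add: m_assoc)
  also have "\<dots> = g \<otimes> (z \<otimes> mprod G gs)"
    using Cons by simp
  also have "\<dots> = (g \<otimes> z) \<otimes> mprod G gs"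
    using g m z by (simp add: m_assoc)
  also have "\<dots> = z \<otimes> (g \<otimes> mprod G gs)"
    using g m z Cons.prems(2)[of g] by (simp add: m_assoc)
  finally show ?case
    by simp
qed (use z in simp)

lemma close_string_cyc:
  assumes z: "z \<in> carrier G" and hs: "hs \<in> lists (carrier G)"
    and comm: "\<And>h. h \<in> set hs \<Longrightarrow> h \<otimes> z = z \<otimes> h"
  shows "cyc_list (close_string G z hs) = close_string G z (cyc (twisted_nerve G z) (length hs) hs)"
proof (cases hs rule: rev_cases)
  case Nil
  then show ?thesis
    by (simp add: close_string_def twisted_nerve_def cyc_list_def)
next
  case (snoc hs' h)
  have c: "h \<in> carrier G" "hs' \<in> lists (carrier G)" "mprod G hs' \<in> carrier G"
    using hs snoc mprod_closed by auto
  have m: "mprod G hs = mprod G hs' \<otimes> h"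
    using c by (simp add: snoc mprod_append)
  have "mprod G hs \<otimes> z = z \<otimes> mprod G hs"
    using mprod_commute[OF z hs comm] .
  then have 1: "inv (mprod G hs) \<otimes> z = z \<otimes> inv (mprod G hs)"
    using z mprod_closed[OF hs] by (metis inv_closed inv_solve_left inv_solve_right m_assoc m_closed)
  have 2: "inv (z \<otimes> inv (mprod G hs) \<otimes> mprod G hs') \<otimes> z = h"
    using c z unfolding m by (simp add: inv_mult_group m_assoc)
  show ?thesis
    using 1 2 unfolding snoc by (simp add: close_string_def twisted_nerve_def cyc_list_def)
qed

end

context free_class
begin

lemma BC_cyclic_cells: "cyclic_cells (BC F c)"
  unfolding BC_def by (rule R.twisted_nerve_cyclic_cells[OF twist_in_R])

lemma eval_lists: "gs \<in> lists (carrier R) \<Longrightarrow> y \<in> c \<Longrightarrow> map (\<lambda>\<gamma>. \<gamma> y) gs \<in> lists (carrier F)"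
  using R_carrier by auto

end

lemma free_classI: "F = free_group S \<Longrightarrow> c \<in> conj_classes F \<Longrightarrow> free_class S F c"
  by (simp add: free_class_def)

lemma free_class_homI:
  "F = free_group S \<Longrightarrow> c \<in> conj_classes F \<Longrightarrow> F' = free_group S' \<Longrightarrow> f \<in> hom F F' \<Longrightarrow> free_class_hom S F c S' F' f"
  by (simp add: free_class_hom_def free_class_hom_axioms_def free_class_def)

lemma centralizer_nerve_cyclic_cells:
  assumes F: "F = free_group S"
  shows "cyclic_cells (centralizer_nerve F)"
proof
  fix x n i assume x: "x \<in> cells (centralizer_nerve F) n"
  obtain c gs where cg: "x = (c, gs)"
    by (cases x)
  then interpret free_class S F c
    using F x by (intro free_classI) auto
  interpret B: cyclic_cells "BC F c"
    by (rule BC_cyclic_cells)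
  have gs: "gs \<in> cells (BC F c) n"
    using x by (simp add: cg BC_def)
  show "face (centralizer_nerve F) n i x \<in> cells (centralizer_nerve F) (n - 1)" if "0 < n" "i \<le> n"
    using B.face_cells[OF gs that] c by (simp add: cg BC_def)
  show "cyc (centralizer_nerve F) n x \<in> cells (centralizer_nerve F) n"
    using B.cyc_cells[OF gs] c by (simp add: cg BC_def)
qed

lemma centralizer_nerve_map_cyclic:
  assumes F: "F = free_group S" and F': "F' = free_group S'" and f: "f \<in> hom F F'"
  shows "cyclic_map (centralizer_nerve F) (centralizer_nerve F') (centralizer_nerve_map F' f)"
proof -
  have "centralizer_nerve_map F' f x \<in> cells (centralizer_nerve F') n \<and>
    centralizer_nerve_map F' f (cyc (centralizer_nerve F) n x) = cyc (centralizer_nerve F') n (centralizer_nerve_map F' f x) \<and>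
    (0 < n \<longrightarrow> (\<forall>i\<le>n. centralizer_nerve_map F' f (face (centralizer_nerve F) n i x)
      = face (centralizer_nerve F') n i (centralizer_nerve_map F' f x)))"
    if x: "x \<in> cells (centralizer_nerve F) n" for x n
  proof -
    obtain c gs where cg: "x = (c, gs)"
      by (cases x)
    then interpret free_class_hom S F c S' F' f
      using F F' f x by (intro free_class_homI) auto
    have gs: "gs \<in> cells (BC F c) n"
      using x by (simp add: cg BC_def)
    have "cyclic_map (BC F c) (BC F' c') (map (class_centralizer_map F' f c))"
      using twisted_nerve_map[OF R.is_group T.R.is_group induced_hom twist_in_R]
      unfolding BC_def induced_twist .
    then show ?thesis
      using gs c'_class unfolding cyclic_map_def by (auto simp: cg centralizer_nerve_map_def BC_def)
  qed
  then show ?thesis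
    unfolding cyclic_map_def by blast
qed

lemma nerve_to_Ncy_cyclic:
  assumes F: "F = free_group S" and r: "\<And>c. c \<in> conj_classes F \<Longrightarrow> r c \<in> c"
  shows "cyclic_map (centralizer_nerve F) (Ncy F) (nerve_to_Ncy F r)"
proof -
  have "nerve_to_Ncy F r x \<in> cells (Ncy F) n \<and>
    nerve_to_Ncy F r (cyc (centralizer_nerve F) n x) = cyc (Ncy F) n (nerve_to_Ncy F r x) \<and>
    (0 < n \<longrightarrow> (\<forall>i\<le>n. nerve_to_Ncy F r (face (centralizer_nerve F) n i x) = face (Ncy F) n i (nerve_to_Ncy F r x)))"
    if x: "x \<in> cells (centralizer_nerve F) n" for x n
  proof -
    obtain c gs where cg: "x = (c, gs)"
      by (cases x)
    then interpret free_class S F c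
      using F x by (intro free_classI) auto
    let ?e = "map (\<lambda>\<gamma>. \<gamma> (r c))"
    have gs: "gs \<in> lists (carrier R)" "length gs = n"
      using x by (simp_all add: cg)
    have rc: "r c \<in> c" "r c \<in> carrier F"
      using r[OF c] c_carrier by auto
    have map: "cyclic_map (BC F c) (twisted_nerve F (r c)) ?e"
      using twisted_nerve_map[OF R.is_group F.is_group eval_hom[OF rc(1)] twist_in_R] rc(1) by (simp add: BC_def)
    have e: "?e gs \<in> lists (carrier F)" "length (?e gs) = n"
      using eval_lists[OF gs(1) rc(1)] gs(2) by simp_all
    have comm: "h \<otimes>\<^bsub>F\<^esub> r c = r c \<otimes>\<^bsub>F\<^esub> h" if "h \<in> set (?e gs)" for h
      using that gs(1) R_commute[OF _ rc(1)] by auto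
    have "nerve_to_Ncy F r x \<in> cells (Ncy F) n"
      using e rc(2) F.mprod_closed[OF e(1)] by (auto simp: cg nerve_to_Ncy_eq close_string_def)
    moreover have "nerve_to_Ncy F r (cyc (centralizer_nerve F) n x) = cyc (Ncy F) n (nerve_to_Ncy F r x)"
      using F.close_string_cyc[OF rc(2) e(1) comm] map gs e(2) by (simp add: cg nerve_to_Ncy_eq cyclic_map_def BC_def)
    moreover have "nerve_to_Ncy F r (face (centralizer_nerve F) n i x) = face (Ncy F) n i (nerve_to_Ncy F r x)"
      if "0 < n" "i \<le> n" for i
      using F.close_string_face[OF rc(2) e that comm] map gs that by (simp add: cg nerve_to_Ncy_eq cyclic_map_def BC_def)
    ultimately show ?thesis
      by blast
  qed
  then show ?thesis
    unfolding cyclic_map_def by blast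
qed

text \<open>Both composites are closed strings on the values of the same canonical centralizer elements, one at
  \<open>f (r c)\<close> and the other at the representative of the image class, and \<open>\<kappa>\<close> conjugates the former to the
  latter.\<close>

lemma nerve_to_Ncy_naturality:
  assumes F: "F = free_group S" and F': "F' = free_group S'" and f: "f \<in> hom F F'"
    and c: "c \<in> conj_classes F" and rc: "r c \<in> c" and rc': "r' (class_map F' f c) \<in> class_map F' f c"
    and \<kappa>: "\<kappa> \<in> carrier F'" "\<And>\<gamma>. \<gamma> \<in> carrier (class_centralizer F c) \<Longrightarrow>
      class_centralizer_map F' f c \<gamma> (r' (class_map F' f c)) = \<kappa> \<otimes>\<^bsub>F'\<^esub> f (\<gamma> (r c)) \<otimes>\<^bsub>F'\<^esub> inv\<^bsub>F'\<^esub> \<kappa>"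
    and gs: "gs \<in> lists (carrier (class_centralizer F c))"
  shows "nerve_to_Ncy F' r' (centralizer_nerve_map F' f (c, gs))
    = map (\<lambda>g. \<kappa> \<otimes>\<^bsub>F'\<^esub> g \<otimes>\<^bsub>F'\<^esub> inv\<^bsub>F'\<^esub> \<kappa>) (map f (nerve_to_Ncy F r (c, gs)))"
proof -
  interpret free_class_hom S F c S' F' f
    by (rule free_class_homI[OF F c F' f])
  let ?k = "\<lambda>g. \<kappa> \<otimes>\<^bsub>F'\<^esub> g \<otimes>\<^bsub>F'\<^esub> inv\<^bsub>F'\<^esub> \<kappa>"
  have k: "?k \<in> hom F' F'"
    using \<kappa>(1) F'.conj_mult by (intro homI) auto
  have kf: "(\<lambda>g. ?k (f g)) \<in> hom F F'"
    using hom_compose[OF f k] by (simp add: o_def)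
  have "r' c' = ?k (f (r c))"
    using \<kappa>(2)[OF twist_in_R] rc rc' by (simp add: induced_twist)
  moreover have "map (\<lambda>\<gamma>. \<gamma> (r' c')) (map (class_centralizer_map F' f c) gs) = map (\<lambda>g. ?k (f g)) (map (\<lambda>\<gamma>. \<gamma> (r c)) gs)"
    using \<kappa>(2) gs by auto
  ultimately have "nerve_to_Ncy F' r' (centralizer_nerve_map F' f (c, gs))
    = close_string F' (?k (f (r c))) (map (\<lambda>g. ?k (f g)) (map (\<lambda>\<gamma>. \<gamma> (r c)) gs))"
    by (simp add: nerve_to_Ncy_eq centralizer_nerve_map_def del: map_map)
  also have "\<dots> = map (\<lambda>g. ?k (f g)) (nerve_to_Ncy F r (c, gs))"
    unfolding nerve_to_Ncy_eq
    by (rule close_string_hom[OF F.is_group F'.is_group kf c_carrier[OF rc] eval_lists[OF gs rc]])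
  finally show ?thesis
    by simp
qed

lemma centralizer_nerve_map_comp:
  assumes F: "F = free_group S" and F': "F' = free_group S'" and F'': "F'' = free_group S''"
    and f: "f \<in> hom F F'" and g: "g \<in> hom F' F''" and x: "x \<in> cells (centralizer_nerve F) n"
  shows "centralizer_nerve_map F'' g (centralizer_nerve_map F' f x) = centralizer_nerve_map F'' (g \<circ> f) x"
proof -
  obtain c gs where cg: "x = (c, gs)"
    by (cases x)
  then have c: "c \<in> conj_classes F" "gs \<in> lists (carrier (class_centralizer F c))"
    using x by auto
  have G: "group F" "group F'" "group F''"
    using group_free_group F F' F'' by auto
  have "class_centralizer_map F'' g (class_map F' f c) (class_centralizer_map F' f c \<gamma>) = class_centralizer_map F'' (g \<circ> f) c \<gamma>"
    if "\<gamma> \<in> set gs" for \<gamma>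
    using c that by (intro induced_comp[OF free_class_homI[OF F c(1) F' f] F'' g]) auto
  then show ?thesis
    using class_map_comp[OF G f g c(1)] by (simp add: cg centralizer_nerve_map_def)
qed

lemma centralizer_nerve_map_cong:
  assumes F: "F = free_group S" and F': "F' = free_group S'" and f: "f \<in> hom F F'"
    and eq: "\<And>y. y \<in> carrier F \<Longrightarrow> f y = g y" and x: "x \<in> cells (centralizer_nerve F) n"
  shows "centralizer_nerve_map F' f x = centralizer_nerve_map F' g x"
proof -
  obtain c gs where cg: "x = (c, gs)"
    by (cases x)
  then have c: "c \<in> conj_classes F" "gs \<in> lists (carrier (class_centralizer F c))"
    using x by auto
  have "class_centralizer_map F' f c \<gamma> = class_centralizer_map F' g c \<gamma>" if "\<gamma> \<in> set gs" for \<gamma>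
    using c that eq by (intro induced_cong[OF free_class_homI[OF F c(1) F' f]]) auto
  moreover have "class_map F' f c = class_map F' g c"
    using F eq c(1) by (intro class_map_cong) (auto simp: group_free_group)
  ultimately show ?thesis
    by (simp add: cg centralizer_nerve_map_def)
qed

section \<open>Homomorphisms out of free groups\<close>

context group
begin

definition letter_image :: "('c \<Rightarrow> 'a) \<Rightarrow> 'c \<times> bool \<Rightarrow> 'a"
  where "letter_image f l = (if snd l then f (fst l) else inv (f (fst l)))"

lemma free_hom_Cons: "free_hom G f (l # w) = letter_image f l \<otimes> free_hom G f w"
  and free_hom_Nil [simp]: "free_hom G f [] = \<one>"
  by (simp_all add: free_hom_def letter_image_def case_prod_unfold)

lemma letter_image_closed: "f \<in> S \<rightarrow> carrier G \<Longrightarrow> l \<in> S \<times> UNIV \<Longrightarrow> letter_image f l \<in> carrier G"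
  by (auto simp: letter_image_def)

lemma letter_image_neg: "f \<in> S \<rightarrow> carrier G \<Longrightarrow> l \<in> S \<times> UNIV \<Longrightarrow> letter_image f l \<otimes> letter_image f (neg l) = \<one>"
  by (auto simp: letter_image_def neg_def Pi_def)

lemma free_hom_closed: "f \<in> S \<rightarrow> carrier G \<Longrightarrow> w \<in> lists (S \<times> UNIV) \<Longrightarrow> free_hom G f w \<in> carrier G"
  by (induction w rule: list.induct) (auto simp: free_hom_Cons letter_image_closed simp del: Pi_I' mem_Sigma_iff)

lemma free_hom_append:
  assumes "f \<in> S \<rightarrow> carrier G" "u \<in> lists (S \<times> UNIV)" "v \<in> lists (S \<times> UNIV)"
  shows "free_hom G f (u @ v) = free_hom G f u \<otimes> free_hom G f v"
  using assms(2)
proof (induction u rule: list.induct)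
  case (Cons l u)
  then show ?case
    using letter_image_closed[OF assms(1), of l] free_hom_closed[OF assms(1), of u] free_hom_closed[OF assms(1,3)]
    by (simp add: free_hom_Cons m_assoc)
qed (simp add: free_hom_closed[OF assms(1,3)])

text \<open>Cancelling a letter against its inverse does not change the product of the images, so the evaluation of
  arbitrary words descends to reduced words.\<close>

lemma free_hom_push:
  assumes "f \<in> S \<rightarrow> carrier G" "l \<in> S \<times> UNIV" "w \<in> lists (S \<times> UNIV)"
  shows "free_hom G f (push l w) = letter_image f l \<otimes> free_hom G f w"
proof (cases w)
  case (Cons k v)
  show ?thesis
  proof (cases "k = neg l")
    case True
    have v: "v \<in> lists (S \<times> UNIV)"
      using assms(3) Cons by simp
    have "neg l \<in> S \<times> UNIV"
      using assms(2) by (auto simp: neg_def)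
    then have "letter_image f l \<otimes> (letter_image f (neg l) \<otimes> free_hom G f v) = free_hom G f v"
      using letter_image_neg[OF assms(1,2)] letter_image_closed[OF assms(1)] free_hom_closed[OF assms(1) v] assms(2)
      by (simp add: m_assoc[symmetric])
    then show ?thesis
      by (simp add: Cons True push_Cons free_hom_Cons)
  qed (simp add: Cons push_Cons free_hom_Cons)
qed (simp add: free_hom_Cons)

lemma free_hom_reduce:
  assumes "f \<in> S \<rightarrow> carrier G" "w \<in> lists (S \<times> UNIV)"
  shows "free_hom G f (reduce w) = free_hom G f w"
  using assms(2)
proof (induction w rule: list.induct)
  case (Cons l w)
  have "reduce (l # w) = push l (reduce w)"
    by (simp add: reduce_def)
  moreover have "reduce w \<in> lists (S \<times> UNIV)"
    using set_reduce[of w] Cons.prems by (auto simp: lists_eq_set)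
  ultimately show ?case
    using Cons free_hom_push[OF assms(1), of l "reduce w"] by (simp add: free_hom_Cons)
qed simp

lemma free_hom_hom: "f \<in> S \<rightarrow> carrier G \<Longrightarrow> free_hom G f \<in> hom (free_group S) G"
  using free_hom_closed[of f S] free_hom_reduce[of f S] free_hom_append[of f S]
  by (intro homI) (simp_all add: free_group_simps)

lemma free_hom_generator: "f a \<in> carrier G \<Longrightarrow> free_hom G f [(a, True)] = f a"
  by (simp add: free_hom_Cons letter_image_def)

lemma free_group_hom_eqI:
  assumes g: "g \<in> hom (free_group S) G" and h: "h \<in> hom (free_group S) G"
    and eq: "\<And>a. a \<in> S \<Longrightarrow> g [(a, True)] = h [(a, True)]" and w: "w \<in> carrier (free_group S)"
  shows "g w = h w"
proof -
  interpret F: group "free_group S" by (rule group_free_group)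
  interpret g: group_hom "free_group S" G g
    using g is_group F.is_group by (simp add: group_hom_def group_hom_axioms_def)
  interpret h: group_hom "free_group S" G h
    using h is_group F.is_group by (simp add: group_hom_def group_hom_axioms_def)
  show ?thesis
    using w by (induction rule: free_group_induct) (simp_all add: eq)
qed

end

section \<open>The free simplicial group\<close>

definition delete :: "nat \<Rightarrow> 'a list \<Rightarrow> 'a list"
  where "delete i xs = take i xs @ drop (Suc i) xs"

lemma delete_delete: "i < j \<Longrightarrow> delete i (delete j xs) = delete (j - 1) (delete i xs)"
proof -
  assume "i < j"
  then obtain k where j: "j = Suc (i + k)"
    using less_imp_Suc_add by blast
  show ?thesis
  proof (cases "i < length xs")
    case True
    then obtain us a vs where xs: "xs = us @ a # vs" "length us = i"
      using id_take_nth_drop by (metis length_take min.absorb4)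
    then show ?thesis
      by (simp add: delete_def j)
  qed (simp add: delete_def j)
qed

lemma set_delete: "set (delete i xs) \<subseteq> set xs"
  by (auto simp: delete_def dest: in_set_takeD in_set_dropD)

lemma sorted_delete: "sorted xs \<Longrightarrow> sorted (delete i xs)"
proof -
  assume "sorted xs"
  then have "sorted (take i xs @ drop i xs)"
    by simp
  moreover have "drop (Suc i) xs = tl (drop i xs)"
    by (simp add: drop_Suc tl_drop)
  ultimately show ?thesis
    unfolding delete_def by (cases "drop i xs") (auto simp: sorted_append)
qed

lemma group_Gamma: "group (Gamma m n)"
  unfolding Gamma_def by (rule group_free_group)

text \<open>A list that misses a value stands for a degeneracy of a proper face of the fundamental simplex, where
  \<open>Gamma m\<close> is trivial.\<close>

definition simplex_image :: "nat \<Rightarrow> nat list \<Rightarrow> nat list word"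
  where "simplex_image m \<beta> = (if set \<beta> = {..<m} then [(\<beta>, True)] else [])"

lemma map_nth_omit: "i \<le> n \<Longrightarrow> length \<alpha> = Suc n \<Longrightarrow> map ((!) \<alpha>) ([0..<i] @ [Suc i..<Suc n]) = delete i \<alpha>"
  by (rule nth_equalityI) (auto simp: delete_def nth_append simp del: upt_Suc)

lemma delete_gens:
  assumes "\<alpha> \<in> Gamma_gens m n" "0 < n" "i \<le> n" "set (delete i \<alpha>) = {..<m}"
  shows "delete i \<alpha> \<in> Gamma_gens m (n - 1)"
  using assms sorted_delete[of \<alpha> i] by (auto simp: Gamma_gens_def delete_def)

context
  fixes m n i :: nat
  assumes n: "0 < n" and i: "i \<le> n"
begin

interpretation T: group "Gamma m (n - 1)" by (rule group_Gamma)

lemma Gamma_face_hom: "Gamma_face m n i \<in> hom (Gamma m n) (Gamma m (n - 1))"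
  and Gamma_face_generator: "\<alpha> \<in> Gamma_gens m n \<Longrightarrow> Gamma_face m n i [(\<alpha>, True)] = simplex_image m (delete i \<alpha>)"
proof -
  let ?\<theta> = "[0..<i] @ [Suc i..<Suc n]"
  let ?f = "\<lambda>\<alpha>. let \<beta> = map ((!) \<alpha>) ?\<theta> in if set \<beta> = {..<m} then [(\<beta>, True)] else []"
  have len: "length ?\<theta> - 1 = n - 1"
    using i by (cases "i = n") auto
  have face: "Gamma_face m n i = free_hom (Gamma m (n - 1)) ?f"
    unfolding Gamma_face_def Gamma_op_def len ..
  have f: "?f \<alpha> = simplex_image m (delete i \<alpha>)" if "\<alpha> \<in> Gamma_gens m n" for \<alpha>
  proof -
    have "map ((!) \<alpha>) ?\<theta> = delete i \<alpha>"
      using that i by (intro map_nth_omit) (auto simp: Gamma_gens_def)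
    then show ?thesis
      unfolding Let_def by (simp only: simplex_image_def)
  qed
  have closed: "simplex_image m (delete i \<alpha>) \<in> carrier (Gamma m (n - 1))" if "\<alpha> \<in> Gamma_gens m n" for \<alpha>
    using delete_gens[OF that n i] by (auto simp: simplex_image_def Gamma_def free_group_simps)
  have "?f \<in> Gamma_gens m n \<rightarrow> carrier (Gamma m (n - 1))"
    using f closed by (intro Pi_I) simp
  from T.free_hom_hom[OF this] show "Gamma_face m n i \<in> hom (Gamma m n) (Gamma m (n - 1))"
    unfolding face by (simp only: Gamma_def)
  show "Gamma_face m n i [(\<alpha>, True)] = simplex_image m (delete i \<alpha>)" if "\<alpha> \<in> Gamma_gens m n"
    unfolding face using T.free_hom_generator[of ?f \<alpha>] f[OF that] closed[OF that] by (simp only:)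
qed

lemma Gamma_face_Nil: "Gamma_face m n i [] = []"
  using hom_one[OF Gamma_face_hom group_Gamma group_Gamma] by (simp add: Gamma_def free_group_simps)

end

text \<open>On generators both sides are given by deleting two entries, where a list that has ceased to be
  surjective remains so.\<close>

lemma Gamma_face_face_generator:
  assumes "\<alpha> \<in> Gamma_gens m n" "1 < n" "i \<le> n - 1" "j \<le> n"
  shows "Gamma_face m (n - 1) i (Gamma_face m n j [(\<alpha>, True)]) = simplex_image m (delete i (delete j \<alpha>))"
proof (cases "set (delete j \<alpha>) = {..<m}")
  case True
  then have "delete j \<alpha> \<in> Gamma_gens m (n - 1)"
    using assms by (intro delete_gens) auto
  then show ?thesis
    using Gamma_face_generator[of n j \<alpha> m] Gamma_face_generator[of "n - 1" i "delete j \<alpha>" m] assms True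
    by (simp add: simplex_image_def[of m "delete j \<alpha>"])
next
  case False
  have "set (delete j \<alpha>) \<subseteq> {..<m}"
    using assms(1) set_delete[of j \<alpha>] by (auto simp: Gamma_gens_def)
  then have "set (delete i (delete j \<alpha>)) \<noteq> {..<m}"
    using False set_delete[of i "delete j \<alpha>"] by auto
  then show ?thesis
    using Gamma_face_generator[of n j \<alpha> m] Gamma_face_Nil[of "n - 1" i m] assms False
    by (simp add: simplex_image_def)
qed

lemma Gamma_face_face:
  assumes "1 < n" "i < j" "j \<le> n" "w \<in> carrier (Gamma m n)"
  shows "Gamma_face m (n - 1) i (Gamma_face m n j w) = Gamma_face m (n - 1) (j - 1) (Gamma_face m n i w)"
proof -
  interpret T: group "Gamma m (n - 1 - 1)" by (rule group_Gamma)
  have hom: "(\<lambda>w. Gamma_face m (n - 1) i (Gamma_face m n j w)) \<in> hom (Gamma m n) (Gamma m (n - 1 - 1))"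
    if "i \<le> n - 1" "j \<le> n" for i j
    using hom_compose[OF Gamma_face_hom[of n j m] Gamma_face_hom[of "n - 1" i m]] that assms(1) by (simp add: o_def)
  show ?thesis
  proof (rule T.free_group_hom_eqI[where S = "Gamma_gens m n" and w = w
        and g = "\<lambda>w. Gamma_face m (n - 1) i (Gamma_face m n j w)"
        and h = "\<lambda>w. Gamma_face m (n - 1) (j - 1) (Gamma_face m n i w)"])
    show "(\<lambda>w. Gamma_face m (n - 1) i (Gamma_face m n j w)) \<in> hom (free_group (Gamma_gens m n)) (Gamma m (n - 1 - 1))"
      using hom[of i j] assms unfolding Gamma_def[of m n] by simp
    show "(\<lambda>w. Gamma_face m (n - 1) (j - 1) (Gamma_face m n i w)) \<in> hom (free_group (Gamma_gens m n)) (Gamma m (n - 1 - 1))"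
      using hom[of "j - 1" i] assms unfolding Gamma_def[of m n] by simp
    show "w \<in> carrier (free_group (Gamma_gens m n))"
      using assms(4) by (simp add: Gamma_def)
    show "Gamma_face m (n - 1) i (Gamma_face m n j [(\<alpha>, True)]) = Gamma_face m (n - 1) (j - 1) (Gamma_face m n i [(\<alpha>, True)])"
      if "\<alpha> \<in> Gamma_gens m n" for \<alpha>
      using Gamma_face_face_generator[OF that assms(1), of i j] Gamma_face_face_generator[OF that assms(1), of "j - 1" i]
        delete_delete[OF assms(2), of \<alpha>] assms by simp
  qed
qed

section \<open>The simplicial chain complexes\<close>

lemma Ncy_map_cyclic:
  assumes "group G" "group H" "f \<in> hom G H"
  shows "cyclic_map (Ncy G) (Ncy H) (map f)"
proof -
  interpret group_hom G H f
    using assms by (simp add: group_hom_def group_hom_axioms_def)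
  have "map f (face (Ncy G) n i gs) = face (Ncy H) n i (map f gs)"
    if "gs \<in> lists (carrier G)" "length gs = Suc n" "0 < n" "i \<le> n" for gs n i
  proof -
    have "gs ! k \<in> carrier G" if "k \<le> n" for k
      using \<open>gs \<in> lists (carrier G)\<close> \<open>length gs = Suc n\<close> that by (auto simp: in_lists_conv_set)
    then show ?thesis
      using that by (intro nth_equalityI) (auto simp: nth_face_Ncy)
  qed
  moreover have "map f (cyc_list gs) = cyc_list (map f gs)" if "length gs = Suc n" for gs n
    using that by (cases gs rule: rev_cases) (auto simp: cyc_list_def)
  ultimately show ?thesis
    by (auto simp: cyclic_map_def)
qed

lemma C_cells: "cyclic_cells (centralizer_nerve (Gamma m n))"
  unfolding Gamma_def by (rule centralizer_nerve_cyclic_cells[OF refl])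

lemma D_precyclic: "precyclic_set (Ncy (Gamma m n))"
  by (intro monoid.precyclic_Ncy group.is_monoid group_Gamma)

lemma D_cells: "cyclic_cells (Ncy (Gamma m n))"
  using D_precyclic by (simp add: precyclic_set_def)

abbreviation "C_basis m n \<equiv> CC_basis (centralizer_nerve (Gamma m n))"
abbreviation "D_basis m n \<equiv> CC_basis (Ncy (Gamma m n))"

lemma chains_C_cx: "chains (C_cx m n) k = supported (C_basis m n k)"
  and chains_D_cx: "chains (D_cx m n) k = supported (D_basis m n k)"
  by (simp_all add: C_cx_def D_cx_def chains_CC)

lemma linear_bdry_C: "linear_c (bdry (C_cx m n) k)" and linear_bdry_D: "linear_c (bdry (D_cx m n) k)"
  by (simp_all add: C_cx_def D_cx_def linear_bdry_CC)

lemma bdry_C_zero: "c \<in> supported (C_basis m n 0) \<Longrightarrow> bdry (C_cx m n) 0 c = 0"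
  unfolding C_cx_def by (rule cyclic_cells.bdry_zero[OF C_cells])

lemma linear_C_face: "linear_c (C_face m n i)" and linear_D_face: "linear_c (D_face m n i)"
  and linear_phi: "linear_c (phi m r n)"
  by (simp_all add: C_face_def D_face_def phi_def linear_CC_map)

lemma linear_C_diff: "linear_c (C_diff m n)" and linear_D_diff: "linear_c (D_diff m n)"
  unfolding C_diff_def[abs_def] D_diff_def[abs_def]
  by (intro linear_c_sum linear_c_scale linear_C_face linear_D_face)+

lemma C_face_cyclic:
  "0 < n \<Longrightarrow> i \<le> n \<Longrightarrow> cyclic_map (centralizer_nerve (Gamma m n)) (centralizer_nerve (Gamma m (n - 1)))
    (centralizer_nerve_map (Gamma m (n - 1)) (Gamma_face m n i))"
  by (rule centralizer_nerve_map_cyclic[OF Gamma_def Gamma_def Gamma_face_hom])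

lemma D_face_cyclic: "0 < n \<Longrightarrow> i \<le> n \<Longrightarrow> cyclic_map (Ncy (Gamma m n)) (Ncy (Gamma m (n - 1))) (map (Gamma_face m n i))"
  by (rule Ncy_map_cyclic[OF group_Gamma group_Gamma Gamma_face_hom])

lemma phi_cyclic:
  "class_reps m r \<Longrightarrow> cyclic_map (centralizer_nerve (Gamma m n)) (Ncy (Gamma m n)) (nerve_to_Ncy (Gamma m n) (r n))"
  by (rule nerve_to_Ncy_cyclic[OF Gamma_def]) (auto simp: class_reps_def)

lemma C_face_supported: "0 < n \<Longrightarrow> i \<le> n \<Longrightarrow> c \<in> supported (C_basis m n k) \<Longrightarrow> C_face m n i c \<in> supported (C_basis m (n - 1) k)"
  unfolding C_face_def by (rule CC_map_supported[OF cyclic_map_cells[OF C_face_cyclic]])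

lemma D_face_supported: "0 < n \<Longrightarrow> i \<le> n \<Longrightarrow> c \<in> supported (D_basis m n k) \<Longrightarrow> D_face m n i c \<in> supported (D_basis m (n - 1) k)"
  unfolding D_face_def by (rule CC_map_supported[OF cyclic_map_cells[OF D_face_cyclic]])

lemma phi_supported: "class_reps m r \<Longrightarrow> c \<in> supported (C_basis m n k) \<Longrightarrow> phi m r n c \<in> supported (D_basis m n k)"
  unfolding phi_def by (rule CC_map_supported[OF cyclic_map_cells[OF phi_cyclic]])

lemma C_diff_supported: "0 < n \<Longrightarrow> c \<in> supported (C_basis m n k) \<Longrightarrow> C_diff m n c \<in> supported (C_basis m (n - 1) k)"
  unfolding C_diff_def by (intro supported_sum supported_scale C_face_supported) auto

lemma D_diff_supported: "0 < n \<Longrightarrow> c \<in> supported (D_basis m n k) \<Longrightarrow> D_diff m n c \<in> supported (D_basis m (n - 1) k)"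
  unfolding D_diff_def by (intro supported_sum supported_scale D_face_supported) auto

lemma C_face_bdry: "0 < n \<Longrightarrow> i \<le> n \<Longrightarrow> c \<in> supported (C_basis m n k) \<Longrightarrow>
    bdry (C_cx m (n - 1)) k (C_face m n i c) = C_face m n i (bdry (C_cx m n) k c)"
  unfolding C_face_def C_cx_def by (rule cyclic_cells.CC_map_bdry[OF C_cells C_face_cyclic])

lemma D_face_bdry: "0 < n \<Longrightarrow> i \<le> n \<Longrightarrow> c \<in> supported (D_basis m n k) \<Longrightarrow>
    bdry (D_cx m (n - 1)) k (D_face m n i c) = D_face m n i (bdry (D_cx m n) k c)"
  unfolding D_face_def D_cx_def by (rule cyclic_cells.CC_map_bdry[OF D_cells D_face_cyclic])

lemma phi_bdry: "class_reps m r \<Longrightarrow> c \<in> supported (C_basis m n k) \<Longrightarrow>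
    bdry (D_cx m n) k (phi m r n c) = phi m r n (bdry (C_cx m n) k c)"
  unfolding phi_def C_cx_def D_cx_def by (rule cyclic_cells.CC_map_bdry[OF C_cells phi_cyclic])

lemma C_diff_bdry: "0 < n \<Longrightarrow> c \<in> supported (C_basis m n k) \<Longrightarrow>
    bdry (C_cx m (n - 1)) k (C_diff m n c) = C_diff m n (bdry (C_cx m n) k c)"
  unfolding C_diff_def linear_c_simps[OF linear_bdry_C] by (intro sum.cong) (auto simp: C_face_bdry simp del: One_nat_def)

lemma D_diff_bdry: "0 < n \<Longrightarrow> c \<in> supported (D_basis m n k) \<Longrightarrow>
    bdry (D_cx m (n - 1)) k (D_diff m n c) = D_diff m n (bdry (D_cx m n) k c)"
  unfolding D_diff_def linear_c_simps[OF linear_bdry_D] by (intro sum.cong) (auto simp: D_face_bdry simp del: One_nat_def)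

lemma C_face_face:
  assumes "1 < n" "i < j" "j \<le> n" and c: "c \<in> supported (C_basis m n k)"
  shows "C_face m (n - 1) i (C_face m n j c) = C_face m (n - 1) (j - 1) (C_face m n i c)"
  unfolding C_face_def CC_map_comp
proof (rule linear_c_eq_on[OF linear_CC_map linear_CC_map c])
  fix z assume "z \<in> C_basis m n k"
  then obtain p x where z: "z = (p, x)" "x \<in> cells (centralizer_nerve (Gamma m n)) (k - p)"
    by (cases z) auto
  have comp: "centralizer_nerve_map (Gamma m (n - 1 - 1)) (Gamma_face m (n - 1) i) (centralizer_nerve_map (Gamma m (n - 1)) (Gamma_face m n j) x)
    = centralizer_nerve_map (Gamma m (n - 1 - 1)) (Gamma_face m (n - 1) i \<circ> Gamma_face m n j) x"
    if "i \<le> n - 1" "j \<le> n" for i j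
    using assms(1) that by (intro centralizer_nerve_map_comp[OF Gamma_def Gamma_def Gamma_def _ _ z(2)] Gamma_face_hom) auto
  have "centralizer_nerve_map (Gamma m (n - 1 - 1)) (Gamma_face m (n - 1) i \<circ> Gamma_face m n j) x
    = centralizer_nerve_map (Gamma m (n - 1 - 1)) (Gamma_face m (n - 1) (j - 1) \<circ> Gamma_face m n i) x"
  proof (rule centralizer_nerve_map_cong[OF Gamma_def Gamma_def _ _ z(2)])
    show "Gamma_face m (n - 1) i \<circ> Gamma_face m n j \<in> hom (Gamma m n) (Gamma m (n - 1 - 1))"
      using assms by (intro hom_compose[OF Gamma_face_hom Gamma_face_hom]) auto
  qed (use Gamma_face_face[OF assms(1-3)] in simp)
  then show "CC_map (\<lambda>x. centralizer_nerve_map (Gamma m (n - 1 - 1)) (Gamma_face m (n - 1) i) (centralizer_nerve_map (Gamma m (n - 1)) (Gamma_face m n j) x)) (bas z)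
    = CC_map (\<lambda>x. centralizer_nerve_map (Gamma m (n - 1 - 1)) (Gamma_face m (n - 1) (j - 1)) (centralizer_nerve_map (Gamma m (n - 1)) (Gamma_face m n i) x)) (bas z)"
    using comp[of i j] comp[of "j - 1" i] assms by (simp only: z(1) CC_map_single)
qed

lemma D_face_face:
  assumes "1 < n" "i < j" "j \<le> n" and c: "c \<in> supported (D_basis m n k)"
  shows "D_face m (n - 1) i (D_face m n j c) = D_face m (n - 1) (j - 1) (D_face m n i c)"
  unfolding D_face_def CC_map_comp
proof (rule linear_c_eq_on[OF linear_CC_map linear_CC_map c])
  fix z assume "z \<in> D_basis m n k"
  then obtain p x where z: "z = (p, x)" "x \<in> lists (carrier (Gamma m n))"
    by (cases z) auto
  have "map (Gamma_face m (n - 1) i) (map (Gamma_face m n j) x) = map (Gamma_face m (n - 1) (j - 1)) (map (Gamma_face m n i) x)"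
    using z(2) Gamma_face_face[OF assms(1-3)] by auto
  then show "CC_map (\<lambda>x. map (Gamma_face m (n - 1) i) (map (Gamma_face m n j) x)) (bas z)
    = CC_map (\<lambda>x. map (Gamma_face m (n - 1) (j - 1)) (map (Gamma_face m n i) x)) (bas z)"
    by (simp only: z(1) CC_map_single)
qed

lemma C_diff_diff:
  assumes "0 < n" "c \<in> supported (C_basis m (Suc n) k)"
  shows "C_diff m n (C_diff m (Suc n) c) = 0"
proof -
  have "C_diff m n (C_diff m (Suc n) c)
    = (\<Sum>i\<le>Suc n. \<Sum>j\<le>n. cscale ((- 1) ^ (i + j)) (C_face m n j (C_face m (Suc n) i c)))"
    unfolding C_diff_def[of m "Suc n"] linear_c_simps[OF linear_C_diff]
    by (simp add: C_diff_def cvs.scale_sum_right power_add del: sum.atMost_Suc)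
  then show ?thesis
    using alternating_double_sum[of n "\<lambda>i j. C_face m n j (C_face m (Suc n) i c)"]
      C_face_face[of "Suc n" _ _ c m k] assms by simp
qed

lemma D_diff_diff:
  assumes "0 < n" "c \<in> supported (D_basis m (Suc n) k)"
  shows "D_diff m n (D_diff m (Suc n) c) = 0"
proof -
  have "D_diff m n (D_diff m (Suc n) c)
    = (\<Sum>i\<le>Suc n. \<Sum>j\<le>n. cscale ((- 1) ^ (i + j)) (D_face m n j (D_face m (Suc n) i c)))"
    unfolding D_diff_def[of m "Suc n"] linear_c_simps[OF linear_D_diff]
    by (simp add: D_diff_def cvs.scale_sum_right power_add del: sum.atMost_Suc)
  then show ?thesis
    using alternating_double_sum[of n "\<lambda>i j. D_face m n j (D_face m (Suc n) i c)"]
      D_face_face[of "Suc n" _ _ c m k] assms by simp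
qed

section \<open>The canonical homotopies\<close>

text \<open>The canonical homotopies are the chain homotopies of this form, with \<open>K i c\<close> a homotopy for the
  \<open>i\<close>-th face on the summand of \<open>c\<close>.\<close>

definition assemble :: "nat \<Rightarrow> (nat \<Rightarrow> nat list word set \<Rightarrow> nat list word) \<Rightarrow> nat \<Rightarrow>
    (nat \<Rightarrow> nat list word set \<Rightarrow> (dbasis, dbasis) gmap) \<Rightarrow> (cbasis, dbasis) gmap"
  where "assemble m r n K = (\<lambda>k. cextend (\<lambda>(p, c, gs). \<Sum>i\<le>n. cscale ((- 1) ^ i)
    (K i c k (D_face m n i (phi m r n (bas (p, c, gs)))))))"

definition conjugator :: "nat \<Rightarrow> (nat \<Rightarrow> nat list word set \<Rightarrow> nat list word) \<Rightarrow> nat \<Rightarrow> nat \<Rightarrow>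
    nat list word set \<Rightarrow> nat list word \<Rightarrow> bool"
  where "conjugator m r n i c h \<longleftrightarrow> h \<in> carrier (Gamma m (n - 1)) \<and>
    (\<forall>\<gamma>\<in>carrier (class_centralizer (Gamma m n) c).
      class_centralizer_map (Gamma m (n - 1)) (Gamma_face m n i) c \<gamma>
          (r (n - 1) (class_map (Gamma m (n - 1)) (Gamma_face m n i) c))
        = h \<otimes>\<^bsub>Gamma m (n - 1)\<^esub> Gamma_face m n i (\<gamma> (r n c)) \<otimes>\<^bsub>Gamma m (n - 1)\<^esub> inv\<^bsub>Gamma m (n - 1)\<^esub> h)"

lemma canonical_homotopy_iff: "canonical_homotopy m r n s \<longleftrightarrow>
    chain_homotopy (C_cx m n) (D_cx m (n - 1)) (\<lambda>_. phi m r (n - 1) \<circ> C_diff m n) (\<lambda>_. D_diff m n \<circ> phi m r n) s \<and>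
    (\<exists>\<kappa> K. (\<forall>i\<le>n. \<forall>c\<in>conj_classes (Gamma m n). conjugator m r n i c (\<kappa> i c) \<and>
        canonical_conj_homotopy (Gamma m (n - 1)) (\<kappa> i c) (K i c)) \<and> s = assemble m r n K)"
  unfolding canonical_homotopy_def conjugator_def assemble_def Let_def by (simp only: conj_assoc)

text \<open>The differential of \<open>C(m)\<close> preserves the decomposition into classes, so homotopies can be chosen
  independently on the summands.\<close>

lemma bdry_same_class:
  "bdry (CC (centralizer_nerve F)) k (bas (p, c, gs)) \<in> supported {z. fst (snd z) = c}"
proof -
  have pow: "\<exists>gs'. (cyc (centralizer_nerve F) q ^^ j) (c, gs) = (c, gs')" for q j
    by (induction j) auto
  have "fst ((cyc (centralizer_nerve F) q ^^ j) (c, gs)) = c" for q j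
    using pow by (metis fst_conv)
  then show ?thesis
    unfolding bdry_CC_bas
    by (auto simp: cyclic_vert_def cyclic_horiz_def simp del: One_nat_def
        intro!: supported_add supported_sum supported_neg supported_diff supported_single)
qed

text \<open>On the summand of \<open>c\<close>, the homotopy \<open>K i c\<close> has as its two ends the identity and the conjugation by
  \<open>\<kappa> i c\<close>, which turns the face of \<open>\<phi>\<close> into \<open>\<phi>\<close> of the face.\<close>

lemma assembled_homotopy:
  assumes r: "class_reps m r" and n: "0 < n"
    and \<kappa>: "\<And>i c. i \<le> n \<Longrightarrow> c \<in> conj_classes (Gamma m n) \<Longrightarrow> conjugator m r n i c (\<kappa> i c)"
    and K: "\<And>i c. i \<le> n \<Longrightarrow> c \<in> conj_classes (Gamma m n) \<Longrightarrow>
      canonical_conj_homotopy (Gamma m (n - 1)) (\<kappa> i c) (K i c)"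
  shows "chain_homotopy (C_cx m n) (D_cx m (n - 1)) (\<lambda>_. phi m r (n - 1) \<circ> C_diff m n)
    (\<lambda>_. D_diff m n \<circ> phi m r n) (assemble m r n K)"
proof -
  interpret F': group "Gamma m (n - 1)" by (rule group_Gamma)
  let ?s = "assemble m r n K"
  let ?y = "\<lambda>i x. D_face m n i (phi m r n x)"
  have lin: "linear_c (?s k)" for k
    unfolding assemble_def by (rule linear_cextend)
  have lin_y: "linear_c (?y i)" for i
    by (rule linear_c_compose[OF linear_D_face linear_phi])
  note Kc = F'.canonical_conj_homotopy[OF _ K]
  have h: "\<kappa> i c \<in> carrier (Gamma m (n - 1))" if "i \<le> n" "c \<in> conj_classes (Gamma m n)" for i c
    using \<kappa>[OF that] by (simp add: conjugator_def)
  have K_lin: "linear_c (K i c k)" and K_supp: "\<And>x. x \<in> supported (D_basis m (n - 1) k) \<Longrightarrow> K i c k x \<in> supported (D_basis m (n - 1) (Suc k))"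
    if "i \<le> n" "c \<in> conj_classes (Gamma m n)" for i c k
    using Kc(1)[OF h[OF that] that] by (auto simp: graded_map_def chains_CC)
  have y_supp: "?y i x \<in> supported (D_basis m (n - 1) k)" if "i \<le> n" "x \<in> supported (C_basis m n k)" for i x k
    using that n r by (intro D_face_supported phi_supported) auto
  have s_bas: "?s k (bas (p, c, gs)) = (\<Sum>i\<le>n. cscale ((- 1) ^ i) (K i c k (?y i (bas (p, c, gs)))))" for k p c gs
    by (simp add: assemble_def)
  have s_class: "?s k x = (\<Sum>i\<le>n. cscale ((- 1) ^ i) (K i c k (?y i x)))"
    if c: "c \<in> conj_classes (Gamma m n)" and x: "x \<in> supported {z. fst (snd z) = c}" for k c x
  proof (rule linear_c_eq_on[OF lin _ x])
    show "linear_c (\<lambda>x. \<Sum>i\<le>n. cscale ((- 1) ^ i) (K i c k (?y i x)))"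
      by (rule linear_c_sum[OF linear_c_scale[OF linear_c_compose[OF K_lin lin_y]]]) (use c in auto)
    fix z :: cbasis assume "z \<in> {z. fst (snd z) = c}"
    then show "?s k (bas z) = (\<Sum>i\<le>n. cscale ((- 1) ^ i) (K i c k (?y i (bas z))))"
      by (cases z) (auto simp: s_bas)
  qed
  have supp: "?s k x \<in> supported (D_basis m (n - 1) (Suc k))" if x: "x \<in> supported (C_basis m n k)" for k x
  proof (rule linear_c_supported[OF lin _ x])
    fix z assume z: "z \<in> C_basis m n k"
    obtain p c gs where zz: "z = (p, c, gs)"
      by (cases z)
    then have "c \<in> conj_classes (Gamma m n)"
      using z by auto
    then show "?s k (bas z) \<in> supported (D_basis m (n - 1) (Suc k))"
      unfolding zz s_bas using z zz by (intro supported_sum supported_scale K_supp y_supp) auto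
  qed
  have eq: "bdry (D_cx m (n - 1)) (k + 1) (?s k x) + ?s (k - 1) (bdry (C_cx m n) k x)
      = phi m r (n - 1) (C_diff m n x) - D_diff m n (phi m r n x)" if x: "x \<in> supported (C_basis m n k)" for k x
  proof (rule linear_c_eq_on[where f = "\<lambda>x. bdry (D_cx m (n - 1)) (k + 1) (?s k x) + ?s (k - 1) (bdry (C_cx m n) k x)"
        and g = "\<lambda>x. phi m r (n - 1) (C_diff m n x) - D_diff m n (phi m r n x)", OF _ _ x])
    show "linear_c (\<lambda>x. bdry (D_cx m (n - 1)) (k + 1) (?s k x) + ?s (k - 1) (bdry (C_cx m n) k x))"
      by (rule linear_c_add[OF linear_c_compose[OF linear_bdry_D lin] linear_c_compose[OF lin linear_bdry_C]])
    show "linear_c (\<lambda>x. phi m r (n - 1) (C_diff m n x) - D_diff m n (phi m r n x))"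
      by (rule linear_c_sub[OF linear_c_compose[OF linear_phi linear_C_diff] linear_c_compose[OF linear_D_diff linear_phi]])
    fix z assume z: "z \<in> C_basis m n k"
    obtain p c gs where zz: "z = (p, c, gs)"
      by (cases z)
    have c: "c \<in> conj_classes (Gamma m n)" and gs: "gs \<in> lists (carrier (class_centralizer (Gamma m n) c))"
      using z zz by auto
    have bz: "bas z \<in> supported (C_basis m n k)"
      using z by simp
    have y_bdry: "?y i (bdry (C_cx m n) k (bas z)) = bdry (D_cx m (n - 1)) k (?y i (bas z))" if "i \<le> n" for i
      using phi_bdry[OF r bz] D_face_bdry[OF n that phi_supported[OF r bz]] by simp
    have "bdry (D_cx m (n - 1)) (k + 1) (?s k (bas z)) + ?s (k - 1) (bdry (C_cx m n) k (bas z))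
      = (\<Sum>i\<le>n. cscale ((- 1) ^ i) (bdry (D_cx m (n - 1)) (Suc k) (K i c k (?y i (bas z)))
          + K i c (k - 1) (bdry (D_cx m (n - 1)) k (?y i (bas z)))))"
    proof -
      have "?s (k - 1) (bdry (C_cx m n) k (bas z)) = (\<Sum>i\<le>n. cscale ((- 1) ^ i) (K i c (k - 1) (bdry (D_cx m (n - 1)) k (?y i (bas z)))))"
        using s_class[OF c, of "bdry (C_cx m n) k (bas z)" "k - 1"] bdry_same_class[of "Gamma m n" k p c gs] y_bdry
        by (simp add: zz C_cx_def)
      then show ?thesis
        by (simp add: zz s_bas linear_c_simps[OF linear_bdry_D] cvs.scale_right_distrib sum.distrib)
    qed
    also have "\<dots> = (\<Sum>i\<le>n. cscale ((- 1) ^ i) (phi m r (n - 1) (C_face m n i (bas z)) - ?y i (bas z)))"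
    proof (intro sum.cong refl arg_cong[where f = "cscale _"])
      fix i assume "i \<in> {..n}"
      then have i: "i \<le> n" by simp
      have "bdry (D_cx m (n - 1)) (Suc k) (K i c k (?y i (bas z))) + K i c (k - 1) (bdry (D_cx m (n - 1)) k (?y i (bas z)))
        = CC_map (map (\<lambda>g. \<kappa> i c \<otimes>\<^bsub>Gamma m (n - 1)\<^esub> g \<otimes>\<^bsub>Gamma m (n - 1)\<^esub> inv\<^bsub>Gamma m (n - 1)\<^esub> \<kappa> i c)) (?y i (bas z)) - ?y i (bas z)"
        using Kc(2)[OF h[OF i c] i c y_supp[OF i bz]] by (simp add: D_cx_def)
      also have "CC_map (map (\<lambda>g. \<kappa> i c \<otimes>\<^bsub>Gamma m (n - 1)\<^esub> g \<otimes>\<^bsub>Gamma m (n - 1)\<^esub> inv\<^bsub>Gamma m (n - 1)\<^esub> \<kappa> i c)) (?y i (bas z))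
        = phi m r (n - 1) (C_face m n i (bas z))"
      proof -
        have rc: "r n c \<in> c" "r (n - 1) (class_map (Gamma m (n - 1)) (Gamma_face m n i) c) \<in> class_map (Gamma m (n - 1)) (Gamma_face m n i) c"
          using r c class_map_in_conj_classes[OF group_Gamma group_Gamma Gamma_face_hom[OF n i] c] by (auto simp: class_reps_def)
        show ?thesis
          using nerve_to_Ncy_naturality[OF Gamma_def Gamma_def Gamma_face_hom[OF n i] c, of "r n" "r (n - 1)" "\<kappa> i c" gs]
            \<kappa>[OF i c] rc gs
          by (simp add: zz phi_def D_face_def C_face_def conjugator_def)
      qed
      finally show "bdry (D_cx m (n - 1)) (Suc k) (K i c k (?y i (bas z))) + K i c (k - 1) (bdry (D_cx m (n - 1)) k (?y i (bas z)))
        = phi m r (n - 1) (C_face m n i (bas z)) - ?y i (bas z)" .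
    qed
    also have "\<dots> = phi m r (n - 1) (C_diff m n (bas z)) - D_diff m n (phi m r n (bas z))"
      by (simp add: C_diff_def D_diff_def linear_c_simps[OF linear_phi] cvs.scale_right_diff_distrib sum_subtractf)
    finally show "bdry (D_cx m (n - 1)) (k + 1) (?s k (bas z)) + ?s (k - 1) (bdry (C_cx m n) k (bas z))
      = phi m r (n - 1) (C_diff m n (bas z)) - D_diff m n (phi m r n (bas z))" .
  qed
  show ?thesis
    unfolding chain_homotopy_def graded_map_def
    using lin supp eq by (auto simp: chains_C_cx chains_D_cx)
qed

lemma conjugator_exists:
  assumes r: "class_reps m r" and n: "0 < n" "i \<le> n" and c: "c \<in> conj_classes (Gamma m n)"
  shows "\<exists>h. conjugator m r n i c h"
proof -
  interpret free_class_hom "Gamma_gens m n" "Gamma m n" c "Gamma_gens m (n - 1)" "Gamma m (n - 1)" "Gamma_face m n i"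
    by (rule free_class_homI[OF Gamma_def c Gamma_def Gamma_face_hom[OF n]])
  have "r n c \<in> c" "r (n - 1) c' \<in> c'"
    using r c c'_class by (auto simp: class_reps_def)
  from conjugator_exists[OF this] show ?thesis
    unfolding conjugator_def by metis
qed

lemma canonical_homotopy_exists:
  assumes r: "class_reps m r" and n: "0 < n"
  shows "\<exists>s. canonical_homotopy m r n s"
proof -
  have "\<exists>h K. conjugator m r n i c h \<and> canonical_conj_homotopy (Gamma m (n - 1)) h K"
    if "i \<le> n" "c \<in> conj_classes (Gamma m n)" for i c
    using conjugator_exists[OF r n that] canonical_conj_homotopy_exists[OF group.is_monoid[OF group_Gamma]] by blast
  then obtain \<kappa> K where "\<And>i c. i \<le> n \<Longrightarrow> c \<in> conj_classes (Gamma m n) \<Longrightarrow>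
      conjugator m r n i c (\<kappa> i c) \<and> canonical_conj_homotopy (Gamma m (n - 1)) (\<kappa> i c) (K i c)"
    by metis
  then show ?thesis
    unfolding canonical_homotopy_iff using assembled_homotopy[OF r n, of \<kappa> K] by blast
qed

section \<open>The Toda bracket is a chain map\<close>

text \<open>The boundary of \<open>s d + d s\<close> consists, up to the terms with the boundary of the argument, of
  \<open>(\<phi> d - d \<phi>) d + d (\<phi> d - d \<phi>) = \<phi> d d - d d \<phi> = 0\<close>. The sign in the differential of the suspension
  matches the sign of these terms.\<close>

lemma toda_bracket2_chain_map:
  assumes r: "class_reps m r"
    and s: "\<And>n. n \<ge> 1 \<Longrightarrow> chain_homotopy (C_cx m n) (D_cx m (n - 1)) (\<lambda>_. phi m r (n - 1) \<circ> C_diff m n)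
      (\<lambda>_. D_diff m n \<circ> phi m r n) (s n)"
  shows "chain_map (suspension (C_cx m (n + 2))) (D_cx m n) (toda_bracket2 m n s)"
proof -
  have lin: "linear_c (s n k)" if "n \<ge> 1" for n k
    using s[OF that] by (simp add: chain_homotopy_def graded_map_def)
  have supp: "s n k x \<in> supported (D_basis m (n - 1) (Suc k))" if "n \<ge> 1" "x \<in> supported (C_basis m n k)" for n k x
    using s[OF that(1)] that(2) by (auto simp: chain_homotopy_def graded_map_def chains_C_cx chains_D_cx)
  have eq: "bdry (D_cx m (n - 1)) (Suc k) (s n k x)
      = phi m r (n - 1) (C_diff m n x) - D_diff m n (phi m r n x) - s n (k - 1) (bdry (C_cx m n) k x)"
    if "n \<ge> 1" "x \<in> supported (C_basis m n k)" for n k x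
    using s[OF that(1)] that(2) by (simp add: chain_homotopy_def chains_C_cx eq_diff_eq)
  define T where "T k x = s (n + 1) k (C_diff m (n + 2) x) + D_diff m (n + 1) (s (n + 2) k x)" for k x
  have toda: "toda_bracket2 m n s = (\<lambda>k. T (k - 1))"
    by (simp add: toda_bracket2_def from_suspension_def T_def[abs_def])
  have T_lin: "linear_c (T k)" for k
    unfolding T_def[abs_def]
    by (rule linear_c_add[OF linear_c_compose[OF lin linear_C_diff] linear_c_compose[OF linear_D_diff lin]]) auto
  have T_supp: "T k x \<in> supported (D_basis m n (Suc k))" if x: "x \<in> supported (C_basis m (n + 2) k)" for k x
  proof -
    have "C_diff m (n + 2) x \<in> supported (C_basis m (n + 1) k)"
      using C_diff_supported[of "n + 2", OF _ x] by simp
    moreover have "s (n + 2) k x \<in> supported (D_basis m (n + 1) (Suc k))"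
      using supp[of "n + 2", OF _ x] by simp
    ultimately show ?thesis
      unfolding T_def using supp[of "n + 1"] D_diff_supported[of "n + 1"] by (intro supported_add) auto
  qed
  have T_bdry: "bdry (D_cx m n) (Suc k) (T k x) = - T (k - 1) (bdry (C_cx m (n + 2)) k x)"
    if x: "x \<in> supported (C_basis m (n + 2) k)" for k x
  proof -
    have Cx: "C_diff m (n + 2) x \<in> supported (C_basis m (n + 1) k)"
      using C_diff_supported[of "n + 2", OF _ x] by simp
    have sx: "s (n + 2) k x \<in> supported (D_basis m (n + 1) (Suc k))"
      using supp[of "n + 2", OF _ x] by simp
    have 1: "bdry (D_cx m n) (Suc k) (s (n + 1) k (C_diff m (n + 2) x))
      = - D_diff m (n + 1) (phi m r (n + 1) (C_diff m (n + 2) x)) - s (n + 1) (k - 1) (C_diff m (n + 2) (bdry (C_cx m (n + 2)) k x))"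
      using eq[of "n + 1", OF _ Cx] C_diff_diff[of "n + 1" x m k] x C_diff_bdry[of "n + 2", OF _ x]
      by (simp add: linear_c_simps[OF linear_phi])
    have "bdry (D_cx m n) (Suc k) (D_diff m (n + 1) (s (n + 2) k x))
      = D_diff m (n + 1) (bdry (D_cx m (n + 1)) (Suc k) (s (n + 2) k x))"
      using D_diff_bdry[of "n + 1", OF _ sx] by simp
    also have "\<dots> = D_diff m (n + 1) (phi m r (n + 1) (C_diff m (n + 2) x))
        - D_diff m (n + 1) (s (n + 2) (k - 1) (bdry (C_cx m (n + 2)) k x))"
      using eq[of "n + 2", OF _ x] D_diff_diff[of "n + 1" "phi m r (n + 2) x" m k] phi_supported[OF r x]
      by (simp add: linear_c_simps[OF linear_D_diff])
    finally show ?thesis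
      unfolding T_def linear_c_simps[OF linear_bdry_D] 1 by simp
  qed
  have "chain_map (suspension (C_cx m (n + 2))) (D_cx m n) (\<lambda>k. T (k - 1))"
    unfolding chain_map_def graded_map_def
  proof (intro conjI allI ballI)
    show "linear_c (T (k - 1))" for k
      by (rule T_lin)
    show "T (k - 1) ` chains (suspension (C_cx m (n + 2))) k \<subseteq> chains (D_cx m n) (k + 0)" for k
      using T_supp[of _ "k - 1"]
      by (cases k) (auto simp: suspension_def chains_C_cx chains_D_cx linear_c_simps[OF T_lin])
    fix k x assume x: "x \<in> chains (suspension (C_cx m (n + 2))) k"
    show "bdry (D_cx m n) k (T (k - 1) x) = T (k - 1 - 1) (bdry (suspension (C_cx m (n + 2))) k x)"
    proof (cases k)
      case 0
      then show ?thesis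
        using x by (simp add: suspension_def linear_c_simps[OF T_lin] linear_c_simps[OF linear_bdry_D] linear_c_simps[OF linear_bdry_C])
    next
      case (Suc j)
      then show ?thesis
        using x T_bdry[of x j] by (simp add: suspension_def chains_C_cx linear_c_simps[OF T_lin])
    qed
  qed
  then show ?thesis
    unfolding toda .
qed

section \<open>A functional on the first cyclic homology\<close>

definition exponent :: "'a word \<Rightarrow> int"
  where "exponent w = (\<Sum>l\<leftarrow>w. if snd l then 1 else - 1)"

lemma exponent_simps [simp]: "exponent [] = 0" "exponent (l # w) = (if snd l then 1 else - 1) + exponent w"
  "exponent (u @ v) = exponent u + exponent v"
  by (simp_all add: exponent_def)

lemma exponent_push: "exponent (push l w) = (if snd l then 1 else - 1) + exponent w"
  by (cases w) (auto simp: push_Cons neg_def)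

lemma exponent_reduce: "exponent (reduce w) = exponent w"
  by (induction w) (auto simp: reduce_def exponent_push)

text \<open>Homomorphisms to the integers, which form a type class structure rather than a group record.\<close>

definition additive_on :: "('g, 'k) monoid_scheme \<Rightarrow> ('g \<Rightarrow> int) \<Rightarrow> bool"
  where "additive_on G e \<longleftrightarrow> (\<forall>x\<in>carrier G. \<forall>y\<in>carrier G. e (x \<otimes>\<^bsub>G\<^esub> y) = e x + e y)"

lemma additive_exponent: "additive_on (free_group S) exponent"
  by (simp add: additive_on_def free_group_simps exponent_reduce)

lemma additive_comp: "f \<in> hom G H \<Longrightarrow> additive_on H e \<Longrightarrow> additive_on G (\<lambda>x. e (f x))"
  by (auto simp: additive_on_def hom_def)

context group
begin

context
  fixes e :: "'a \<Rightarrow> int"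
  assumes e: "additive_on G e"
begin

lemma additive_mult: "x \<in> carrier G \<Longrightarrow> y \<in> carrier G \<Longrightarrow> e (x \<otimes> y) = e x + e y"
  using e by (simp add: additive_on_def)

lemma additive_one: "e \<one> = 0"
  using additive_mult[of \<one> \<one>] by simp

lemma additive_inv: "x \<in> carrier G \<Longrightarrow> e (inv x) = - e x"
  using additive_mult[of x "inv x"] additive_one by simp

lemma additive_conj: "h \<in> carrier G \<Longrightarrow> x \<in> carrier G \<Longrightarrow> e (h \<otimes> x \<otimes> inv h) = e x"
  by (simp add: additive_mult additive_inv)

lemma additive_nat_pow: "x \<in> carrier G \<Longrightarrow> e (x [^] (n::nat)) = int n * e x"
  by (induction n) (auto simp: additive_one additive_mult algebra_simps)

lemma additive_int_pow:
  assumes "x \<in> carrier G"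
  shows "e (x [^] (i::int)) = i * e x"
proof (cases "i \<ge> 0")
  case True
  then show ?thesis
    using additive_nat_pow[OF assms, of "nat i"] int_pow_int[of G x "nat i"] by simp
next
  case False
  then have "x [^] i = inv (x [^] nat (- i))"
    using int_pow_neg_int[OF assms, of "nat (- i)"] by simp
  then show ?thesis
    using False additive_nat_pow[OF assms, of "nat (- i)"] assms by (simp add: additive_inv)
qed

end

end

text \<open>Commuting elements of a free group are powers of a common element \<open>t\<close>. As \<open>v\<close> is a non-trivial
  power of \<open>t\<close>, a homomorphism that vanishes at \<open>v\<close> vanishes at \<open>t\<close>.\<close>

lemma additive_on_centralizer:
  assumes "additive_on (free_group S) e" "g \<in> carrier (free_group S)" "v \<in> carrier (free_group S)"
    and "g \<otimes>\<^bsub>free_group S\<^esub> v = v \<otimes>\<^bsub>free_group S\<^esub> g" "v \<noteq> []" "e v = 0"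
  shows "e g = 0"
proof -
  interpret F: group "free_group S" by (rule group_free_group)
  obtain t i j where t: "t \<in> carrier (free_group S)" "g = t [^]\<^bsub>free_group S\<^esub> (i::int)" "v = t [^]\<^bsub>free_group S\<^esub> (j::int)"
    using free_group_commute[OF assms(2-4)] .
  have "j \<noteq> 0"
    using t(3) assms(5) by (auto simp: free_group_simps)
  then show ?thesis
    using assms(6) F.additive_int_pow[OF assms(1) t(1)] t by auto
qed

text \<open>For the exponent \<open>e\<close> of the infinite cyclic group this is the residue at \<open>0\<close> of the differential form
  \<open>g dh\<close>: for \<open>g = t ^ a\<close> and \<open>h = t ^ b\<close> the form \<open>b t ^ (a + b - 1) dt\<close> has residue \<open>b\<close> if
  \<open>a + b = 0\<close> and \<open>0\<close> otherwise. The values lie in the chains on a point so that the calculus of linear maps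
  on finitely supported functions applies.\<close>

definition log_form :: "('g \<Rightarrow> int) \<Rightarrow> (nat \<times> 'g list \<Rightarrow>\<^sub>0 complex) \<Rightarrow> (unit \<Rightarrow>\<^sub>0 complex)"
  where "log_form e = cextend (\<lambda>(p, gs). Poly_Mapping.single () (case gs of [g, h] \<Rightarrow>
    if p = 0 \<and> e g + e h = 0 then of_int (e h) else 0 | _ \<Rightarrow> 0))"

lemma linear_log_form: "linear_c (log_form e)"
  unfolding log_form_def by (rule linear_cextend)

lemma log_form_map: "log_form e (CC_map (map f) c) = log_form (\<lambda>x. e (f x)) c"
proof (rule linear_c_eqI[OF linear_c_compose[OF linear_log_form linear_CC_map] linear_log_form, where A = UNIV])
  fix z
  show "log_form e (CC_map (map f) (bas z)) = log_form (\<lambda>x. e (f x)) (bas z)"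
    by (cases z) (auto simp: log_form_def split: list.split)
qed simp

lemma CC_basis_1_cases:
  assumes "z \<in> CC_basis X (Suc 0)"
  obtains x where "z = (0, x)" "x \<in> cells X (Suc 0)" | x where "z = (Suc 0, x)" "x \<in> cells X 0"
  using assms by (cases z) (auto simp: le_Suc_eq)

lemma CC_basis_2_cases:
  assumes "z \<in> CC_basis X (Suc (Suc 0))"
  obtains x where "z = (0, x)" "x \<in> cells X (Suc (Suc 0))" | x where "z = (Suc 0, x)" "x \<in> cells X (Suc 0)"
    | x where "z = (Suc (Suc 0), x)" "x \<in> cells X 0"
  using assms by (cases z) (auto simp: le_Suc_eq)

context group
begin

text \<open>On a Hochschild boundary this is the Leibniz rule for \<open>d\<close>, and on the image of \<open>1 - t\<close> it says that the
  residue of the exact form \<open>g dh + h dg\<close> is zero.\<close>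

lemma log_form_bdry:
  assumes e: "additive_on G e" and c: "c \<in> supported (CC_basis (Ncy G) (Suc (Suc 0)))"
  shows "log_form e (bdry (CC (Ncy G)) (Suc (Suc 0)) c) = 0"
proof (rule linear_c_eq_on[OF linear_c_compose[OF linear_log_form linear_bdry_CC] linear_c_zero c])
  fix z assume "z \<in> CC_basis (Ncy G) (Suc (Suc 0))"
  then show "log_form e (bdry (CC (Ncy G)) (Suc (Suc 0)) (bas z)) = 0"
  proof (cases rule: CC_basis_2_cases)
    case (1 gs)
    then obtain g h k where gs: "gs = [g, h, k]" "g \<in> carrier G" "h \<in> carrier G" "k \<in> carrier G"
      by (auto simp: length_Suc_conv)
    have "log_form e (bdry (CC (Ncy G)) (Suc (Suc 0)) (bas z))
      = log_form e (bas (0, [g \<otimes> h, k])) - log_form e (bas (0, [g, h \<otimes> k])) + log_form e (bas (0, [k \<otimes> g, h]))"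
      by (simp add: 1 gs bdry_CC_bas cyclic_vert_def cyclic_horiz_def Ncy_def linear_c_simps[OF linear_log_form] single_uminus)
    also have "\<dots> = 0"
      using gs additive_mult[OF e] by (auto simp: log_form_def single_diff[symmetric] single_add[symmetric])
    finally show ?thesis .
  next
    case (2 gs)
    then obtain g h where gs: "gs = [g, h]" "g \<in> carrier G" "h \<in> carrier G"
      by (auto simp: length_Suc_conv)
    have "log_form e (bdry (CC (Ncy G)) (Suc (Suc 0)) (bas z))
      = - log_form e (bas (1, [g \<otimes> h])) + (log_form e (bas (0, [g, h])) + log_form e (bas (0, [h, g])))"
      by (simp add: 2 gs bdry_CC_bas cyclic_vert_def cyclic_horiz_def Ncy_def linear_c_simps[OF linear_log_form] single_uminus)
    also have "\<dots> = 0"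
      by (auto simp: log_form_def single_add[symmetric] eq_neg_iff_add_eq_0 simp flip: of_int_add)
    finally show ?thesis .
  next
    case (3 gs)
    then obtain g where "gs = [g]"
      by (auto simp: length_Suc_conv)
    then show ?thesis
      using 3 by (simp add: bdry_CC_bas cyclic_vert_def cyclic_horiz_def linear_c_simps[OF linear_log_form])
        (simp add: log_form_def)
  qed
qed

text \<open>The canonical homotopy at \<open>g\<close> is the image of a path \<open>v\<close> in the cylinder. On a string with objects
  \<open>p\<close>, \<open>q\<close> the transport changes the exponent of the second entry by \<open>e h\<close> if \<open>q\<close> is \<open>True\<close> and by
  \<open>- e h\<close> if \<open>p\<close> is \<open>True\<close>. The change of the residue is thus a function \<open>\<Theta>\<close> of the boundary of \<open>v\<close>, that
  is, of the two ends, whereas the residue of the projection of \<open>v\<close> is zero, as this projection is a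
  boundary.\<close>

lemma log_form_conj_homotopy:
  assumes e: "additive_on G e" and h: "h \<in> carrier G" and g: "g \<in> carrier G"
    and K: "canonical_conj_homotopy G h K"
  shows "log_form e (K 0 (bas (0, [g]))) = Poly_Mapping.single () (if e g = 0 then - of_int (e h) else 0)"
proof -
  interpret cylinder G
    by unfold_locales
  obtain L S where L: "chain_homotopy (CC X) (CC Y) (\<lambda>_. CC_map (\<lambda>gs. (gs, replicate (length gs) True)))
      (\<lambda>_. CC_map (\<lambda>gs. (gs, replicate (length gs) False))) L"
    and S: "chain_homotopy (suspension (CC X)) (CC X) (from_suspension (\<lambda>n. CC_map fst \<circ> L n)) (\<lambda>_ _. 0) S"
    and K: "K = (\<lambda>n. CC_map (conj_transport G h) \<circ> L n)"
    using K unfolding canonical_conj_homotopy_def null_homotopic_def by blast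
  let ?x = "bas (0, [g]) :: nat \<times> 'a list \<Rightarrow>\<^sub>0 complex"
  have x: "?x \<in> supported (CC_basis X 0)"
    using g by simp
  have linL: "linear_c (L k)" and linS: "linear_c (S k)" for k
    using L S by (simp_all add: chain_homotopy_def graded_map_def)
  define v where "v = L 0 ?x"
  have v: "v \<in> supported (CC_basis Y (Suc 0))"
  proof -
    have "L 0 ` supported (CC_basis X 0) \<subseteq> supported (CC_basis Y (0 + 1))"
      using L unfolding chain_homotopy_def graded_map_def chains_CC by blast
    then show ?thesis
      using x unfolding v_def by auto
  qed
  have bdry0: "bdry (CC X) 0 ?x = 0"
    by (rule X.bdry_zero[OF x])
  have "bdry (CC Y) (Suc 0) v = CC_map (\<lambda>gs. (gs, replicate (length gs) True)) ?x - CC_map (\<lambda>gs. (gs, replicate (length gs) False)) ?x"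
  proof -
    have "bdry (CC Y) (0 + 1) (L 0 ?x) + L (0 - 1) (bdry (CC X) 0 ?x)
        = CC_map (\<lambda>gs. (gs, replicate (length gs) True)) ?x - CC_map (\<lambda>gs. (gs, replicate (length gs) False)) ?x"
      using L x unfolding chain_homotopy_def chains_CC by blast
    then show ?thesis
      by (simp only: bdry0 linear_c_simps[OF linL] v_def) simp
  qed
  then have bdry_v: "bdry (CC Y) (Suc 0) v = bas (0, [g], [True]) - bas (0, [g], [False])"
    by simp
  have chain1: "?x \<in> chains (suspension (CC X)) (Suc 0)"
    using x by (simp add: suspension_def chains_CC)
  have S1: "S (Suc 0) ?x \<in> supported (CC_basis X (Suc (Suc 0)))"
  proof -
    have "S (Suc 0) ` chains (suspension (CC X)) (Suc 0) \<subseteq> supported (CC_basis X (Suc 0 + 1))"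
      using S unfolding chain_homotopy_def graded_map_def chains_CC[of X] by blast
    then show ?thesis
      using chain1 by auto
  qed
  have "bdry (CC X) (Suc 0 + 1) (S (Suc 0) ?x) + S (Suc 0 - 1) (bdry (suspension (CC X)) (Suc 0) ?x)
      = from_suspension (\<lambda>n. CC_map fst \<circ> L n) (Suc 0) ?x - 0"
    using S chain1 unfolding chain_homotopy_def by blast
  then have "CC_map fst v = bdry (CC X) (Suc (Suc 0)) (S (Suc 0) ?x)"
    by (simp add: suspension_def from_suspension_def v_def bdry0 linear_c_simps[OF linS])
  then have fst_v: "log_form e (CC_map fst v) = 0"
    using log_form_bdry[OF e S1] by simp
  \<comment> \<open>Of the objects of a string only the first enters, as a chain of degree zero has a single object.\<close>
  define \<Theta> where "\<Theta> = cextend (\<lambda>(p :: nat, gs, es). Poly_Mapping.single ()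
    (if e (hd gs) = 0 \<and> hd es then - of_int (e h) else (0 :: complex)))"
  have lin\<Theta>: "linear_c \<Theta>"
    unfolding \<Theta>_def by (rule linear_cextend)
  have "log_form e (CC_map (conj_transport G h) v) - log_form e (CC_map fst v) = \<Theta> (bdry (CC Y) (Suc 0) v)"
  proof (rule linear_c_eq_on[OF linear_c_sub[OF linear_c_compose[OF linear_log_form linear_CC_map]
          linear_c_compose[OF linear_log_form linear_CC_map]] linear_c_compose[OF lin\<Theta> linear_bdry_CC] v])
    fix z assume "z \<in> CC_basis Y (Suc 0)"
    then show "log_form e (CC_map (conj_transport G h) (bas z)) - log_form e (CC_map fst (bas z)) = \<Theta> (bdry (CC Y) (Suc 0) (bas z))"
    proof (cases rule: CC_basis_1_cases)
      case (1 y)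
      then obtain a b p q where y: "y = ([a, b], [p, q])" "a \<in> carrier G" "b \<in> carrier G"
        by (cases y) (auto simp: length_Suc_conv)
      have bdry: "bdry (CC Y) (Suc 0) (bas z) = bas (0, [a \<otimes> b], [p]) - bas (0, [b \<otimes> a], [q])"
        by (simp add: 1 y bdry_CC_bas cyclic_vert_def cyclic_horiz_def) (simp add: Ncy_def Ncy_interval_def single_uminus)
      have "conj_transport G h y = [(if p then h else \<one>) \<otimes> a \<otimes> inv (if q then h else \<one>), (if q then h else \<one>) \<otimes> b \<otimes> inv (if p then h else \<one>)]"
        by (simp add: y conj_transport_def)
      then show ?thesis
        unfolding bdry using y h additive_mult[OF e] additive_inv[OF e] additive_one[OF e]
        by (auto simp: 1 \<Theta>_def cextend_simps log_form_def single_diff[symmetric] single_uminus[symmetric])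
    next
      case (2 y)
      then obtain a p where y: "y = ([a], [p])"
        by (cases y) (auto simp: length_Suc_conv)
      show ?thesis
        by (simp add: 2 y bdry_CC_bas cyclic_vert_def cyclic_horiz_def linear_c_simps[OF lin\<Theta>] cyc_list_def)
          (simp add: log_form_def conj_transport_def)
    qed
  qed
  then show ?thesis
    unfolding fst_v bdry_v by (simp add: K v_def[symmetric] linear_c_simps[OF lin\<Theta>]) (simp add: \<Theta>_def)
qed

end

section \<open>Exponents of conjugating elements and of faces\<close>

lemma additive_on_free_group_zero:
  assumes e: "additive_on (free_group S) e" and gen: "\<And>a. a \<in> S \<Longrightarrow> e [(a, True)] = 0"
    and w: "w \<in> carrier (free_group S)"
  shows "e w = 0"
proof -
  interpret F: group "free_group S" by (rule group_free_group)
  show ?thesis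
    using w by (induction rule: free_group_induct)
      (simp_all add: gen F.additive_one[OF e] F.additive_inv[OF e] F.additive_mult[OF e])
qed

lemma (in group) conj_commute:
  assumes "b \<in> carrier G" "b' \<in> carrier G" "v \<in> carrier G" "b \<otimes> v \<otimes> inv b = b' \<otimes> v \<otimes> inv b'"
  shows "(b' \<otimes> inv b) \<otimes> (b \<otimes> v \<otimes> inv b) = (b \<otimes> v \<otimes> inv b) \<otimes> (b' \<otimes> inv b)"
proof -
  have cancel: "inv x \<otimes> (x \<otimes> y) = y" if "x \<in> carrier G" "y \<in> carrier G" for x y
    using that by (simp add: m_assoc[symmetric])
  have "(b' \<otimes> inv b) \<otimes> (b \<otimes> v \<otimes> inv b) = b' \<otimes> v \<otimes> inv b"
    using assms(1-3) by (simp add: m_assoc cancel)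
  also have "\<dots> = (b' \<otimes> v \<otimes> inv b') \<otimes> (b' \<otimes> inv b)"
    using assms(1-3) by (simp add: m_assoc cancel)
  finally show ?thesis
    by (simp add: assms(4))
qed

text \<open>The element \<open>b' b\<inverse>\<close> centralizes the common conjugate.\<close>

lemma additive_conjugators:
  assumes e: "additive_on (free_group S) e"
    and c: "b \<in> carrier (free_group S)" "b' \<in> carrier (free_group S)" "v \<in> carrier (free_group S)"
    and eq: "b \<otimes>\<^bsub>free_group S\<^esub> v \<otimes>\<^bsub>free_group S\<^esub> inv\<^bsub>free_group S\<^esub> b
      = b' \<otimes>\<^bsub>free_group S\<^esub> v \<otimes>\<^bsub>free_group S\<^esub> inv\<^bsub>free_group S\<^esub> b'"
    and v: "v \<noteq> []" "e v = 0"
  shows "e b = e b'"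
proof -
  interpret F: group "free_group S" by (rule group_free_group)
  let ?x = "b \<otimes>\<^bsub>free_group S\<^esub> v \<otimes>\<^bsub>free_group S\<^esub> inv\<^bsub>free_group S\<^esub> b"
  have one: "\<one>\<^bsub>free_group S\<^esub> = []"
    by (simp add: free_group_simps)
  have "?x \<noteq> \<one>\<^bsub>free_group S\<^esub>"
  proof
    assume "?x = \<one>\<^bsub>free_group S\<^esub>"
    also have "\<dots> = b \<otimes>\<^bsub>free_group S\<^esub> \<one>\<^bsub>free_group S\<^esub> \<otimes>\<^bsub>free_group S\<^esub> inv\<^bsub>free_group S\<^esub> b"
      using c(1) by simp
    finally have "v = \<one>\<^bsub>free_group S\<^esub>"
      by (rule F.conj_eq_iff[OF c(1,3) F.one_closed, THEN iffD1])
    then show False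
      using v(1) unfolding one by contradiction
  qed
  then have ne: "?x \<noteq> []"
    unfolding one .
  have ex: "e ?x = 0"
    using F.additive_conj[OF e c(1,3)] v(2) by simp
  have "e (b' \<otimes>\<^bsub>free_group S\<^esub> inv\<^bsub>free_group S\<^esub> b) = 0"
    by (rule additive_on_centralizer[OF e _ _ F.conj_commute[OF c eq] ne ex]) (use c in simp_all)
  then show ?thesis
    using c by (simp add: F.additive_mult[OF e] F.additive_inv[OF e])
qed

lemma alternating_double_sum_int:
  fixes f :: "nat \<Rightarrow> nat \<Rightarrow> int"
  assumes "\<And>i j. j < i \<Longrightarrow> i \<le> Suc n \<Longrightarrow> f i j = f j (i - 1)"
  shows "(\<Sum>i\<le>Suc n. \<Sum>j\<le>n. (- 1) ^ (i + j) * f i j) = 0"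
proof -
  have "(\<Sum>i\<le>Suc n. \<Sum>j\<le>n. cscale ((- 1) ^ (i + j)) (Poly_Mapping.single () (of_int (f i j)))) = 0"
    by (rule alternating_double_sum) (simp add: assms)
  then have "Poly_Mapping.lookup (\<Sum>i\<le>Suc n. \<Sum>j\<le>n. cscale ((- 1) ^ (i + j)) (Poly_Mapping.single () (of_int (f i j) :: complex))) () = 0"
    by simp
  then have "of_int (\<Sum>i\<le>Suc n. \<Sum>j\<le>n. (- 1) ^ (i + j) * f i j) = (0 :: complex)"
    by (simp add: lookup_sum lookup_single del: sum.atMost_Suc)
  then show ?thesis
    by (simp only: of_int_eq_0_iff)
qed

lemma delete_simps [simp]: "delete 0 (x # xs) = xs" "delete (Suc i) (x # xs) = x # delete i xs" "delete i [] = []"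
  by (simp_all add: delete_def)

lemma delete_append: "delete i (xs @ ys) = (if i < length xs then delete i xs @ ys else xs @ delete (i - length xs) ys)"
  by (auto simp: delete_def Suc_diff_le)

lemma nth_notin_delete:
  assumes "distinct xs" "k < length xs"
  shows "xs ! k \<notin> set (delete k xs)"
proof -
  have "xs = take k xs @ xs ! k # drop (Suc k) xs"
    using assms(2) by (rule id_take_nth_drop)
  with assms(1) have "distinct (take k xs @ xs ! k # drop (Suc k) xs)"
    by metis
  then show ?thesis
    by (auto simp: delete_def)
qed

definition face_exponent :: "nat \<Rightarrow> nat \<Rightarrow> nat list word \<Rightarrow> int"
  where "face_exponent m i w = exponent (Gamma_face m m i w)"

lemma exponent_simplex_image: "exponent (simplex_image m \<beta>) = (if set \<beta> = {..<m} then 1 else 0)"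
  by (simp add: simplex_image_def)

lemma additive_face_exponent: "0 < m \<Longrightarrow> i \<le> m \<Longrightarrow> additive_on (Gamma m m) (face_exponent m i)"
  using additive_comp[OF Gamma_face_hom[of m i m] additive_exponent[of "Gamma_gens m (m - 1)", folded Gamma_def]]
  by (simp add: face_exponent_def[abs_def])

text \<open>A generator of dimension \<open>m\<close> is the degeneracy \<open>s\<^sub>l\<close> of the fundamental one, for some \<open>l\<close>, and
  its faces other than those of index \<open>l\<close> and \<open>l + 1\<close> are trivial.\<close>

lemma face_exponent_generator:
  assumes m: "0 < m" and \<alpha>: "\<alpha> \<in> Gamma_gens m m"
  obtains l where "l < m" "\<And>i. i \<le> m \<Longrightarrow> face_exponent m i [(\<alpha>, True)] = (if i = l \<or> i = Suc l then 1 else 0)"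
proof -
  have \<alpha>': "length \<alpha> = Suc m" "sorted \<alpha>" "set \<alpha> = {..<m}"
    using \<alpha> by (auto simp: Gamma_gens_def)
  have "\<not> distinct \<alpha>"
    using \<alpha>' distinct_card[of \<alpha>] by auto
  then obtain us vs ws v where d: "\<alpha> = us @ [v] @ vs @ [v] @ ws"
    using not_distinct_decomp by blast
  have "set vs \<subseteq> {v}"
    using \<alpha>'(2) by (auto simp: d sorted_append intro: antisym)
  then have set: "set (us @ v # ws) = {..<m}"
    using \<alpha>'(3) by (auto simp: d)
  then have "m \<le> length (us @ v # ws)"
    using card_length[of "us @ v # ws"] by simp
  then have "length vs = 0"
    using \<alpha>'(1) unfolding d length_append list.size by linarith
  then have vs: "vs = []"
    by simp
  have len: "length (us @ v # ws) = m"
    using \<alpha>'(1) by (simp add: d vs)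
  have dist: "distinct (us @ v # ws)"
    using set len by (intro card_distinct) simp
  have del_neq: "set (delete k xs) \<noteq> set xs" if "distinct xs" "k < length xs" for k and xs :: "nat list"
    using nth_notin_delete[OF that] nth_mem[OF that(2)] by metis
  have faces: "set (delete i \<alpha>) = {..<m} \<longleftrightarrow> i = length us \<or> i = Suc (length us)" if "i \<le> m" for i
  proof -
    consider "i < length us" | "i = length us" | "i = Suc (length us)" | "Suc (length us) < i"
      by linarith
    then show ?thesis
    proof cases
      case 1
      then have "delete i (us @ v # ws) = delete i us @ v # ws" "set (delete i \<alpha>) = set (delete i us @ v # ws)"
        by (auto simp: d vs delete_append)
      then show ?thesis
        using del_neq[OF dist, of i] 1 set by auto
    next
      case 4
      then obtain k where k: "i = length us + Suc (Suc k)"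
        by (metis add_Suc_right less_imp_Suc_add add.commute add_Suc)
      then have "delete (length us + Suc k) (us @ v # ws) = us @ v # delete k ws" "set (delete i \<alpha>) = set (us @ v # delete k ws)"
        by (auto simp: d vs delete_append)
      then show ?thesis
        using del_neq[OF dist, of "length us + Suc k"] that len k set by auto
    qed (use set in \<open>auto simp: d vs delete_append\<close>)
  qed
  show ?thesis
  proof (rule that[of "length us"])
    show "length us < m"
      using len by simp
    show "face_exponent m i [(\<alpha>, True)] = (if i = length us \<or> i = Suc (length us) then 1 else 0)" if "i \<le> m" for i
      using Gamma_face_generator[OF m that \<alpha>] faces[OF that] by (simp add: face_exponent_def exponent_simplex_image)
  qed
qed

text \<open>The alternating sum of the faces of a degenerate simplex is zero: of the faces of \<open>s\<^sub>l\<close> only the two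
  equal and consecutive ones are non-trivial.\<close>

lemma sum_face_exponent:
  assumes m: "0 < m" and w: "w \<in> carrier (Gamma m m)"
  shows "(\<Sum>i\<le>m. (- 1) ^ i * face_exponent m i w) = 0"
proof (rule additive_on_free_group_zero[where S = "Gamma_gens m m"])
  show "w \<in> carrier (free_group (Gamma_gens m m))"
    using w by (simp add: Gamma_def)
  show "additive_on (free_group (Gamma_gens m m)) (\<lambda>w. \<Sum>i\<le>m. (- 1) ^ i * face_exponent m i w)"
    using additive_face_exponent[OF m] unfolding additive_on_def Gamma_def[symmetric]
    by (simp add: distrib_left sum.distrib)
  fix \<alpha> assume "\<alpha> \<in> Gamma_gens m m"
  then obtain l where l: "l < m" "\<And>i. i \<le> m \<Longrightarrow> face_exponent m i [(\<alpha>, True)] = (if i = l \<or> i = Suc l then 1 else 0)"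
    using face_exponent_generator[OF m] by blast
  have "(\<Sum>i\<le>m. (- 1) ^ i * face_exponent m i [(\<alpha>, True)]) = (\<Sum>i\<in>{l, Suc l}. (- 1) ^ i)"
    using l by (intro sum.mono_neutral_cong_right) auto
  then show "(\<Sum>i\<le>m. (- 1) ^ i * face_exponent m i [(\<alpha>, True)]) = 0"
    by simp
qed

section \<open>A cycle with conjugate faces\<close>

locale toda =
  fixes m :: nat and r :: "nat \<Rightarrow> nat list word set \<Rightarrow> nat list word"
  assumes m: "2 \<le> m" and r: "class_reps m r"
begin

abbreviation "\<Gamma> \<equiv> Gamma m m"
abbreviation "\<Gamma>' \<equiv> Gamma m (Suc m)"
abbreviation "d \<equiv> Gamma_face m (Suc m)"
abbreviation "\<epsilon> \<equiv> face_exponent m"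

sublocale \<Gamma>: group \<Gamma>
  by (rule group_Gamma)

sublocale \<Gamma>': group \<Gamma>'
  by (rule group_Gamma)

text \<open>These are the surjections that repeat only the values \<open>0\<close> and \<open>1\<close>. A face deletes one value of the list, so
  \<open>X\<close> has the non-trivial face \<open>x\<close>, \<open>Z\<close> has \<open>y\<close>, and \<open>Y\<close> has both, which is what makes the faces of
  \<open>X\<inverse> Y Z\<close> and \<open>X\<inverse> Z Y\<close> degenerate to conjugate words.\<close>

abbreviation "x \<equiv> [(0 # Suc 0 # Suc 0 # [2..<m], True)]"
abbreviation "y \<equiv> [(0 # 0 # Suc 0 # [2..<m], True)]"
abbreviation "X \<equiv> [(0 # Suc 0 # Suc 0 # Suc 0 # [2..<m], True)]"
abbreviation "Y \<equiv> [(0 # 0 # Suc 0 # Suc 0 # [2..<m], True)]"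
abbreviation "Z \<equiv> [(0 # 0 # 0 # Suc 0 # [2..<m], True)]"

lemma insert_interval: "insert 0 (insert (Suc 0) {2..<m}) = {..<m}"
  using m by auto

lemma gens: "x \<in> carrier \<Gamma>" "y \<in> carrier \<Gamma>" "X \<in> carrier \<Gamma>'" "Y \<in> carrier \<Gamma>'" "Z \<in> carrier \<Gamma>'"
  and gens': "0 # Suc 0 # Suc 0 # [2..<m] \<in> Gamma_gens m m" "0 # 0 # Suc 0 # [2..<m] \<in> Gamma_gens m m"
    "0 # Suc 0 # Suc 0 # Suc 0 # [2..<m] \<in> Gamma_gens m (Suc m)" "0 # 0 # Suc 0 # Suc 0 # [2..<m] \<in> Gamma_gens m (Suc m)"
    "0 # 0 # 0 # Suc 0 # [2..<m] \<in> Gamma_gens m (Suc m)"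
proof -
  show "0 # Suc 0 # Suc 0 # [2..<m] \<in> Gamma_gens m m" "0 # 0 # Suc 0 # [2..<m] \<in> Gamma_gens m m"
    "0 # Suc 0 # Suc 0 # Suc 0 # [2..<m] \<in> Gamma_gens m (Suc m)" "0 # 0 # Suc 0 # Suc 0 # [2..<m] \<in> Gamma_gens m (Suc m)"
    "0 # 0 # 0 # Suc 0 # [2..<m] \<in> Gamma_gens m (Suc m)"
    using m by (auto simp: Gamma_gens_def insert_interval)
  then show "x \<in> carrier \<Gamma>" "y \<in> carrier \<Gamma>" "X \<in> carrier \<Gamma>'" "Y \<in> carrier \<Gamma>'" "Z \<in> carrier \<Gamma>'"
    by (simp_all add: Gamma_def letter_in_free_group)
qed

lemma not_in_delete: "k < m - 2 \<Longrightarrow> Suc (Suc k) \<notin> set (delete k [2..<m])"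
  using nth_notin_delete[of "[2..<m]" k] by simp

text \<open>Deleting a value that occurs only once destroys surjectivity; the words are non-repeating beyond the values
  \<open>0\<close> and \<open>1\<close>.\<close>

lemma image_outer:
  assumes "k < m - 2" "set as \<subseteq> {..<2}"
  shows "simplex_image m (as @ delete k [2..<m]) = []"
proof -
  have "Suc (Suc k) \<notin> set (as @ delete k [2..<m])"
    using not_in_delete[OF assms(1)] assms(2) by auto
  moreover have "Suc (Suc k) \<in> {..<m}"
    using assms(1) by simp
  ultimately have "set (as @ delete k [2..<m]) \<noteq> {..<m}"
    by metis
  then show ?thesis
    by (simp only: simplex_image_def if_False)
qed

lemma image_outer3: "k < m - 2 \<Longrightarrow> a < 2 \<Longrightarrow> b < 2 \<Longrightarrow> c < 2 \<Longrightarrow> simplex_image m (a # b # c # delete k [2..<m]) = []"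
  and image_outer4: "k < m - 2 \<Longrightarrow> a < 2 \<Longrightarrow> b < 2 \<Longrightarrow> c < 2 \<Longrightarrow> e < 2 \<Longrightarrow>
    simplex_image m (a # b # c # e # delete k [2..<m]) = []"
proof -
  assume "k < m - 2" "a < 2" "b < 2" "c < 2"
  then show "simplex_image m (a # b # c # delete k [2..<m]) = []"
    using image_outer[of k "[a, b, c]"] by auto
next
  assume "k < m - 2" "a < 2" "b < 2" "c < 2" "e < 2"
  then show "simplex_image m (a # b # c # e # delete k [2..<m]) = []"
    using image_outer[of k "[a, b, c, e]"] by auto
qed

lemma index_cases:
  assumes "j \<le> Suc m"
  obtains "j = 0" | "j = Suc 0" | "j = Suc (Suc 0)" | "j = Suc (Suc (Suc 0))"
    | k where "j = Suc (Suc (Suc (Suc k)))" "k < m - 2"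
proof -
  show ?thesis
  proof (cases "j < 4")
    case True
    then have "j = 0 \<or> j = Suc 0 \<or> j = Suc (Suc 0) \<or> j = Suc (Suc (Suc 0))"
      by linarith
    then show ?thesis
      by (elim disjE) (erule that)+
  next
    case False
    then obtain k where "j = 4 + k"
      using le_Suc_ex not_less by blast
    then show ?thesis
      using that(5)[of k] assms by simp
  qed
qed

lemma image_full: "simplex_image m (0 # Suc 0 # Suc 0 # [2..<m]) = x" "simplex_image m (0 # 0 # Suc 0 # [2..<m]) = y"
  "simplex_image m (Suc 0 # Suc 0 # Suc 0 # [2..<m]) = []" "simplex_image m (0 # 0 # 0 # [2..<m]) = []"
proof -
  have "0 \<notin> set (Suc 0 # Suc 0 # Suc 0 # [2..<m])" "0 \<in> {..<m}" "Suc 0 \<notin> set (0 # 0 # 0 # [2..<m])" "Suc 0 \<in> {..<m}"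
    using m by auto
  then have n: "set (Suc 0 # Suc 0 # Suc 0 # [2..<m]) \<noteq> {..<m}" "set (0 # 0 # 0 # [2..<m]) \<noteq> {..<m}"
    by metis+
  have f: "set (0 # Suc 0 # Suc 0 # [2..<m]) = {..<m}" "set (0 # 0 # Suc 0 # [2..<m]) = {..<m}"
    using insert_interval m by (simp_all add: insert_absorb)
  show "simplex_image m (0 # Suc 0 # Suc 0 # [2..<m]) = x" "simplex_image m (0 # 0 # Suc 0 # [2..<m]) = y"
    "simplex_image m (Suc 0 # Suc 0 # Suc 0 # [2..<m]) = []" "simplex_image m (0 # 0 # 0 # [2..<m]) = []"
    unfolding simplex_image_def n[THEN if_not_P] f by simp_all
qed

lemma face_generator: "j \<le> Suc m \<Longrightarrow> \<alpha> \<in> Gamma_gens m (Suc m) \<Longrightarrow> d j [(\<alpha>, True)] = simplex_image m (delete j \<alpha>)"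
  by (rule Gamma_face_generator) simp_all

lemma face_gens:
  assumes "j \<le> Suc m"
  shows "d j X = (if 1 \<le> j \<and> j \<le> 3 then x else [])" "d j Y = (if j \<le> 1 then x else if j \<le> 3 then y else [])"
    "d j Z = (if j \<le> 2 then y else [])"
proof -
  from assms have "d j X = (if 1 \<le> j \<and> j \<le> 3 then x else []) \<and> d j Y = (if j \<le> 1 then x else if j \<le> 3 then y else []) \<and>
    d j Z = (if j \<le> 2 then y else [])"
    unfolding face_generator[OF assms gens'(3)] face_generator[OF assms gens'(4)] face_generator[OF assms gens'(5)]
    by (cases rule: index_cases) (simp_all add: image_full image_outer4)
  then show "d j X = (if 1 \<le> j \<and> j \<le> 3 then x else [])" "d j Y = (if j \<le> 1 then x else if j \<le> 3 then y else [])"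
    "d j Z = (if j \<le> 2 then y else [])"
    by blast+
qed

lemma exponent_gens:
  assumes "i \<le> m"
  shows "\<epsilon> i x = (if i = 1 \<or> i = 2 then 1 else 0)" "\<epsilon> i y = (if i \<le> 1 then 1 else 0)"
proof -
  have n: "set (Suc 0 # Suc 0 # [2..<m]) \<noteq> {..<m}" "set (0 # 0 # [2..<m]) \<noteq> {..<m}"
  proof -
    have "0 \<notin> set (Suc 0 # Suc 0 # [2..<m])" "0 \<in> {..<m}" "Suc 0 \<notin> set (0 # 0 # [2..<m])" "Suc 0 \<in> {..<m}"
      using m by auto
    then show "set (Suc 0 # Suc 0 # [2..<m]) \<noteq> {..<m}" "set (0 # 0 # [2..<m]) \<noteq> {..<m}"
      by metis+
  qed
  have f: "set (0 # Suc 0 # [2..<m]) = {..<m}"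
    using insert_interval by simp
  have im: "simplex_image m (Suc 0 # Suc 0 # [2..<m]) = []" "simplex_image m (0 # 0 # [2..<m]) = []"
    "exponent (simplex_image m (0 # Suc 0 # [2..<m])) = 1"
    unfolding simplex_image_def n[THEN if_not_P] f by simp_all
  have g: "\<epsilon> i [(\<alpha>, True)] = exponent (simplex_image m (delete i \<alpha>))" if "\<alpha> \<in> Gamma_gens m m" for \<alpha>
    using Gamma_face_generator[OF _ assms that] m by (simp add: face_exponent_def)
  from assms have "Suc i \<le> Suc m"
    by simp
  then have "\<epsilon> i x = (if i = 1 \<or> i = 2 then 1 else 0) \<and> \<epsilon> i y = (if i \<le> 1 then 1 else 0)"
    unfolding g[OF gens'(1)] g[OF gens'(2)]
    by (cases rule: index_cases) (simp_all add: im image_outer3)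
  then show "\<epsilon> i x = (if i = 1 \<or> i = 2 then 1 else 0)" "\<epsilon> i y = (if i \<le> 1 then 1 else 0)"
    by blast+
qed

end

text \<open>The element \<open>y\<close> itself belongs to the canonical centralizer, so a conjugator in particular carries the
  representative to the representative.\<close>

lemma conjugator_twist:
  assumes r: "class_reps m r" and n: "0 < n" "i \<le> n" and c: "c \<in> conj_classes (Gamma m n)"
    and h: "conjugator m r n i c h"
  shows "h \<in> carrier (Gamma m (n - 1)) \<and> r (n - 1) (class_map (Gamma m (n - 1)) (Gamma_face m n i) c)
    = h \<otimes>\<^bsub>Gamma m (n - 1)\<^esub> Gamma_face m n i (r n c) \<otimes>\<^bsub>Gamma m (n - 1)\<^esub> inv\<^bsub>Gamma m (n - 1)\<^esub> h"
proof -
  interpret free_class_hom "Gamma_gens m n" "Gamma m n" c "Gamma_gens m (n - 1)" "Gamma m (n - 1)" "Gamma_face m n i"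
    by (rule free_class_homI[OF Gamma_def c Gamma_def Gamma_face_hom[OF n]])
  have rc: "r n c \<in> c" "r (n - 1) c' \<in> c'"
    using r c c'_class by (auto simp: class_reps_def)
  have "class_centralizer_map (Gamma m (n - 1)) (Gamma_face m n i) c (\<lambda>y\<in>c. y) (r (n - 1) c')
    = h \<otimes>\<^bsub>Gamma m (n - 1)\<^esub> Gamma_face m n i ((\<lambda>y\<in>c. y) (r n c)) \<otimes>\<^bsub>Gamma m (n - 1)\<^esub> inv\<^bsub>Gamma m (n - 1)\<^esub> h"
    using h twist_in_R unfolding conjugator_def by blast
  then show ?thesis
    using h rc unfolding induced_twist by (simp add: conjugator_def)
qed

context toda
begin

definition w :: "nat list word" where "w = inv\<^bsub>\<Gamma>'\<^esub> X \<otimes>\<^bsub>\<Gamma>'\<^esub> Y \<otimes>\<^bsub>\<Gamma>'\<^esub> Z"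
definition w' :: "nat list word" where "w' = inv\<^bsub>\<Gamma>'\<^esub> X \<otimes>\<^bsub>\<Gamma>'\<^esub> Z \<otimes>\<^bsub>\<Gamma>'\<^esub> Y"

abbreviation "c \<equiv> conj_class \<Gamma>' w"
abbreviation "c' \<equiv> conj_class \<Gamma>' w'"

definition h :: "nat \<Rightarrow> nat list word" where "h j = (if j \<le> 1 then inv\<^bsub>\<Gamma>\<^esub> x else \<one>\<^bsub>\<Gamma>\<^esub>)"

lemma w_closed: "w \<in> carrier \<Gamma>'" "w' \<in> carrier \<Gamma>'"
  using gens by (simp_all add: w_def w'_def)

lemma h_closed: "h j \<in> carrier \<Gamma>"
  using gens by (simp add: h_def)

lemma classes: "c \<in> conj_classes \<Gamma>'" "c' \<in> conj_classes \<Gamma>'"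
  using w_closed by (auto intro: \<Gamma>'.conj_class_in_conj_classes)

lemma d_hom: "j \<le> Suc m \<Longrightarrow> d j \<in> hom \<Gamma>' \<Gamma>"
  using Gamma_face_hom[of "Suc m" j m] by simp

lemma d_closed: "j \<le> Suc m \<Longrightarrow> g \<in> carrier \<Gamma>' \<Longrightarrow> d j g \<in> carrier \<Gamma>"
  using d_hom by (auto simp: hom_def)

lemma d_group_hom: "j \<le> Suc m \<Longrightarrow> group_hom \<Gamma>' \<Gamma> (d j)"
  using d_hom by (simp add: group_hom_def group_hom_axioms_def \<Gamma>.is_group \<Gamma>'.is_group)

lemma one_Nil: "[] = \<one>\<^bsub>\<Gamma>\<^esub>"
  by (simp add: Gamma_def free_group_simps)

text \<open>The zeroth face kills \<open>X\<close> and leaves the conjugate words \<open>x y\<close> and \<open>y x\<close>. The first one identifies \<open>X\<close>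
  and \<open>Y\<close> and leaves \<open>y\<close> and \<open>x\<inverse> y x\<close>. The second identifies \<open>Y\<close> and \<open>Z\<close>, and the others kill \<open>Z\<close>, so
  from then on the two faces agree.\<close>

lemma d_w:
  assumes "j \<le> Suc m"
  shows "d j w = (if j = 0 then x \<otimes>\<^bsub>\<Gamma>\<^esub> y else if j = 1 then y else if j = 2 then inv\<^bsub>\<Gamma>\<^esub> x \<otimes>\<^bsub>\<Gamma>\<^esub> y \<otimes>\<^bsub>\<Gamma>\<^esub> y
    else if j = 3 then inv\<^bsub>\<Gamma>\<^esub> x \<otimes>\<^bsub>\<Gamma>\<^esub> y else \<one>\<^bsub>\<Gamma>\<^esub>)"
    and "d j w' = h j \<otimes>\<^bsub>\<Gamma>\<^esub> d j w \<otimes>\<^bsub>\<Gamma>\<^esub> inv\<^bsub>\<Gamma>\<^esub> h j"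
proof -
  interpret d: group_hom \<Gamma>' \<Gamma> "d j"
    by (rule d_group_hom[OF assms])
  have cancel: "inv\<^bsub>\<Gamma>\<^esub> x \<otimes>\<^bsub>\<Gamma>\<^esub> (x \<otimes>\<^bsub>\<Gamma>\<^esub> g) = g" if "g \<in> carrier \<Gamma>" for g
    using gens(1) that by (simp add: \<Gamma>.m_assoc[symmetric])
  have w: "d j w = inv\<^bsub>\<Gamma>\<^esub> d j X \<otimes>\<^bsub>\<Gamma>\<^esub> d j Y \<otimes>\<^bsub>\<Gamma>\<^esub> d j Z" "d j w' = inv\<^bsub>\<Gamma>\<^esub> d j X \<otimes>\<^bsub>\<Gamma>\<^esub> d j Z \<otimes>\<^bsub>\<Gamma>\<^esub> d j Y"
    using gens by (simp_all add: w_def w'_def)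
  have f: "d j X = (if 1 \<le> j \<and> j \<le> 3 then x else \<one>\<^bsub>\<Gamma>\<^esub>)" "d j Y = (if j \<le> 1 then x else if j \<le> 3 then y else \<one>\<^bsub>\<Gamma>\<^esub>)"
    "d j Z = (if j \<le> 2 then y else \<one>\<^bsub>\<Gamma>\<^esub>)"
    using face_gens[OF assms] by (simp_all only: one_Nil)
  consider "j = 0" | "j = 1" | "j = 2" | "j = 3" | "3 < j"
    by linarith
  then show "d j w = (if j = 0 then x \<otimes>\<^bsub>\<Gamma>\<^esub> y else if j = 1 then y else if j = 2 then inv\<^bsub>\<Gamma>\<^esub> x \<otimes>\<^bsub>\<Gamma>\<^esub> y \<otimes>\<^bsub>\<Gamma>\<^esub> y
    else if j = 3 then inv\<^bsub>\<Gamma>\<^esub> x \<otimes>\<^bsub>\<Gamma>\<^esub> y else \<one>\<^bsub>\<Gamma>\<^esub>)"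
    unfolding w f by cases (use gens in simp_all)
  have "j = 0 \<or> j = 1 \<or> j = 2 \<or> j = 3 \<or> 3 < j"
    by linarith
  then show "d j w' = h j \<otimes>\<^bsub>\<Gamma>\<^esub> d j w \<otimes>\<^bsub>\<Gamma>\<^esub> inv\<^bsub>\<Gamma>\<^esub> h j"
    unfolding w f h_def by (elim disjE) (use gens cancel in \<open>simp_all add: \<Gamma>.m_assoc\<close>)
qed

lemma class_map_eq: "j \<le> Suc m \<Longrightarrow> class_map \<Gamma> (d j) c = conj_class \<Gamma> (d j w)"
  "j \<le> Suc m \<Longrightarrow> class_map \<Gamma> (d j) c' = conj_class \<Gamma> (d j w')"
  using class_map_eq[OF \<Gamma>'.is_group \<Gamma>.is_group d_hom classes(1) \<Gamma>'.conj_class_self[OF w_closed(1)]]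
    class_map_eq[OF \<Gamma>'.is_group \<Gamma>.is_group d_hom classes(2) \<Gamma>'.conj_class_self[OF w_closed(2)]] by simp_all

lemma same_faces:
  assumes "j \<le> Suc m"
  shows "class_map \<Gamma> (d j) c' = class_map \<Gamma> (d j) c"
proof -
  have "d j w' \<in> conj_class \<Gamma> (d j w)"
    using \<Gamma>.conj_class_iff[OF d_closed[OF assms w_closed(1)], of "d j w'"] d_w(2)[OF assms] h_closed by blast
  then show ?thesis
    unfolding class_map_eq[OF assms] by (rule \<Gamma>.conj_class_eq(2)[OF d_closed[OF assms w_closed(1)]])
qed

definition z :: "cbasis \<Rightarrow>\<^sub>0 complex"
  where "z = bas (0, c, []) - bas (0, c', [])"

lemma z_supported: "z \<in> supported (C_basis m (Suc m) 0)"
  unfolding z_def using classes by (intro supported_diff) simp_all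

lemma C_diff_z: "C_diff m (Suc m) z = 0"
proof -
  have "C_face m (Suc m) j z = 0" if "j \<le> Suc m" for j
    unfolding C_face_def z_def linear_c_simps[OF linear_CC_map]
    using same_faces[OF that] by (simp add: centralizer_nerve_map_def)
  then show ?thesis
    by (simp add: C_diff_def)
qed

lemma additive_\<epsilon>: "i \<le> m \<Longrightarrow> additive_on \<Gamma> (\<epsilon> i)"
  using additive_face_exponent[of m i] m by simp

text \<open>These are the simplicial identities, in the form required by the pairwise cancellation in alternating
  double sums.\<close>

lemma \<epsilon>_d_commute:
  assumes "j < k" "k \<le> Suc m" "g \<in> carrier \<Gamma>'"
  shows "\<epsilon> j (d k g) = \<epsilon> (k - 1) (d j g)"
  using Gamma_face_face[of "Suc m" j k g m] assms m by (simp add: face_exponent_def)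

section \<open>The residue of the bracket\<close>

text \<open>Both \<open>k a\<close> and \<open>k' a' h\<close>, with the appropriate faces of \<open>a\<close> and \<open>a'\<close>, conjugate \<open>d j w\<close> to the chosen
  representative of its class, so \<open>\<epsilon> i\<close> takes the same value at both.\<close>

lemma conjugator_difference:
  assumes j: "j \<le> Suc m" and k: "conjugator m r (Suc m) j c k" and k': "conjugator m r (Suc m) j c' k'"
    and a: "a \<in> carrier \<Gamma>'" "r (Suc m) c = a \<otimes>\<^bsub>\<Gamma>'\<^esub> w \<otimes>\<^bsub>\<Gamma>'\<^esub> inv\<^bsub>\<Gamma>'\<^esub> a"
    and a': "a' \<in> carrier \<Gamma>'" "r (Suc m) c' = a' \<otimes>\<^bsub>\<Gamma>'\<^esub> w' \<otimes>\<^bsub>\<Gamma>'\<^esub> inv\<^bsub>\<Gamma>'\<^esub> a'"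
    and i: "i \<le> m" "\<epsilon> i (d j w) = 0" and ne: "d j w \<noteq> []"
  shows "\<epsilon> i k - \<epsilon> i k' = \<epsilon> i (h j) - \<epsilon> i (d j a) + \<epsilon> i (d j a')"
proof -
  note tw = conjugator_twist[OF r, of "Suc m" j, simplified, OF j]
  have kc: "k \<in> carrier \<Gamma>" "k' \<in> carrier \<Gamma>"
    using tw[OF classes(1) k] tw[OF classes(2) k'] by simp_all
  have "k \<otimes>\<^bsub>\<Gamma>\<^esub> d j (r (Suc m) c) \<otimes>\<^bsub>\<Gamma>\<^esub> inv\<^bsub>\<Gamma>\<^esub> k = k' \<otimes>\<^bsub>\<Gamma>\<^esub> d j (r (Suc m) c') \<otimes>\<^bsub>\<Gamma>\<^esub> inv\<^bsub>\<Gamma>\<^esub> k'"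
    using tw[OF classes(1) k] tw[OF classes(2) k'] same_faces[OF j] by simp
  interpret dj: group_hom \<Gamma>' \<Gamma> "d j"
    by (rule d_group_hom[OF j])
  note cl = d_closed[OF j w_closed(1)] d_closed[OF j a(1)] d_closed[OF j a'(1)] h_closed[of j]
  have da: "d j (r (Suc m) c) = d j a \<otimes>\<^bsub>\<Gamma>\<^esub> d j w \<otimes>\<^bsub>\<Gamma>\<^esub> inv\<^bsub>\<Gamma>\<^esub> d j a"
    "d j (r (Suc m) c') = d j a' \<otimes>\<^bsub>\<Gamma>\<^esub> (h j \<otimes>\<^bsub>\<Gamma>\<^esub> d j w \<otimes>\<^bsub>\<Gamma>\<^esub> inv\<^bsub>\<Gamma>\<^esub> h j) \<otimes>\<^bsub>\<Gamma>\<^esub> inv\<^bsub>\<Gamma>\<^esub> d j a'"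
    using a a' w_closed d_w(2)[OF j] by simp_all
  have conj_conj: "u \<otimes>\<^bsub>\<Gamma>\<^esub> (v \<otimes>\<^bsub>\<Gamma>\<^esub> g \<otimes>\<^bsub>\<Gamma>\<^esub> inv\<^bsub>\<Gamma>\<^esub> v) \<otimes>\<^bsub>\<Gamma>\<^esub> inv\<^bsub>\<Gamma>\<^esub> u
    = (u \<otimes>\<^bsub>\<Gamma>\<^esub> v) \<otimes>\<^bsub>\<Gamma>\<^esub> g \<otimes>\<^bsub>\<Gamma>\<^esub> inv\<^bsub>\<Gamma>\<^esub> (u \<otimes>\<^bsub>\<Gamma>\<^esub> v)"
    if "u \<in> carrier \<Gamma>" "v \<in> carrier \<Gamma>" "g \<in> carrier \<Gamma>" for u v g
    using that by (simp add: \<Gamma>.inv_mult_group \<Gamma>.m_assoc)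
  let ?b = "k \<otimes>\<^bsub>\<Gamma>\<^esub> d j a" and ?b' = "k' \<otimes>\<^bsub>\<Gamma>\<^esub> d j a' \<otimes>\<^bsub>\<Gamma>\<^esub> h j"
  have eq: "?b \<otimes>\<^bsub>\<Gamma>\<^esub> d j w \<otimes>\<^bsub>\<Gamma>\<^esub> inv\<^bsub>\<Gamma>\<^esub> ?b = ?b' \<otimes>\<^bsub>\<Gamma>\<^esub> d j w \<otimes>\<^bsub>\<Gamma>\<^esub> inv\<^bsub>\<Gamma>\<^esub> ?b'"
    using \<open>k \<otimes>\<^bsub>\<Gamma>\<^esub> d j (r (Suc m) c) \<otimes>\<^bsub>\<Gamma>\<^esub> inv\<^bsub>\<Gamma>\<^esub> k = k' \<otimes>\<^bsub>\<Gamma>\<^esub> d j (r (Suc m) c') \<otimes>\<^bsub>\<Gamma>\<^esub> inv\<^bsub>\<Gamma>\<^esub> k'\<close> cl kc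
    unfolding da by (simp only: conj_conj \<Gamma>.m_closed \<Gamma>.inv_closed \<Gamma>.m_assoc[OF kc(2) cl(3) cl(4)])
  have bc: "?b \<in> carrier \<Gamma>" "?b' \<in> carrier \<Gamma>"
    using cl kc by simp_all
  have "\<epsilon> i ?b = \<epsilon> i ?b'"
    by (rule additive_conjugators[where S = "Gamma_gens m m", folded Gamma_def, OF additive_\<epsilon>[OF i(1)] bc cl(1) eq ne i(2)])
  then show ?thesis
    using cl kc by (simp add: \<Gamma>.additive_mult[OF additive_\<epsilon>[OF i(1)]])
qed

text \<open>If \<open>d j w\<close> is trivial, its conjugators are arbitrary, but then all the exponents \<open>\<epsilon> i (d j w)\<close> are zero
  and both sides are full alternating sums, which vanish separately.\<close>

lemma conjugator_difference_sum:
  assumes j: "j \<le> Suc m" and k: "conjugator m r (Suc m) j c k" and k': "conjugator m r (Suc m) j c' k'"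
    and a: "a \<in> carrier \<Gamma>'" "r (Suc m) c = a \<otimes>\<^bsub>\<Gamma>'\<^esub> w \<otimes>\<^bsub>\<Gamma>'\<^esub> inv\<^bsub>\<Gamma>'\<^esub> a"
    and a': "a' \<in> carrier \<Gamma>'" "r (Suc m) c' = a' \<otimes>\<^bsub>\<Gamma>'\<^esub> w' \<otimes>\<^bsub>\<Gamma>'\<^esub> inv\<^bsub>\<Gamma>'\<^esub> a'"
  shows "(\<Sum>i\<le>m. (- 1) ^ i * (if \<epsilon> i (d j w) = 0 then \<epsilon> i k - \<epsilon> i k' else 0))
    = (\<Sum>i\<le>m. (- 1) ^ i * (if \<epsilon> i (d j w) = 0 then \<epsilon> i (h j) - \<epsilon> i (d j a) + \<epsilon> i (d j a') else 0))"
proof (cases "d j w = []")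
  case False
  then show ?thesis
    using conjugator_difference[OF assms] by (intro sum.cong) auto
next
  case True
  have kc: "k \<in> carrier \<Gamma>" "k' \<in> carrier \<Gamma>"
    using k k' by (simp_all add: conjugator_def)
  have zero: "\<epsilon> i (d j w) = 0" if "i \<le> m" for i
    unfolding True one_Nil by (rule \<Gamma>.additive_one[OF additive_\<epsilon>[OF that]])
  have "0 < m"
    using m by simp
  note sum0 = sum_face_exponent[OF this]
  have "(\<Sum>i\<le>m. (- 1) ^ i * (if \<epsilon> i (d j w) = 0 then \<epsilon> i k - \<epsilon> i k' else 0))
      = (\<Sum>i\<le>m. (- 1) ^ i * \<epsilon> i k - (- 1) ^ i * \<epsilon> i k')"
    using zero by (intro sum.cong) (auto simp: right_diff_distrib)
  also have "\<dots> = 0"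
    using sum0[OF kc(1)] sum0[OF kc(2)] by (simp add: sum_subtractf)
  also have "\<dots> = (\<Sum>i\<le>m. (- 1) ^ i * \<epsilon> i (h j) - (- 1) ^ i * \<epsilon> i (d j a) + (- 1) ^ i * \<epsilon> i (d j a'))"
    using sum0[OF h_closed] sum0[OF d_closed[OF j a(1)]] sum0[OF d_closed[OF j a'(1)]]
    by (simp add: sum.distrib sum_subtractf)
  also have "\<dots> = (\<Sum>i\<le>m. (- 1) ^ i * (if \<epsilon> i (d j w) = 0 then \<epsilon> i (h j) - \<epsilon> i (d j a) + \<epsilon> i (d j a') else 0))"
    using zero by (intro sum.cong) (auto simp: right_diff_distrib distrib_left)
  finally show ?thesis .
qed

text \<open>The condition and the summand are both built from iterated faces, so the terms cancel in pairs by the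
  simplicial identities.\<close>

lemma gauge_sum:
  assumes a: "a \<in> carrier \<Gamma>'"
  shows "(\<Sum>j\<le>Suc m. (- 1) ^ j * (\<Sum>i\<le>m. (- 1) ^ i * (if \<epsilon> i (d j w) = 0 then \<epsilon> i (d j a) else 0))) = 0"
proof -
  have "(\<Sum>j\<le>Suc m. \<Sum>i\<le>m. (- 1) ^ (j + i) * (if \<epsilon> i (d j w) = 0 then \<epsilon> i (d j a) else 0)) = 0"
    by (rule alternating_double_sum_int) (simp add: \<epsilon>_d_commute w_closed a)
  then show ?thesis
    by (simp add: sum_distrib_left power_add mult.assoc del: sum.atMost_Suc)
qed

text \<open>Only \<open>h 0\<close> and \<open>h 1\<close> are non-trivial, and only the indices \<open>i = 1\<close>, \<open>2\<close> see them. The exponents of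
  \<open>d 0 w = x y\<close> at these indices are \<open>2\<close> and \<open>1\<close>, those of \<open>d 1 w = y\<close> are \<open>1\<close> and \<open>0\<close>, so the single
  contribution comes from \<open>j = 1\<close>, \<open>i = 2\<close>.\<close>

lemma holonomy_sum:
  "(\<Sum>j\<le>Suc m. (- 1) ^ j * (\<Sum>i\<le>m. (- 1) ^ i * (if \<epsilon> i (d j w) = 0 then \<epsilon> i (h j) else 0))) = 1"
proof -
  let ?A = "\<lambda>j. \<Sum>i\<le>m. (- 1) ^ i * (if \<epsilon> i (d j w) = 0 then \<epsilon> i (h j) else 0)"
  have e: "\<epsilon> i (inv\<^bsub>\<Gamma>\<^esub> x) = - \<epsilon> i x" "\<epsilon> i (x \<otimes>\<^bsub>\<Gamma>\<^esub> y) = \<epsilon> i x + \<epsilon> i y" "\<epsilon> i \<one>\<^bsub>\<Gamma>\<^esub> = 0" if "i \<le> m" for i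
    using gens additive_\<epsilon>[OF that] by (simp_all add: \<Gamma>.additive_inv \<Gamma>.additive_mult \<Gamma>.additive_one)
  have d01: "d 0 w = x \<otimes>\<^bsub>\<Gamma>\<^esub> y" "d (Suc 0) w = y"
    using d_w(1)[of 0] d_w(1)[of "Suc 0"] by simp_all
  have h01: "h 0 = inv\<^bsub>\<Gamma>\<^esub> x" "h (Suc 0) = inv\<^bsub>\<Gamma>\<^esub> x"
    by (simp_all add: h_def)
  have "?A 0 = 0"
    unfolding d01 h01 by (intro sum.neutral ballI) (use e exponent_gens in auto)
  moreover have "?A (Suc 0) = (\<Sum>i\<in>{2 :: nat}. - 1)"
    unfolding d01 h01 using m e exponent_gens by (intro sum.mono_neutral_cong_right) auto
  moreover have "?A j = 0" if "2 \<le> j" for j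
    using that e by (intro sum.neutral) (auto simp: h_def)
  then have "(\<Sum>j\<le>Suc m. (- 1) ^ j * ?A j) = (\<Sum>j\<in>{0, Suc 0}. (- 1) ^ j * ?A j)"
    by (intro sum.mono_neutral_right) (auto simp: not_less_eq_eq numeral_2_eq_2)
  ultimately show ?thesis
    by (simp del: sum.atMost_Suc)
qed

text \<open>The residue is \<open>- 1\<close>, namely minus the sum of holonomies. In \<open>val\<close> the case distinction is the one of the
  residue of a canonical homotopy, and conjugation invariance replaces the representatives in it by \<open>w\<close>.\<close>

lemma toda_value:
  assumes s: "linear_c (s m 0)" "s (Suc m) = assemble m r (Suc m) K"
    and \<kappa>: "\<And>j c. j \<le> Suc m \<Longrightarrow> c \<in> conj_classes \<Gamma>' \<Longrightarrow> conjugator m r (Suc m) j c (\<kappa> j c)"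
    and K: "\<And>j c. j \<le> Suc m \<Longrightarrow> c \<in> conj_classes \<Gamma>' \<Longrightarrow> canonical_conj_homotopy \<Gamma> (\<kappa> j c) (K j c)"
  shows "log_form exponent (toda_bracket2 m (m - 1) s (Suc 0) z) \<noteq> 0"
proof -
  have reps: "r (Suc m) c \<in> c" "r (Suc m) c' \<in> c'"
    using r classes by (simp_all add: class_reps_def)
  obtain a where a: "a \<in> carrier \<Gamma>'" "r (Suc m) c = a \<otimes>\<^bsub>\<Gamma>'\<^esub> w \<otimes>\<^bsub>\<Gamma>'\<^esub> inv\<^bsub>\<Gamma>'\<^esub> a"
    using reps(1) \<Gamma>'.conj_class_iff[OF w_closed(1)] by blast
  obtain a' where a': "a' \<in> carrier \<Gamma>'" "r (Suc m) c' = a' \<otimes>\<^bsub>\<Gamma>'\<^esub> w' \<otimes>\<^bsub>\<Gamma>'\<^esub> inv\<^bsub>\<Gamma>'\<^esub> a'"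
    using reps(2) \<Gamma>'.conj_class_iff[OF w_closed(2)] by blast
  have rc: "r (Suc m) c \<in> carrier \<Gamma>'" "r (Suc m) c' \<in> carrier \<Gamma>'"
    using a a' w_closed by simp_all
  define val where "val i j g = (if \<epsilon> i (d j (r (Suc m) g)) = 0 then - \<epsilon> i (\<kappa> j g) else 0)" for i j g
  have s_bas: "s (Suc m) 0 (bas (0, g, [])) = (\<Sum>j\<le>Suc m. cscale ((- 1) ^ j) (K j g 0 (bas (0, [d j (r (Suc m) g)]))))"
    if "r (Suc m) g \<in> carrier \<Gamma>'" for g
    using that by (simp add: s(2) assemble_def phi_def D_face_def nerve_to_Ncy_eq close_string_def del: sum.atMost_Suc)
  have log_K: "log_form (\<epsilon> i) (K j g 0 (bas (0, [d j (r (Suc m) g)]))) = Poly_Mapping.single () (of_int (val i j g))"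
    if "i \<le> m" "j \<le> Suc m" "g \<in> conj_classes \<Gamma>'" "r (Suc m) g \<in> carrier \<Gamma>'" for i j g
    using \<Gamma>.log_form_conj_homotopy[OF additive_\<epsilon>[OF that(1)] _ d_closed[OF that(2,4)] K[OF that(2,3)]] \<kappa>[OF that(2,3)]
    by (simp add: val_def conjugator_def)
  have log_s: "log_form (\<epsilon> i) (s (Suc m) 0 z)
      = (\<Sum>j\<le>Suc m. cscale ((- 1) ^ j) (Poly_Mapping.single () (of_int (val i j c - val i j c'))))" if "i \<le> m" for i
  proof -
    have lin: "linear_c (s (Suc m) 0)"
      unfolding s(2) assemble_def by (rule linear_cextend)
    have "log_form (\<epsilon> i) (s (Suc m) 0 (bas (0, g, []))) = (\<Sum>j\<le>Suc m. cscale ((- 1) ^ j) (Poly_Mapping.single () (of_int (val i j g))))"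
      if "g \<in> conj_classes \<Gamma>'" "r (Suc m) g \<in> carrier \<Gamma>'" for g
      unfolding s_bas[OF that(2)] linear_c_simps[OF linear_log_form]
      by (intro sum.cong refl) (simp only: log_K[OF \<open>i \<le> m\<close> _ that] atMost_iff)
    then show ?thesis
      unfolding z_def linear_c_simps[OF lin] linear_c_simps[OF linear_log_form] of_int_diff single_diff cvs.scale_right_diff_distrib sum_subtractf
      using classes rc by simp
  qed
  have "toda_bracket2 m (m - 1) s (Suc 0) z = D_diff m m (s (Suc m) 0 z)"
  proof -
    have "m - 1 + 1 = m" "m - 1 + 2 = Suc m"
      using m by simp_all
    then show ?thesis
      unfolding toda_bracket2_def from_suspension_def by (simp only: diff_Suc_1 C_diff_z linear_c_simps[OF s(1)] add_0)
  qed
  also have "log_form exponent \<dots> = (\<Sum>i\<le>m. cscale ((- 1) ^ i) (log_form (\<epsilon> i) (s (Suc m) 0 z)))"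
    by (simp add: D_diff_def D_face_def linear_c_simps[OF linear_log_form] log_form_map face_exponent_def[abs_def])
  also have "\<dots> = (\<Sum>i\<le>m. cscale ((- 1) ^ i) (\<Sum>j\<le>Suc m. cscale ((- 1) ^ j) (Poly_Mapping.single () (of_int (val i j c - val i j c')))))"
    by (intro sum.cong) (simp_all only: log_s atMost_iff)
  finally have "Poly_Mapping.lookup (log_form exponent (toda_bracket2 m (m - 1) s (Suc 0) z)) ()
      = of_int (\<Sum>i\<le>m. (- 1) ^ i * (\<Sum>j\<le>Suc m. (- 1) ^ j * (val i j c - val i j c')))"
    by (simp add: lookup_sum lookup_cscale lookup_single del: sum.atMost_Suc)
  also have "(\<Sum>i\<le>m. (- 1) ^ i * (\<Sum>j\<le>Suc m. (- 1) ^ j * (val i j c - val i j c')))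
      = (\<Sum>j\<le>Suc m. (- 1) ^ j * (\<Sum>i\<le>m. (- 1) ^ i * (val i j c - val i j c')))"
    unfolding sum_distrib_left by (subst sum.swap) (simp add: mult.left_commute del: sum.atMost_Suc)
  also have "\<dots> = (\<Sum>j\<le>Suc m. (- 1) ^ j * - (\<Sum>i\<le>m. (- 1) ^ i * (if \<epsilon> i (d j w) = 0 then \<epsilon> i (h j) - \<epsilon> i (d j a) + \<epsilon> i (d j a') else 0)))"
  proof (intro sum.cong refl arg_cong[where f = "(*) _"])
    fix j assume "j \<in> {..Suc m}"
    then have j: "j \<le> Suc m" by simp
    have eps: "\<epsilon> i (d j (r (Suc m) c)) = \<epsilon> i (d j w)" "\<epsilon> i (d j (r (Suc m) c')) = \<epsilon> i (d j w)" if "i \<le> m" for i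
    proof -
      interpret dj: group_hom \<Gamma>' \<Gamma> "d j"
        by (rule d_group_hom[OF j])
      note conj = \<Gamma>.additive_conj[OF additive_\<epsilon>[OF that]]
      show "\<epsilon> i (d j (r (Suc m) c)) = \<epsilon> i (d j w)"
        using a w_closed conj d_closed[OF j] by simp
      show "\<epsilon> i (d j (r (Suc m) c')) = \<epsilon> i (d j w)"
        using a' w_closed conj d_closed[OF j] d_w(2)[OF j] h_closed by simp
    qed
    have "(\<Sum>i\<le>m. (- 1) ^ i * (val i j c - val i j c'))
        = - (\<Sum>i\<le>m. (- 1) ^ i * (if \<epsilon> i (d j w) = 0 then \<epsilon> i (\<kappa> j c) - \<epsilon> i (\<kappa> j c') else 0))"
      unfolding sum_negf[symmetric] by (intro sum.cong) (auto simp: val_def eps algebra_simps)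
    then show "(\<Sum>i\<le>m. (- 1) ^ i * (val i j c - val i j c'))
        = - (\<Sum>i\<le>m. (- 1) ^ i * (if \<epsilon> i (d j w) = 0 then \<epsilon> i (h j) - \<epsilon> i (d j a) + \<epsilon> i (d j a') else 0))"
      unfolding conjugator_difference_sum[OF j \<kappa>[OF j classes(1)] \<kappa>[OF j classes(2)] a a'] .
  qed
  also have "\<dots> = - (\<Sum>j\<le>Suc m. (- 1) ^ j * (\<Sum>i\<le>m. (- 1) ^ i * (if \<epsilon> i (d j w) = 0 then \<epsilon> i (h j) else 0)))
      + (\<Sum>j\<le>Suc m. (- 1) ^ j * (\<Sum>i\<le>m. (- 1) ^ i * (if \<epsilon> i (d j w) = 0 then \<epsilon> i (d j a) else 0)))
      - (\<Sum>j\<le>Suc m. (- 1) ^ j * (\<Sum>i\<le>m. (- 1) ^ i * (if \<epsilon> i (d j w) = 0 then \<epsilon> i (d j a') else 0)))"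
    unfolding sum_negf[symmetric] sum.distrib[symmetric] sum_subtractf[symmetric] right_diff_distrib[symmetric]
      distrib_left[symmetric] mult_minus_right[symmetric]
    by (intro sum.cong refl arg_cong[where f = "(*) _"]) auto
  also have "\<dots> = - 1"
    using holonomy_sum gauge_sum[OF a(1)] gauge_sum[OF a'(1)] by simp
  finally show ?thesis
    by auto
qed

end

theorem corollary3p16:
  fixes m :: nat and r :: "nat \<Rightarrow> nat list word set \<Rightarrow> nat list word"
  assumes "even m" and "m \<ge> 2"
    and "class_reps m r"
  shows "(\<exists>s. \<forall>n\<ge>1. canonical_homotopy m r n (s n)) \<and>
    (\<forall>s. (\<forall>n\<ge>1. canonical_homotopy m r n (s n)) \<longrightarrow>
      chain_map (suspension (C_cx m (m + 1))) (D_cx m (m - 1)) (toda_bracket2 m (m - 1) s) \<and>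
      \<not> null_homotopic (suspension (C_cx m (m + 1))) (D_cx m (m - 1)) (toda_bracket2 m (m - 1) s))"
proof (intro conjI allI impI)
  have "\<forall>n. \<exists>s. n \<ge> 1 \<longrightarrow> canonical_homotopy m r n s"
    using canonical_homotopy_exists[OF assms(3)] by auto
  then show "\<exists>s. \<forall>n\<ge>1. canonical_homotopy m r n (s n)"
    by metis
next
  fix s assume s: "\<forall>n\<ge>1. canonical_homotopy m r n (s n)"
  have n: "m - 1 + 2 = m + 1"
    using assms(2) by simp
  show "chain_map (suspension (C_cx m (m + 1))) (D_cx m (m - 1)) (toda_bracket2 m (m - 1) s)"
    using toda_bracket2_chain_map[OF assms(3), of s "m - 1"] s unfolding n canonical_homotopy_iff by blast
next
  fix s assume s: "\<forall>n\<ge>1. canonical_homotopy m r n (s n)"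
  interpret toda m r
    using assms by unfold_locales
  have "canonical_homotopy m r (Suc m) (s (Suc m))"
    using s by simp
  then obtain \<kappa> K where sK: "s (Suc m) = assemble m r (Suc m) K"
    and \<kappa>: "\<And>j c. j \<le> Suc m \<Longrightarrow> c \<in> conj_classes (Gamma m (Suc m)) \<Longrightarrow> conjugator m r (Suc m) j c (\<kappa> j c)"
    and K: "\<And>j c. j \<le> Suc m \<Longrightarrow> c \<in> conj_classes (Gamma m (Suc m)) \<Longrightarrow> canonical_conj_homotopy (Gamma m m) (\<kappa> j c) (K j c)"
    unfolding canonical_homotopy_iff diff_Suc_1 by blast
  have "canonical_homotopy m r m (s m)"
    using s assms(2) by simp
  then have lin: "linear_c (s m 0)"
    unfolding canonical_homotopy_iff chain_homotopy_def graded_map_def by blast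
  show "\<not> null_homotopic (suspension (C_cx m (m + 1))) (D_cx m (m - 1)) (toda_bracket2 m (m - 1) s)"
  proof
    assume "null_homotopic (suspension (C_cx m (m + 1))) (D_cx m (m - 1)) (toda_bracket2 m (m - 1) s)"
    then obtain T where T: "chain_homotopy (suspension (C_cx m (Suc m))) (D_cx m (m - 1)) (toda_bracket2 m (m - 1) s) (\<lambda>_ _. 0) T"
      unfolding null_homotopic_def Suc_eq_plus1 by blast
    have zc: "z \<in> chains (suspension (C_cx m (Suc m))) (Suc 0)"
      using z_supported by (simp add: suspension_def chains_C_cx)
    have linT: "linear_c (T 0)"
      using T unfolding chain_homotopy_def graded_map_def by blast
    have "T (Suc 0) z \<in> supported (D_basis m (m - 1) (Suc 0 + 1))"
      using T zc unfolding chain_homotopy_def graded_map_def chains_D_cx by blast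
    then have Tz: "T (Suc 0) z \<in> supported (D_basis m (m - 1) (Suc (Suc 0)))"
      by simp
    have "bdry (D_cx m (m - 1)) (Suc 0 + 1) (T (Suc 0) z) + T (Suc 0 - 1) (bdry (suspension (C_cx m (Suc m))) (Suc 0) z)
        = toda_bracket2 m (m - 1) s (Suc 0) z - 0"
      using T zc unfolding chain_homotopy_def by blast
    then have "toda_bracket2 m (m - 1) s (Suc 0) z = bdry (D_cx m (m - 1)) (Suc (Suc 0)) (T (Suc 0) z)"
      using bdry_C_zero[OF z_supported] by (simp add: suspension_def linear_c_simps[OF linT])
    then have "log_form exponent (toda_bracket2 m (m - 1) s (Suc 0) z) = 0"
      using group.log_form_bdry[OF group_Gamma additive_exponent[of "Gamma_gens m (m - 1)", folded Gamma_def] Tz]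
      by (simp add: D_cx_def)
    then show False
      using toda_value[OF lin sK \<kappa> K] by simp
  qed
qed

end
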